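(* Let $s\in(0,1)$ and let $n\ge 1$ be an integer with $n>2s$. Then $\mathcal S^{\rm Sr}_s(\mathbb{R}^n_+)\le\mathcal S_s$. Moreover, if $\mathcal S^{\rm Sr}_s(\mathbb{R}^n_+)<\mathcal S_s$, then the infimum $\mathcal S^{\rm Sr}_s(\mathbb{R}^n_+)$ is achieved, i.e. there is $u\in\mathcal D^s_{\rm Sr}(\mathbb{R}^n_+)$ with $u|_{\mathbb{R}^n_+}\neq0$ and $\mathcal E_s(u;\mathbb{R}^{2n}\setminus(\mathbb{R}^n_-)^2)=\mathcal S^{\rm Sr}_s(\mathbb{R}^n_+)\,\|u\|^2_{L^{2^*_s}(\mathbb{R}^n_+)}$.
   Context: Notation: $\mathbb{R}^n_\pm=\{x\in\mathbb{R}^n: x_1\gtrless0\}$, $2^*_s=\frac{2n}{n-2s}$, $C_{n,s}=\frac{s2^{2s}\Gamma(\frac n2+s)}{\pi^{n/2}\Gamma(1-s)}$, and for measurable $Z\subseteq\mathbb{R}^n\times\mathbb{R}^n$ $$\mathcal E_s(u;Z)=\frac{C_{n,s}}{2}\iint_Z\frac{(u(x)-u(y))^2}{|x-y|^{n+2s}}\,dx\,dy .$$ $\mathcal D^s(\mathbb{R}^n)=\{u\in L^{2^*_s}(\mathbb{R}^n): \mathcal E_s(u;\mathbb{R}^n\times\mathbb{R}^n)<\infty\}$ and $$\mathcal S_s=\inf_{u\in\mathcal D^s(\mathbb{R}^n),\,u\neq0}\frac{\mathcal E_s(u;\mathbb{R}^n\times\mathbb{R}^n)}{\|u\|^2_{L^{2^*_s}(\mathbb{R}^n)}}.$$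 Semirestricted case: $\mathcal D^s_{\rm Sr}(\mathbb{R}^n_+)=\{u:\mathbb{R}^n\to\mathbb{R}\text{ measurable}: u|_{\mathbb{R}^n_+}\in L^{2^*_s}(\mathbb{R}^n_+),\ \mathcal E_s(u;\mathbb{R}^{2n}\setminus(\mathbb{R}^n_-)^2)<\infty\}$ and $$\mathcal S^{\rm Sr}_s(\mathbb{R}^n_+)=\inf_{u\in\mathcal D^s_{\rm Sr}(\mathbb{R}^n_+),\,u|_{\mathbb{R}^n_+}\neq0}\frac{\mathcal E_s(u;\mathbb{R}^{2n}\setminus(\mathbb{R}^n_-)^2)}{\|u\|^2_{L^{2^*_s}(\mathbb{R}^n_+)}}.$$ *)

theory Defs
  imports "HOL-Analysis.Analysis"
begin

definition critical_exponent :: "nat \<Rightarrow> real \<Rightarrow> real" where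
  "critical_exponent n s = 2 * real n / (real n - 2 * s)"

definition frac_const :: "nat \<Rightarrow> real \<Rightarrow> real" where
  "frac_const n s =
     s * 2 powr (2 * s) * Gamma (real n / 2 + s) / (pi powr (real n / 2) * Gamma (1 - s))"

text \<open>The coordinate \<open>x\<^sub>1\<close> is the coordinate with index \<open>k\<close>; the finite index type \<open>'n\<close> carries
  no order, so \<open>k\<close> is a parameter.\<close>

definition pos_halfspace :: "'n::finite \<Rightarrow> (real^'n) set" where
  "pos_halfspace k = {x. x $ k > 0}"

definition neg_halfspace :: "'n::finite \<Rightarrow> (real^'n) set" where
  "neg_halfspace k = {x. x $ k < 0}"

text \<open>The energy takes values in \<open>[0,\<infinity>]\<close>. On the diagonal, a null set, the integrand is
  \<open>0 / 0 = 0\<close>.\<close>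

definition energy :: "real \<Rightarrow> (real^'n::finite \<Rightarrow> real) \<Rightarrow> ((real^'n) \<times> (real^'n)) set \<Rightarrow> ennreal" where
  "energy s u Z = ennreal (frac_const CARD('n) s / 2) *
     (\<integral>\<^sup>+z\<in>Z. ennreal ((u (fst z) - u (snd z))\<^sup>2 /
        norm (fst z - snd z) powr (real CARD('n) + 2 * s)) \<partial>lebesgue)"

text \<open>Elements of \<open>L\<^sup>p\<close> are represented by functions; accordingly, being nonzero means not vanishing
  almost everywhere.\<close>

definition Lp_on :: "real \<Rightarrow> 'a::euclidean_space set \<Rightarrow> ('a \<Rightarrow> real) set" where
  "Lp_on p A = {u. u \<in> borel_measurable (lebesgue_on A) \<and>
                   integrable (lebesgue_on A) (\<lambda>x. \<bar>u x\<bar> powr p)}"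

definition Lp_norm_on :: "real \<Rightarrow> 'a::euclidean_space set \<Rightarrow> ('a \<Rightarrow> real) \<Rightarrow> real" where
  "Lp_norm_on p A u = (\<integral>x. \<bar>u x\<bar> powr p \<partial>lebesgue_on A) powr (1 / p)"

definition nonzero_on :: "'a::euclidean_space set \<Rightarrow> ('a \<Rightarrow> real) \<Rightarrow> bool" where
  "nonzero_on A u \<longleftrightarrow> \<not> (AE x in lebesgue_on A. u x = 0)"

definition D_space :: "real \<Rightarrow> (real^'n::finite \<Rightarrow> real) set" where
  "D_space s = {u. u \<in> Lp_on (critical_exponent CARD('n) s) UNIV \<and> energy s u UNIV < \<infinity>}"

text \<open>The infima are taken in \<open>[0,\<infinity>]\<close>; every quotient has a finite numerator and a finite nonzero
  denominator.\<close>

definition S_const :: "'n::finite itself \<Rightarrow> real \<Rightarrow> ennreal" where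
  "S_const _ s = (INF u \<in> {u :: real^'n \<Rightarrow> real. u \<in> D_space s \<and> nonzero_on UNIV u}.
     energy s u UNIV / ennreal ((Lp_norm_on (critical_exponent CARD('n) s) UNIV u)\<^sup>2))"

text \<open>\<open>\<real>\<^sup>2\<^sup>n \<setminus> (\<real>\<^sup>n\<^sub>-)\<^sup>2\<close>\<close>

definition Sr_domain :: "'n::finite \<Rightarrow> ((real^'n) \<times> (real^'n)) set" where
  "Sr_domain k = UNIV - neg_halfspace k \<times> neg_halfspace k"

definition D_space_Sr :: "'n::finite \<Rightarrow> real \<Rightarrow> (real^'n \<Rightarrow> real) set" where
  "D_space_Sr k s = {u. u \<in> borel_measurable lebesgue \<and>
     u \<in> Lp_on (critical_exponent CARD('n) s) (pos_halfspace k) \<and>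
     energy s u (Sr_domain k) < \<infinity>}"

definition S_const_Sr :: "'n::finite \<Rightarrow> real \<Rightarrow> ennreal" where
  "S_const_Sr k s = (INF u \<in> {u. u \<in> D_space_Sr k s \<and> nonzero_on (pos_halfspace k) u}.
     energy s u (Sr_domain k) /
       ennreal ((Lp_norm_on (critical_exponent CARD('n) s) (pos_halfspace k) u)\<^sup>2))"

end

theory Submission
  imports Defs "HOL-Complex_Analysis.Great_Picard"
begin

text \<open>
  Write \<open>H\<close> for the open half-space, \<open>n\<close> for the dimension, \<open>p = 2n/(n
  - 2s)\<close>, \<open>E\<close> for the energy over pairs touching \<open>H\<close>, and
  \<open>S\<^sub>H\<close>, \<open>S\<close> for the two constants.

  The inequality \<open>S\<^sub>H \<le> S\<close> holds because a function on the whole space, pushed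
  into \<open>H\<close> by a large translation, keeps nearly all its norm on \<open>H\<close>, while
  its energy over pairs touching \<open>H\<close> is at most the full energy
  (\<open>S_const_Sr_le_S_const\<close>).

  For the existence of a minimizer, take a normalized minimizing sequence. Three facts carry the
  proof.

  First, after a translation and a dilation the sequence does not vanish. For \<open>x \<in> H\<close>
  let \<open>g(x)\<close> be the inner integral of the energy at \<open>x\<close>. The difference
  between \<open>u(x)\<close> and an average of \<open>u\<close> over a cube of side \<open>r\<close>
  at \<open>x\<close> is at most a multiple of \<open>r\<^sup>s g(x) powr (1/2)\<close>. If all
  averages of \<open>\<bar>u\<bar>\<close> are at most \<open>c r powr (s - n/2)\<close>, then
  choosing the best \<open>r\<close> gives \<open>\<bar>u(x)\<bar>\<^sup>p \<le> C c powr (p - 2)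
  g(x)\<close>, and integration bounds the norm of \<open>u\<close> by a power of \<open>c\<close>. As
  the norm is \<open>1\<close>, the average over some cube in \<open>H\<close> is not small on this
  scale, and the critical rescaling moves that cube into a fixed one
  (\<open>halfspace_nonvanishing_rescaled\<close>). The half-space \<open>H\<close> turns into
  \<open>{x\<^sub>1 > -d\<^sub>j}\<close> with natural numbers \<open>d\<^sub>j\<close>.

  Second, bounded energy gives almost everywhere convergence of a subsequence on the half-spaces:
  averages over dyadic cubes converge along a diagonal subsequence, and they approximate the functions
  in a weighted \<open>L\<^sup>1\<close>, uniformly in \<open>j\<close>
  (\<open>bounded_energy_AE_convergent_subseq\<close>). The energy does not control the functions this
  way off the half-space; there they are replaced by the values that minimize the energy, which depend
  continuously on the values inside (\<open>optimal_extension_tendsto\<close>).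

  Third, almost everywhere convergence splits both the norm and the energy, by the Brezis-Lieb lemma
  applied with exponent \<open>p\<close> to the functions and with exponent \<open>2\<close> to their
  difference quotients. Let \<open>w\<close> be the limit, on the union of the half-spaces, with
  energy \<open>E(w)\<close> over pairs touching this union and with \<open>p\<close>-th power
  integral \<open>t \<in> (0, 1]\<close>. The remainders satisfy the inequality with
  \<open>S\<^sub>H\<close>, so \<open>S\<^sub>H \<ge> E(w) + S\<^sub>H (1 - t) powr (2/p)\<close>;
  since \<open>1 - (1 - t) powr (2/p) \<le> t powr (2/p)\<close>, this yields \<open>E(w) \<le>
  S\<^sub>H t powr (2/p)\<close> (\<open>minimizing_sequence_limit\<close>).

  After passing to a subsequence, either all \<open>d\<^sub>j\<close> agree, and \<open>w\<close> is,
  up to a translation, a minimizer; or \<open>d\<^sub>j\<close> tends to infinity, and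
  \<open>w\<close> lives on the whole space, where it shows \<open>S \<le> S\<^sub>H\<close>. The
  strict inequality excludes the second alternative.
\<close>

section \<open>Splitting of norms under almost everywhere convergence\<close>

lemma nn_integral_lborel_affine:
  fixes f :: "'a::euclidean_space \<Rightarrow> ennreal"
  assumes [measurable]: "f \<in> borel_measurable borel" and "r > 0"
  shows "(\<integral>\<^sup>+x. f x \<partial>lborel) = ennreal (r ^ DIM('a)) * (\<integral>\<^sup>+x. f (a + r *\<^sub>R x) \<partial>lborel)"
proof -
  have "(\<integral>\<^sup>+x. f x \<partial>lborel) =
      (\<integral>\<^sup>+x. f x \<partial>density (distr lborel borel (\<lambda>x. a + r *\<^sub>R x)) (\<lambda>_. ennreal (\<bar>r\<bar> ^ DIM('a))))"
    using lborel_affine[of r a] assms(2) by (simp add: ennreal_power)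
  also have "\<dots> = ennreal (r ^ DIM('a)) * (\<integral>\<^sup>+x. f (a + r *\<^sub>R x) \<partial>lborel)"
    using assms(2) by (subst nn_integral_density) (simp_all add: nn_integral_cmult nn_integral_distr)
  finally show ?thesis .
qed

text \<open>For \<open>b\<close> small compared with \<open>a\<close> the difference is absorbed by
  \<open>e\<close>, by continuity of the power at \<open>1\<close>; otherwise every term is at most a
  multiple of \<open>\<bar>b\<bar>\<^sup>q\<close>.\<close>

lemma powr_abs_add_le:
  fixes q e :: real
  assumes "q > 0" "e > 0"
  obtains C where "C \<ge> 0"
    "\<And>a b :: real. \<bar>\<bar>a + b\<bar> powr q - \<bar>a\<bar> powr q\<bar> \<le> e * \<bar>a\<bar> powr q + C * \<bar>b\<bar> powr q"
proof -
  \<comment> \<open>by homogeneity, only the ratio \<open>t = b / a\<close> matters\<close>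
  have "isCont (\<lambda>t::real. \<bar>1 + t\<bar> powr q) 0"
    using assms by (intro continuous_intros) auto
  then obtain d where d: "d > 0" "\<And>t. \<bar>t\<bar> < d \<Longrightarrow> \<bar>\<bar>1 + t\<bar> powr q - 1\<bar> < e"
    unfolding continuous_at_eps_delta dist_real_def using assms(2) by fastforce
  define C where "C = (1 / d + 1) powr q + (1 / d) powr q"
  have C1: "C \<ge> 1"
  proof -
    have "1 \<le> (1 / d + 1) powr q" using d assms by (intro ge_one_powr_ge_zero) auto
    then show ?thesis unfolding C_def by (simp add: add_increasing2)
  qed
  have key: "\<bar>\<bar>1 + t\<bar> powr q - 1\<bar> \<le> e + C * \<bar>t\<bar> powr q" for t :: real
  proof (cases "\<bar>t\<bar> < d")
    case True
    then show ?thesis using d(2)[of t] C1 by (smt (verit) mult_nonneg_nonneg powr_ge_zero)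
  next
    case False
    then have t: "1 \<le> \<bar>t\<bar> / d" using d(1) by simp
    have "\<bar>1 + t\<bar> \<le> (1 / d + 1) * \<bar>t\<bar>" using t by (simp add: algebra_simps)
    then have 1: "\<bar>1 + t\<bar> powr q \<le> (1 / d + 1) powr q * \<bar>t\<bar> powr q"
      using assms d(1) by (subst powr_mult[symmetric]) (auto intro: powr_mono2)
    have 2: "1 \<le> (1 / d) powr q * \<bar>t\<bar> powr q"
      using assms t d(1) by (subst powr_mult[symmetric]) (auto intro!: ge_one_powr_ge_zero)
    have 3: "\<bar>1 + t\<bar> powr q \<ge> 0" by simp
    have "C * \<bar>t\<bar> powr q = (1 / d + 1) powr q * \<bar>t\<bar> powr q + (1 / d) powr q * \<bar>t\<bar> powr q"
      by (simp add: C_def algebra_simps)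
    moreover have "(1 / d + 1) powr q * \<bar>t\<bar> powr q \<ge> 0" by simp
    ultimately show ?thesis using 1 2 3 assms(2) by linarith
  qed
  show thesis
  proof
    show "C \<ge> 0" using C1 by simp
    fix a b :: real
    show "\<bar>\<bar>a + b\<bar> powr q - \<bar>a\<bar> powr q\<bar> \<le> e * \<bar>a\<bar> powr q + C * \<bar>b\<bar> powr q"
    proof (cases "a = 0")
      case True
      then show ?thesis using C1 by (simp add: mult_right_mono[of 1 C, simplified])
    next
      case False
      have ab: "\<bar>a + b\<bar> = \<bar>a\<bar> * \<bar>1 + b / a\<bar>" "\<bar>b\<bar> = \<bar>a\<bar> * \<bar>b / a\<bar>"
        using False by (simp_all add: abs_mult[symmetric] field_simps)
      have "\<bar>\<bar>a + b\<bar> powr q - \<bar>a\<bar> powr q\<bar> = \<bar>a\<bar> powr q * \<bar>\<bar>1 + b / a\<bar> powr q - 1\<bar>"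
      proof -
        have "\<bar>a + b\<bar> powr q - \<bar>a\<bar> powr q = \<bar>a\<bar> powr q * (\<bar>1 + b / a\<bar> powr q - 1)"
          unfolding ab(1) by (simp add: powr_mult right_diff_distrib del: abs_divide)
        then show ?thesis by (simp add: abs_mult)
      qed
      also have "\<dots> \<le> \<bar>a\<bar> powr q * (e + C * \<bar>b / a\<bar> powr q)"
        by (intro mult_left_mono key) auto
      also have "\<dots> = e * \<bar>a\<bar> powr q + C * \<bar>b\<bar> powr q"
        using arg_cong[OF ab(2), of "\<lambda>t. t powr q"] by (simp add: powr_mult algebra_simps del: abs_divide)
      finally show ?thesis .
    qed
  qed
qed

text \<open>The excess of \<open>g\<close> over a small multiple of a family bounded in
  \<open>L\<^sup>1\<close> tends to zero by dominated convergence. This is the common core of the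
  Brezis-Lieb lemma and of \<open>weighted_L1_tendsto_zero\<close>.\<close>

lemma tendsto_zero_by_dominated_excess:
  fixes g F :: "nat \<Rightarrow> 'a \<Rightarrow> real"
  assumes F: "\<And>j. integrable M (F j)" "\<And>j x. F j x \<ge> 0" "\<And>j. (\<integral>x. F j x \<partial>M) \<le> B"
    and g: "\<And>j. integrable M (g j)" "\<And>j x. g j x \<ge> 0" "AE x in M. (\<lambda>j. g j x) \<longlonglongrightarrow> 0"
    and dom: "\<And>e. e > 0 \<Longrightarrow> \<exists>H. integrable M H \<and> (\<forall>j. AE x in M. g j x \<le> e * F j x + H x)"
  shows "(\<lambda>j. \<integral>x. g j x \<partial>M) \<longlonglongrightarrow> 0"
proof (rule LIMSEQ_I)
  fix r :: real assume r: "r > 0"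
  have B: "B \<ge> 0" using order_trans[OF Bochner_Integration.integral_nonneg F(3)[of 0]] F(2) by auto
  define e where "e = r / (2 * (B + 1))"
  have e: "e > 0" "e * B < r / 2" using r B by (auto simp: e_def field_simps)
  obtain H where H: "integrable M H" "\<And>j. AE x in M. g j x \<le> e * F j x + H x"
    using dom[OF e(1)] by blast
  \<comment> \<open>the excess, dominated by \<open>\<bar>H\<bar>\<close>\<close>
  define W where "W j x = max 0 (g j x - e * F j x)" for j x
  have Wi: "integrable M (W j)" for j unfolding W_def using F(1) g(1) by (intro integrable_max) auto
  have Wlim: "(\<lambda>j. \<integral>x. W j x \<partial>M) \<longlonglongrightarrow> (\<integral>x. 0 \<partial>M)"
  proof (rule integral_dominated_convergence[where w = "\<lambda>x. \<bar>H x\<bar>"])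
    show "integrable M (\<lambda>x. \<bar>H x\<bar>)" using H(1) by simp
    show "AE x in M. norm (W j x) \<le> \<bar>H x\<bar>" for j
      using H(2)[of j] by eventually_elim (auto simp: W_def)
    show "AE x in M. (\<lambda>j. W j x) \<longlonglongrightarrow> 0" using g(3)
    proof eventually_elim
      case (elim x)
      show ?case
        by (rule tendsto_sandwich[OF _ _ tendsto_const elim])
          (use e(1) F(2) g(2) in \<open>auto simp: W_def\<close>)
    qed
  qed (use Wi in auto)
  then obtain N where N: "\<And>j. j \<ge> N \<Longrightarrow> (\<integral>x. W j x \<partial>M) < r / 2"
    using LIMSEQ_D[OF Wlim, of "r / 2"] r by fastforce
  show "\<exists>no. \<forall>n\<ge>no. norm (integral\<^sup>L M (g n) - 0) < r"
  proof (intro exI allI impI)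
    fix n assume n: "n \<ge> N"
    have "(\<integral>x. g n x \<partial>M) \<le> (\<integral>x. W n x + e * F n x \<partial>M)"
      using g(1) Wi F(1) by (intro integral_mono) (auto simp: W_def)
    also have "\<dots> = (\<integral>x. W n x \<partial>M) + e * (\<integral>x. F n x \<partial>M)"
      using Wi F(1) by simp
    also have "\<dots> < r / 2 + r / 2"
      using N[OF n] e mult_left_mono[OF F(3)[of n], of e] by linarith
    finally show "norm (integral\<^sup>L M (g n) - 0) < r"
      using g(2) by (simp add: abs_of_nonneg Bochner_Integration.integral_nonneg)
  qed
qed

lemma abs_diff_powr_le:
  fixes a b q :: real
  assumes "q > 0"
  shows "\<bar>a - b\<bar> powr q \<le> 2 powr q * (\<bar>a\<bar> powr q + \<bar>b\<bar> powr q)"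
proof -
  have "\<bar>a - b\<bar> powr q \<le> (2 * max \<bar>a\<bar> \<bar>b\<bar>) powr q"
    using assms by (intro powr_mono2) auto
  also have "\<dots> = 2 powr q * (max \<bar>a\<bar> \<bar>b\<bar>) powr q" by (simp add: powr_mult)
  also have "\<dots> \<le> 2 powr q * (\<bar>a\<bar> powr q + \<bar>b\<bar> powr q)"
    by (intro mult_left_mono) (auto simp: max_def)
  finally show ?thesis .
qed

lemma integrable_abs_powr_diff:
  fixes f g :: "'a \<Rightarrow> real"
  assumes "q > 0" and [measurable]: "f \<in> borel_measurable M" "g \<in> borel_measurable M"
    and "integrable M (\<lambda>x. \<bar>f x\<bar> powr q)" "integrable M (\<lambda>x. \<bar>g x\<bar> powr q)"
  shows "integrable M (\<lambda>x. \<bar>f x - g x\<bar> powr q)"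
  by (rule Bochner_Integration.integrable_bound[where f = "\<lambda>x. 2 powr q * (\<bar>f x\<bar> powr q + \<bar>g x\<bar> powr q)"])
    (use assms abs_diff_powr_le in \<open>auto simp del: powr_diff\<close>)

text \<open>The limit \<open>f'\<close> is subtracted through approximations \<open>h j\<close> dominated
  by it: below, the functions \<open>f j\<close> and \<open>h j\<close> are cut off to domains that grow
  with \<open>j\<close>, whereas \<open>f'\<close> lives on their union.\<close>

lemma brezis_lieb:
  fixes f h :: "nat \<Rightarrow> 'a \<Rightarrow> real" and f' :: "'a \<Rightarrow> real"
  assumes q: "q > 0"
    and [measurable]: "\<And>j. f j \<in> borel_measurable M" "\<And>j. h j \<in> borel_measurable M" "f' \<in> borel_measurable M"
    and int_f: "\<And>j. integrable M (\<lambda>x. \<bar>f j x\<bar> powr q)" "\<And>j. (\<integral>x. \<bar>f j x\<bar> powr q \<partial>M) \<le> B"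
    and int_f': "integrable M (\<lambda>x. \<bar>f' x\<bar> powr q)"
    and dom: "\<And>j x. \<bar>h j x\<bar> \<le> \<bar>f' x\<bar>"
    and lim_f: "AE x in M. (\<lambda>j. f j x) \<longlonglongrightarrow> f' x"
    and lim_h: "AE x in M. (\<lambda>j. h j x) \<longlonglongrightarrow> f' x"
  shows "(\<lambda>j. (\<integral>x. \<bar>f j x\<bar> powr q \<partial>M) - (\<integral>x. \<bar>f j x - h j x\<bar> powr q \<partial>M)) \<longlonglongrightarrow> (\<integral>x. \<bar>f' x\<bar> powr q \<partial>M)"
proof -
  have ple: "\<bar>h j x\<bar> powr q \<le> \<bar>f' x\<bar> powr q" for j x
    using dom[of j x] q by (intro powr_mono2) auto
  have int_h: "integrable M (\<lambda>x. \<bar>h j x\<bar> powr q)" for j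
    by (rule Bochner_Integration.integrable_bound[OF int_f']) (use ple in auto)
  have int_d: "integrable M (\<lambda>x. \<bar>f j x - h j x\<bar> powr q)" for j
    by (rule integrable_abs_powr_diff) (use q int_f int_h in auto)
  have int_h_le: "(\<integral>x. \<bar>h j x\<bar> powr q \<partial>M) \<le> (\<integral>x. \<bar>f' x\<bar> powr q \<partial>M)" for j
    by (intro integral_mono int_h int_f' ple)
  define F where "F j x = \<bar>f j x - h j x\<bar> powr q" for j x
  define g where "g j x = \<bar>\<bar>f j x\<bar> powr q - \<bar>f j x - h j x\<bar> powr q - \<bar>h j x\<bar> powr q\<bar>" for j x
  have gl: "(\<lambda>j. \<integral>x. g j x \<partial>M) \<longlonglongrightarrow> 0"
  proof (rule tendsto_zero_by_dominated_excess[where F = F and B = "2 powr q * (B + (\<integral>x. \<bar>f' x\<bar> powr q \<partial>M))"])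
    show "integrable M (F j)" for j unfolding F_def by (rule int_d)
    show "F j x \<ge> 0" for j x by (simp add: F_def)
    show "(\<integral>x. F j x \<partial>M) \<le> 2 powr q * (B + (\<integral>x. \<bar>f' x\<bar> powr q \<partial>M))" for j
    proof -
      have "(\<integral>x. F j x \<partial>M) \<le> (\<integral>x. 2 powr q * (\<bar>f j x\<bar> powr q + \<bar>h j x\<bar> powr q) \<partial>M)"
        unfolding F_def by (intro integral_mono int_d abs_diff_powr_le q)
          (use int_f int_h in auto)
      also have "\<dots> = 2 powr q * ((\<integral>x. \<bar>f j x\<bar> powr q \<partial>M) + (\<integral>x. \<bar>h j x\<bar> powr q \<partial>M))"
        using int_f int_h by simp
      also have "\<dots> \<le> 2 powr q * (B + (\<integral>x. \<bar>f' x\<bar> powr q \<partial>M))"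
        using int_f(2)[of j] int_h_le[of j] by (intro mult_left_mono) auto
      finally show ?thesis .
    qed
    show "integrable M (g j)" for j unfolding g_def
      using int_f int_d int_h by (intro integrable_abs Bochner_Integration.integrable_diff) auto
    show "g j x \<ge> 0" for j x by (simp add: g_def)
    show "AE x in M. (\<lambda>j. g j x) \<longlonglongrightarrow> 0" using lim_f lim_h
    proof eventually_elim
      case (elim x)
      have "(\<lambda>j. g j x) \<longlonglongrightarrow> \<bar>\<bar>f' x\<bar> powr q - \<bar>f' x - f' x\<bar> powr q - \<bar>f' x\<bar> powr q\<bar>"
        unfolding g_def
        by (intro tendsto_intros tendsto_powr' elim) (use q in auto)
      then show ?case by simp
    qed
    show "\<exists>H. integrable M H \<and> (\<forall>j. AE x in M. g j x \<le> e * F j x + H x)" if e: "e > 0" for e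
    proof -
      obtain C where C: "C \<ge> 0" "\<And>a b :: real. \<bar>\<bar>a + b\<bar> powr q - \<bar>a\<bar> powr q\<bar> \<le> e * \<bar>a\<bar> powr q + C * \<bar>b\<bar> powr q"
        using powr_abs_add_le[OF q e] by blast
      show ?thesis
      proof (intro exI conjI allI AE_I2)
        show "integrable M (\<lambda>x. (C + 1) * \<bar>f' x\<bar> powr q)" using int_f' by simp
        fix j x
        have "g j x \<le> \<bar>\<bar>f j x\<bar> powr q - \<bar>f j x - h j x\<bar> powr q\<bar> + \<bar>h j x\<bar> powr q"
          unfolding g_def by (smt (verit) powr_ge_zero)
        also have "\<dots> \<le> e * F j x + (C + 1) * \<bar>h j x\<bar> powr q"
          using C(2)[of "f j x - h j x" "h j x"] by (simp add: F_def algebra_simps)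
        also have "\<dots> \<le> e * F j x + (C + 1) * \<bar>f' x\<bar> powr q"
          using ple[of j x] C(1) by (intro add_left_mono mult_left_mono) auto
        finally show "g j x \<le> e * F j x + (C + 1) * \<bar>f' x\<bar> powr q" .
      qed
    qed
  qed
  have hl: "(\<lambda>j. \<integral>x. \<bar>h j x\<bar> powr q \<partial>M) \<longlonglongrightarrow> (\<integral>x. \<bar>f' x\<bar> powr q \<partial>M)"
  proof (rule integral_dominated_convergence[OF _ _ int_f'])
    show "AE x in M. (\<lambda>j. \<bar>h j x\<bar> powr q) \<longlonglongrightarrow> \<bar>f' x\<bar> powr q"
      using lim_h by eventually_elim (intro tendsto_intros tendsto_powr', use q in auto)
  qed (use ple in auto)
  have "(\<lambda>j. \<integral>x. (\<bar>f j x\<bar> powr q - \<bar>f j x - h j x\<bar> powr q - \<bar>h j x\<bar> powr q) \<partial>M) \<longlonglongrightarrow> 0"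
    by (rule Lim_null_comparison[OF _ gl]) (auto simp: g_def intro!: eventuallyI integral_abs_bound)
  from tendsto_add[OF this hl] show ?thesis
    using int_f int_d int_h by simp
qed

text \<open>Young's inequality with a weight, in the form that is needed against a finite
  measure.\<close>

lemma abs_le_powr_plus:
  fixes t q e :: real
  assumes "q > 1" "e > 0"
  shows "\<bar>t\<bar> \<le> e * \<bar>t\<bar> powr q + (1 / e) powr (1 / (q - 1))"
proof (cases "\<bar>t\<bar> \<le> (1 / e) powr (1 / (q - 1))")
  case True
  then show ?thesis using assms(2) by (smt (verit) mult_nonneg_nonneg powr_ge_zero)
next
  case False
  then have t: "\<bar>t\<bar> > (1 / e) powr (1 / (q - 1))" "\<bar>t\<bar> > 0"
    using powr_ge_zero[of "1 / e" "1 / (q - 1)"] by linarith+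
  have "1 / e = ((1 / e) powr (1 / (q - 1))) powr (q - 1)"
    using assms by (simp add: powr_powr)
  also have "\<dots> \<le> \<bar>t\<bar> powr (q - 1)"
    using t assms by (intro powr_mono2) auto
  finally have "1 \<le> e * \<bar>t\<bar> powr (q - 1)" using assms by (simp add: field_simps)
  then have "\<bar>t\<bar> \<le> (e * \<bar>t\<bar> powr (q - 1)) * \<bar>t\<bar>"
    using mult_right_mono[of 1 "e * \<bar>t\<bar> powr (q - 1)" "\<bar>t\<bar>"] by simp
  also have "\<dots> = e * \<bar>t\<bar> powr q" using t(2) by (simp add: powr_diff)
  finally show ?thesis by (smt (verit) powr_ge_zero)
qed

lemma integrable_weight_times_abs:
  fixes w h :: "'a \<Rightarrow> real"
  assumes q: "q > 1" and w: "integrable M w" "\<And>x. 0 \<le> w x" "\<And>x. w x \<le> K"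
    and [measurable]: "h \<in> borel_measurable M" and h: "integrable M (\<lambda>x. \<bar>h x\<bar> powr q)"
  shows "integrable M (\<lambda>x. w x * h x)"
proof (rule Bochner_Integration.integrable_bound[where f = "\<lambda>x. K * \<bar>h x\<bar> powr q + w x"])
  show "AE x in M. norm (w x * h x) \<le> norm (K * \<bar>h x\<bar> powr q + w x)"
  proof (rule AE_I2)
    fix x
    have K: "K \<ge> 0" using w(2,3) order_trans by blast
    have "norm (w x * h x) = w x * \<bar>h x\<bar>" using w(2) by (simp add: abs_mult)
    also have "\<dots> \<le> w x * (\<bar>h x\<bar> powr q + 1)"
      using abs_le_powr_plus[OF q, of 1 "h x"] w(2) by (intro mult_left_mono) auto
    also have "\<dots> = w x * \<bar>h x\<bar> powr q + w x" by (simp add: algebra_simps)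
    also have "\<dots> \<le> K * \<bar>h x\<bar> powr q + w x"
      using w(3) by (intro add_right_mono mult_right_mono) auto
    finally show "norm (w x * h x) \<le> norm (K * \<bar>h x\<bar> powr q + w x)"
      using K w(2)[of x] by simp
  qed
qed (use w h in auto)

text \<open>A bound in \<open>L\<^sup>q\<close> with \<open>q > 1\<close> gives uniform integrability on
  the finite measure with density \<open>w\<close>.\<close>

lemma weighted_L1_tendsto_zero:
  fixes w :: "'a \<Rightarrow> real" and h :: "nat \<Rightarrow> 'a \<Rightarrow> real"
  assumes q: "q > 1" and w: "integrable M w" "\<And>x. 0 \<le> w x" "\<And>x. w x \<le> K"
    and [measurable]: "\<And>j. h j \<in> borel_measurable M"
    and h: "\<And>j. integrable M (\<lambda>x. \<bar>h j x\<bar> powr q)" "\<And>j. (\<integral>x. \<bar>h j x\<bar> powr q \<partial>M) \<le> B"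
    and lim: "AE x in M. (\<lambda>j. h j x) \<longlonglongrightarrow> 0"
  shows "(\<lambda>j. \<integral>x. w x * \<bar>h j x\<bar> \<partial>M) \<longlonglongrightarrow> 0"
proof (rule tendsto_zero_by_dominated_excess[where F = "\<lambda>j x. \<bar>h j x\<bar> powr q" and B = B])
  have K: "K \<ge> 0" using w(2,3) order_trans by blast
  show "integrable M (\<lambda>x. w x * \<bar>h j x\<bar>)" for j
    by (rule integrable_weight_times_abs[OF q w]) (use h in auto)
  show "AE x in M. (\<lambda>j. w x * \<bar>h j x\<bar>) \<longlonglongrightarrow> 0"
    using lim by eventually_elim (auto intro!: tendsto_mult_right_zero tendsto_rabs_zero)
  show "\<exists>H. integrable M H \<and> (\<forall>j. AE x in M. w x * \<bar>h j x\<bar> \<le> e * \<bar>h j x\<bar> powr q + H x)"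
    if e: "e > 0" for e
  proof (intro exI conjI allI AE_I2)
    define e' where "e' = e / (K + 1)"
    have e': "e' > 0" "e' * K \<le> e" using e K by (auto simp: e'_def field_simps)
    let ?C = "(1 / e') powr (1 / (q - 1))"
    show "integrable M (\<lambda>x. ?C * w x)" using w(1) by simp
    fix j x
    have "w x * \<bar>h j x\<bar> \<le> w x * (e' * \<bar>h j x\<bar> powr q + ?C)"
      by (intro mult_left_mono abs_le_powr_plus q e' w)
    also have "\<dots> = (e' * w x) * \<bar>h j x\<bar> powr q + ?C * w x" by (simp add: algebra_simps)
    also have "\<dots> \<le> e * \<bar>h j x\<bar> powr q + ?C * w x"
      using order_trans[OF mult_left_mono[OF w(3)[of x], of e'] e'(2)] e'(1)
      by (intro add_right_mono mult_right_mono) auto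
    finally show "w x * \<bar>h j x\<bar> \<le> e * \<bar>h j x\<bar> powr q + ?C * w x" .
  qed
qed (use h w in auto)

text \<open>Along a subsequence with increments of norm at most \<open>2\<^sup>-\<^sup>k\<close> the sum
  of the absolute increments is integrable, hence finite almost everywhere.\<close>

lemma L1_Cauchy_imp_AE_convergent_subseq:
  fixes f :: "nat \<Rightarrow> 'a \<Rightarrow> real"
  assumes [measurable]: "\<And>j. f j \<in> borel_measurable M"
    and Cauchy: "\<And>e. e > 0 \<Longrightarrow> \<exists>N. \<forall>i\<ge>N. \<forall>j\<ge>N. (\<integral>\<^sup>+x. ennreal \<bar>f i x - f j x\<bar> \<partial>M) \<le> ennreal e"
  obtains r where "strict_mono (r :: nat \<Rightarrow> nat)" "AE x in M. convergent (\<lambda>j. f (r j) x)"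
proof -
  have "\<exists>N. \<forall>k. \<forall>i\<ge>N k. \<forall>j\<ge>N k. (\<integral>\<^sup>+x. ennreal \<bar>f i x - f j x\<bar> \<partial>M) \<le> ennreal ((1/2) ^ k)"
    by (intro choice allI Cauchy) auto
  then obtain N where N: "\<And>k i j. i \<ge> N k \<Longrightarrow> j \<ge> N k \<Longrightarrow> (\<integral>\<^sup>+x. ennreal \<bar>f i x - f j x\<bar> \<partial>M) \<le> ennreal ((1/2) ^ k)"
    by blast
  \<comment> \<open>strictly increasing and at least \<open>N k\<close>\<close>
  define r where "r k = (\<Sum>i\<le>k. Suc (N i))" for k
  have r: "strict_mono r" by (rule strict_monoI_Suc) (simp add: r_def)
  have rN: "r k \<ge> N k" "r (Suc k) \<ge> N k" for k by (cases k; simp add: r_def)+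
  have "(\<integral>\<^sup>+x. (\<Sum>k. ennreal \<bar>f (r (Suc k)) x - f (r k) x\<bar>) \<partial>M)
      = (\<Sum>k. \<integral>\<^sup>+x. ennreal \<bar>f (r (Suc k)) x - f (r k) x\<bar> \<partial>M)"
    by (rule nn_integral_suminf) measurable
  also have "\<dots> \<le> (\<Sum>k. ennreal ((1/2) ^ k))"
    by (intro suminf_le N rN) auto
  also have "\<dots> = ennreal (\<Sum>k. (1/2) ^ k)"
    by (rule suminf_ennreal2) (auto simp: summable_geometric)
  also have "\<dots> < \<infinity>" by simp
  finally have "AE x in M. (\<Sum>k. ennreal \<bar>f (r (Suc k)) x - f (r k) x\<bar>) \<noteq> \<infinity>"
    by (intro nn_integral_PInf_AE) auto
  then have "AE x in M. convergent (\<lambda>j. f (r j) x)"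
  proof eventually_elim
    case (elim x)
    then have "summable (\<lambda>k. \<bar>f (r (Suc k)) x - f (r k) x\<bar>)"
      by (intro summable_suminf_not_top) auto
    then have "summable (\<lambda>k. f (r (Suc k)) x - f (r k) x)" by (rule summable_rabs_cancel)
    then have "(\<lambda>n. \<Sum>k<n. f (r (Suc k)) x - f (r k) x) \<longlonglongrightarrow> (\<Sum>k. f (r (Suc k)) x - f (r k) x)"
      by (rule summable_LIMSEQ)
    then have "(\<lambda>n. f (r n) x - f (r 0) x) \<longlonglongrightarrow> (\<Sum>k. f (r (Suc k)) x - f (r k) x)"
      by (simp only: sum_lessThan_telescope[of "\<lambda>n. f (r n) x"])
    from tendsto_add[OF this tendsto_const[of "f (r 0) x"]] show ?case
      by (auto simp: convergent_def)
  qed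
  with r show thesis by (rule that)
qed

text \<open>The integral over the dyadic shell \<open>\<delta> 2\<^sup>m \<le> \<bar>x\<bar> < \<delta>
  2\<^sup>m\<^sup>+\<^sup>1\<close> is a multiple of \<open>2 powr (- a m)\<close>.\<close>

lemma nn_integral_powr_at_infinity:
  fixes \<delta> a :: real
  assumes "\<delta> > 0" "a > 0"
  shows "(\<integral>\<^sup>+x\<in>{x::'a::euclidean_space. norm x \<ge> \<delta>}. ennreal (norm x powr - (real DIM('a) + a)) \<partial>lborel) < \<infinity>"
proof -
  let ?n = "real DIM('a)"
  let ?R = "\<lambda>m. \<delta> * 2 ^ Suc m"
  define V where "V = emeasure lborel (ball (0::'a) 1)"
  have V: "V < \<infinity>" unfolding V_def using emeasure_lborel_ball_finite by blast
  define v where "v = enn2real V"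
  have v: "V = ennreal v" "v \<ge> 0" using V by (auto simp: v_def)
  have ball: "emeasure lborel (ball (0::'a) R) = ennreal (R ^ DIM('a)) * V" if "R > 0" for R
  proof -
    have "emeasure lborel (ball (0::'a) R) = (\<integral>\<^sup>+x. indicator (ball 0 R) (x::'a) \<partial>lborel)" by simp
    also have "\<dots> = ennreal (R ^ DIM('a)) * (\<integral>\<^sup>+x. indicator (ball 0 R) (0 + R *\<^sub>R x :: 'a) \<partial>lborel)"
      using that by (intro nn_integral_lborel_affine borel_measurable_indicator) auto
    also have "(\<lambda>x. indicator (ball 0 R) (0 + R *\<^sub>R x :: 'a)) = (indicator (ball 0 1) :: 'a \<Rightarrow> ennreal)"
      using that by (auto simp: indicator_def)
    finally show ?thesis by (simp add: V_def)
  qed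
  have term_le: "h m \<le> (\<Sum>m. h m)" for h :: "nat \<Rightarrow> ennreal" and m
    using sum_le_suminf[OF summableI, of "{m}" h] by simp
  have pw: "ennreal (norm x powr - (?n + a)) * indicator {x. norm x \<ge> \<delta>} x
      \<le> (\<Sum>m. ennreal ((\<delta> * 2 ^ m) powr - (?n + a)) * indicator (ball 0 (?R m)) x)" for x :: 'a
  proof (cases "norm x \<ge> \<delta>")
    case True
    obtain k where k: "norm x / \<delta> < 2 ^ k" using real_arch_pow[of 2 "norm x / \<delta>"] by auto
    define l where "l = (LEAST k. norm x / \<delta> < 2 ^ k)"
    have l: "norm x / \<delta> < 2 ^ l" unfolding l_def using k by (rule LeastI)
    have "l \<noteq> 0" using l True assms(1) by (intro notI) auto
    then obtain m where m: "l = Suc m" by (cases l) auto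
    have lm: "\<not> norm x / \<delta> < 2 ^ m" using not_less_Least[of m "\<lambda>k. norm x / \<delta> < 2 ^ k"] m l_def by simp
    have "ennreal (norm x powr - (?n + a)) \<le> ennreal ((\<delta> * 2 ^ m) powr - (?n + a))"
      using lm assms by (intro ennreal_leI powr_mono2') (auto simp: field_simps)
    also have "\<dots> = ennreal ((\<delta> * 2 ^ m) powr - (?n + a)) * indicator (ball 0 (?R m)) x"
      using l m assms(1) by (simp add: field_simps)
    also have "\<dots> \<le> (\<Sum>m. ennreal ((\<delta> * 2 ^ m) powr - (?n + a)) * indicator (ball 0 (?R m)) x)"
      by (rule term_le)
    finally show ?thesis using True by simp
  qed simp
  have term_eq: "ennreal ((\<delta> * 2 ^ m) powr - (?n + a)) * (ennreal (?R m ^ DIM('a)) * V)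
      = ennreal (v * 2 ^ DIM('a) * \<delta> powr - a * (2 powr - a) ^ m)" for m
  proof -
    have pos: "\<delta> * 2 ^ m > 0" using assms by simp
    have "(\<delta> * 2 ^ m) powr - (?n + a) * ?R m ^ DIM('a)
        = (\<delta> * 2 ^ m) powr - (?n + a) * (2 ^ DIM('a) * (\<delta> * 2 ^ m) powr ?n)"
    proof -
      have "?R m = 2 * (\<delta> * 2 ^ m)" by simp
      then have "?R m ^ DIM('a) = (2 * (\<delta> * 2 ^ m)) ^ DIM('a)" by (simp only:)
      also have "\<dots> = 2 ^ DIM('a) * (\<delta> * 2 ^ m) powr ?n"
        unfolding powr_realpow[OF pos] by (rule power_mult_distrib)
      finally show ?thesis by (simp only:)
    qed
    also have "\<dots> = 2 ^ DIM('a) * (\<delta> * 2 ^ m) powr (- (?n + a) + ?n)"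
      unfolding powr_add by (simp only: mult.left_commute)
    also have "(\<delta> * 2 ^ m) powr (- (?n + a) + ?n) = \<delta> powr - a * (2 powr - a) ^ m"
    proof -
      have "(2 ^ m) powr - a = ((2::real) powr - a) ^ m"
        by (simp add: powr_realpow[symmetric] powr_powr mult.commute)
      then show ?thesis using assms by (simp add: powr_mult)
    qed
    finally show ?thesis
      using v assms by (simp add: ennreal_mult[symmetric] mult.commute mult.left_commute)
  qed
  have "(\<integral>\<^sup>+x\<in>{x::'a. norm x \<ge> \<delta>}. ennreal (norm x powr - (?n + a)) \<partial>lborel)
      \<le> (\<integral>\<^sup>+x. (\<Sum>m. ennreal ((\<delta> * 2 ^ m) powr - (?n + a)) * indicator (ball 0 (?R m)) (x::'a)) \<partial>lborel)"
    by (intro nn_integral_mono pw)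
  also have "\<dots> = (\<Sum>m. ennreal ((\<delta> * 2 ^ m) powr - (?n + a)) * (ennreal (?R m ^ DIM('a)) * V))"
  proof -
    have "(\<integral>\<^sup>+x. c * indicator (ball 0 (?R m)) (x::'a) \<partial>lborel) = c * (ennreal (?R m ^ DIM('a)) * V)" for c m
      using ball[of "?R m"] assms(1) by (subst nn_integral_cmult_indicator) (simp_all del: power_Suc)
    moreover have "(\<lambda>x::'a. c * indicator (ball 0 (?R m)) x) \<in> borel_measurable lborel" for c :: ennreal and m
      by (intro borel_measurable_times_ennreal borel_measurable_const borel_measurable_indicator) simp
    ultimately show ?thesis by (simp only: nn_integral_suminf)
  qed
  also have "\<dots> = (\<Sum>m. ennreal (v * 2 ^ DIM('a) * \<delta> powr - a * (2 powr - a) ^ m))"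
    by (simp only: term_eq)
  also have "\<dots> = ennreal (\<Sum>m. v * 2 ^ DIM('a) * \<delta> powr - a * (2 powr - a) ^ m)"
    using v assms
    by (intro suminf_ennreal2 summable_mult summable_geometric) (auto simp: powr_less_one)
  also have "\<dots> < \<infinity>" by simp
  finally show ?thesis .
qed

section \<open>Cubes\<close>

text \<open>The floor makes the cubes half-open, so that for each \<open>m\<close> they partition the
  space.\<close>

definition dyadic_cube :: "nat \<Rightarrow> int^'n \<Rightarrow> (real^'n::finite) set" where
  "dyadic_cube m i = {y. \<forall>l. \<lfloor>2 ^ m * y $ l\<rfloor> = i $ l}"

definition dyadic_index :: "nat \<Rightarrow> real^'n::finite \<Rightarrow> int^'n" where
  "dyadic_index m x = (\<chi> l. \<lfloor>2 ^ m * x $ l\<rfloor>)"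

lemma mem_dyadic_cube_iff: "y \<in> dyadic_cube m i \<longleftrightarrow> dyadic_index m y = i"
  by (auto simp: dyadic_cube_def dyadic_index_def vec_eq_iff)

lemma emeasure_lborel_cube:
  fixes x :: "real^'n::finite"
  assumes "r \<ge> 0"
  shows "emeasure lborel (box x (\<chi> l. x $ l + r)) = ennreal (r ^ CARD('n))"
    and "emeasure lborel (cbox x (\<chi> l. x $ l + r)) = ennreal (r ^ CARD('n))"
proof -
  have *: "((\<chi> l. x $ l + r) - x) \<bullet> b = r" if b: "b \<in> Basis" for b
    using b by (auto simp: Basis_vec_def inner_axis)
  have le: "x \<bullet> b \<le> (\<chi> l. x $ l + r) \<bullet> b" if b: "b \<in> Basis" for b
    using *[OF b] assms by (simp add: inner_diff_left)
  have p: "(\<Prod>b\<in>Basis. ((\<chi> l. x $ l + r) - x) \<bullet> b) = r ^ CARD('n)"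
    using * by simp
  show "emeasure lborel (box x (\<chi> l. x $ l + r)) = ennreal (r ^ CARD('n))"
    using emeasure_lborel_box[OF le] p by simp
  show "emeasure lborel (cbox x (\<chi> l. x $ l + r)) = ennreal (r ^ CARD('n))"
    using emeasure_lborel_cbox[OF le] p by simp
qed

lemma norm_le_card_times:
  fixes x :: "real^'n::finite"
  assumes "\<And>l. \<bar>x $ l\<bar> \<le> r"
  shows "norm x \<le> real CARD('n) * r"
proof -
  have "norm x \<le> (\<Sum>l\<in>UNIV. \<bar>x $ l\<bar>)" by (rule norm_le_l1_cart)
  also have "\<dots> \<le> (\<Sum>l\<in>(UNIV::'n set). r)" by (intro sum_mono assms)
  finally show ?thesis by simp
qed

lemma borel_dyadic_cube [measurable]: "dyadic_cube m i \<in> sets borel"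
proof -
  have "(\<lambda>y::real^'a. y $ l) \<in> borel_measurable borel" for l
    by (intro borel_measurable_continuous_onI continuous_intros)
  note [measurable] = this
  show ?thesis unfolding dyadic_cube_def by measurable
qed

lemma emeasure_dyadic_cube:
  "emeasure lborel (dyadic_cube m i :: (real^'n::finite) set) = ennreal ((1 / 2 ^ m) ^ CARD('n))"
proof -
  define a :: "real^'n" where "a = (\<chi> l. real_of_int (i $ l) / 2 ^ m)"
  let ?b = "\<chi> l. a $ l + 1 / 2 ^ m"
  have 1: "box a ?b \<subseteq> dyadic_cube m i"
  proof
    fix y assume y: "y \<in> box a ?b"
    have "\<lfloor>2 ^ m * y $ l\<rfloor> = i $ l" for l
    proof -
      have "a $ l < y $ l" "y $ l < a $ l + 1 / 2 ^ m" using y by (auto simp: mem_box_cart)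
      then show ?thesis unfolding a_def by (intro floor_unique) (auto simp: field_simps)
    qed
    then show "y \<in> dyadic_cube m i" by (simp add: dyadic_cube_def)
  qed
  have 2: "dyadic_cube m i \<subseteq> cbox a ?b"
  proof
    fix y :: "real^'n" assume "y \<in> dyadic_cube m i"
    then have *: "\<lfloor>2 ^ m * y $ l\<rfloor> = i $ l" for l by (simp add: dyadic_cube_def)
    have "real_of_int (i $ l) \<le> 2 ^ m * y $ l \<and> 2 ^ m * y $ l < real_of_int (i $ l) + 1" for l
      using *[of l] floor_eq_iff[of "2 ^ m * y $ l" "i $ l"] by simp
    then have "a $ l \<le> y $ l \<and> y $ l \<le> a $ l + 1 / 2 ^ m" for l
      unfolding a_def by (auto simp: field_simps intro: less_imp_le)
    then show "y \<in> cbox a ?b" by (simp add: mem_box_cart)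
  qed
  show ?thesis
  proof (rule antisym)
    show "emeasure lborel (dyadic_cube m i :: (real^'n) set) \<le> ennreal ((1 / 2 ^ m) ^ CARD('n))"
      using emeasure_mono[OF 2, of lborel] emeasure_lborel_cube(2)[of "1 / 2 ^ m" a] by simp
    show "ennreal ((1 / 2 ^ m) ^ CARD('n)) \<le> emeasure lborel (dyadic_cube m i :: (real^'n) set)"
      using emeasure_mono[OF 1, of lborel] emeasure_lborel_cube(1)[of "1 / 2 ^ m" a] by simp
  qed
qed

lemma dist_in_dyadic_cube:
  fixes x y :: "real^'n::finite"
  assumes "x \<in> dyadic_cube m i" "y \<in> dyadic_cube m i"
  shows "norm (x - y) \<le> real CARD('n) * (1 / 2 ^ m)"
proof (rule norm_le_card_times)
  fix l
  have "\<lfloor>2 ^ m * x $ l\<rfloor> = \<lfloor>2 ^ m * y $ l\<rfloor>" using assms by (simp add: dyadic_cube_def)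
  then have "\<bar>2 ^ m * x $ l - 2 ^ m * y $ l\<bar> < 1"  by linarith
  then have "2 ^ m * \<bar>x $ l - y $ l\<bar> < 1"
    by (simp add: abs_mult[symmetric] right_diff_distrib[symmetric])
  then show "\<bar>(x - y) $ l\<bar> \<le> 1 / 2 ^ m" by (simp add: field_simps)
qed

section \<open>The Gagliardo seminorm and its scaling\<close>

lemma borel_fst_snd [measurable]:
  "fst \<in> borel_measurable (borel :: ('a::euclidean_space \<times> 'b::euclidean_space) measure)"
  "snd \<in> borel_measurable (borel :: ('a::euclidean_space \<times> 'b::euclidean_space) measure)"
  by (intro borel_measurable_continuous_onI continuous_intros)+

lemma nn_integral_lborel_pair:
  fixes F :: "'a::euclidean_space \<times> 'b::euclidean_space \<Rightarrow> ennreal"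
  assumes "F \<in> borel_measurable borel"
  shows "(\<integral>\<^sup>+z. F z \<partial>lborel) = (\<integral>\<^sup>+x. \<integral>\<^sup>+y. F (x, y) \<partial>lborel \<partial>lborel)"
  using lborel.nn_integral_fst[of F lborel] assms by (simp add: lborel_prod)

lemma nn_integral_lborel_pair_swap:
  fixes F :: "'a::euclidean_space \<times> 'b::euclidean_space \<Rightarrow> ennreal"
  assumes "F \<in> borel_measurable borel"
  shows "(\<integral>\<^sup>+z. F z \<partial>lborel) = (\<integral>\<^sup>+y. \<integral>\<^sup>+x. F (x, y) \<partial>lborel \<partial>lborel)"
  using lborel_pair.nn_integral_snd[of F] assms by (simp add: lborel_prod)

text \<open>The exponent is half of \<open>n + 2 s\<close>, so that the square is the integrand of the
  energy; being linear in \<open>u\<close>, the difference quotient is what the Brezis-Lieb lemma is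
  applied to.\<close>

definition diffquot :: "real \<Rightarrow> (real^'n::finite \<Rightarrow> real) \<Rightarrow> (real^'n) \<times> (real^'n) \<Rightarrow> real" where
  "diffquot s u z = (u (fst z) - u (snd z)) / norm (fst z - snd z) powr ((real CARD('n) + 2 * s) / 2)"

definition touching :: "'a set \<Rightarrow> ('a \<times> 'a) set" where
  "touching \<Omega> = \<Omega> \<times> UNIV \<union> UNIV \<times> \<Omega>"

text \<open>The energy without its normalizing constant. The union \<open>\<Omega> \<times> UNIV \<union>
  UNIV \<times> \<Omega>\<close> depends monotonically on \<open>\<Omega>\<close>, so that one definition
  serves half-spaces and the whole space.\<close>

definition seminorm2 :: "real \<Rightarrow> (real^'n::finite) set \<Rightarrow> (real^'n \<Rightarrow> real) \<Rightarrow> ennreal" where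
  "seminorm2 s \<Omega> u = (\<integral>\<^sup>+z\<in>touching \<Omega>. ennreal ((diffquot s u z)\<^sup>2) \<partial>lborel)"

text \<open>The \<open>p\<close>-th power of the norm, kept in \<open>[0,\<infinity>]\<close> so that it
  is defined for every \<open>u\<close>.\<close>

definition mass :: "real \<Rightarrow> (real^'n::finite) set \<Rightarrow> (real^'n \<Rightarrow> real) \<Rightarrow> ennreal" where
  "mass p \<Omega> u = (\<integral>\<^sup>+x\<in>\<Omega>. ennreal (\<bar>u x\<bar> powr p) \<partial>lborel)"

text \<open>The sign is chosen such that the half-spaces increase with \<open>d\<close>.\<close>

definition halfspace :: "'n::finite \<Rightarrow> real \<Rightarrow> (real^'n) set" where
  "halfspace k d = {x. x $ k > - d}"

lemma open_halfspace: "open (halfspace k d)"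
  unfolding halfspace_def by (intro open_Collect_less continuous_intros)

lemma borel_halfspace [measurable]: "halfspace k d \<in> sets borel"
  by (rule borel_open[OF open_halfspace])

lemma borel_diffquot:
  assumes [measurable]: "u \<in> borel_measurable borel"
  shows "diffquot s u \<in> borel_measurable borel"
  unfolding diffquot_def[abs_def] by measurable

lemma borel_touching:
  fixes \<Omega> :: "'a::euclidean_space set"
  assumes [measurable]: "\<Omega> \<in> sets borel"
  shows "touching \<Omega> \<in> sets borel"
proof -
  have "touching \<Omega> = {z. fst z \<in> \<Omega> \<or> snd z \<in> \<Omega>}" by (auto simp: touching_def)
  then show ?thesis by simp
qed

lemma diffquot_diff: "diffquot s (\<lambda>x. u x - v x) z = diffquot s u z - diffquot s v z"
  by (simp add: diffquot_def diff_divide_distrib)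

lemma diffquot_square_le:
  fixes u :: "real^'n::finite \<Rightarrow> real"
  assumes "norm (x - y) \<le> \<rho>" "s > 0"
  shows "(u x - u y)\<^sup>2 \<le> \<rho> powr (real CARD('n) + 2 * s) * (diffquot s u (x, y))\<^sup>2"
proof (cases "x = y")
  case False
  let ?N = "norm (x - y)"
  have "(u x - u y)\<^sup>2 = (?N powr ((real CARD('n) + 2 * s) / 2))\<^sup>2 * (diffquot s u (x, y))\<^sup>2"
    using False by (simp add: diffquot_def power_divide)
  also have "(?N powr ((real CARD('n) + 2 * s) / 2))\<^sup>2 = ?N powr (real CARD('n) + 2 * s)"
    by (simp add: power2_eq_square powr_add[symmetric])
  also have "\<dots> * (diffquot s u (x, y))\<^sup>2 \<le> \<rho> powr (real CARD('n) + 2 * s) * (diffquot s u (x, y))\<^sup>2"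
    using assms by (intro mult_right_mono powr_mono2) auto
  finally show ?thesis .
qed simp

text \<open>The amplitude \<open>r powr (n/2 - s)\<close> makes the difference quotient of the rescaled
  function equal to \<open>r\<^sup>n\<close> times the rescaled difference quotient;
  \<open>r\<^sup>2\<^sup>n\<close> is the Jacobian on the product. With the same amplitude the critical
  mass is invariant as well, see \<open>mass_rescale\<close>.\<close>

lemma seminorm2_rescale:
  fixes u :: "real^'n::finite \<Rightarrow> real"
  assumes [measurable]: "u \<in> borel_measurable borel" "\<Omega> \<in> sets borel" and r: "r > 0"
  shows "seminorm2 s {x. a + r *\<^sub>R x \<in> \<Omega>} (\<lambda>x. r powr (real CARD('n) / 2 - s) * u (a + r *\<^sub>R x))
       = seminorm2 s \<Omega> u"
proof -
  have [measurable]: "diffquot s u \<in> borel_measurable borel" by (rule borel_diffquot) measurable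
  have [measurable]: "touching \<Omega> \<in> sets borel" by (rule borel_touching) measurable
  let ?n = "real CARD('n)"
  let ?v = "\<lambda>x. r powr (?n / 2 - s) * u (a + r *\<^sub>R x)"
  let ?W = "{x. a + r *\<^sub>R x \<in> \<Omega>}"
  have dq: "diffquot s ?v z = r ^ CARD('n) * diffquot s u ((a, a) + r *\<^sub>R z)" for z
  proof -
    let ?e = "(?n + 2 * s) / 2"
    have n: "norm (fst ((a, a) + r *\<^sub>R z) - snd ((a, a) + r *\<^sub>R z)) = r * norm (fst z - snd z)"
      using r by (simp add: scaleR_diff_right[symmetric])
    have "r powr (?n / 2 - s) = r ^ CARD('n) / r powr ?e"
      using r by (simp add: powr_realpow[symmetric] powr_diff[symmetric] field_simps)
    then show ?thesis
      using r unfolding diffquot_def n by (simp add: powr_mult right_diff_distrib diff_divide_distrib)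
  qed
  have "seminorm2 s \<Omega> u = ennreal (r ^ DIM((real^'n) \<times> (real^'n))) *
      (\<integral>\<^sup>+z. ennreal ((diffquot s u ((a, a) + r *\<^sub>R z))\<^sup>2) * indicator (touching \<Omega>) ((a, a) + r *\<^sub>R z) \<partial>lborel)"
    unfolding seminorm2_def by (rule nn_integral_lborel_affine[OF _ r]) measurable
  also have "\<dots> = (\<integral>\<^sup>+z. ennreal (r ^ DIM((real^'n) \<times> (real^'n))) *
      (ennreal ((diffquot s u ((a, a) + r *\<^sub>R z))\<^sup>2) * indicator (touching \<Omega>) ((a, a) + r *\<^sub>R z)) \<partial>lborel)"
    by (rule nn_integral_cmult[symmetric]) measurable
  also have "\<dots> = seminorm2 s ?W ?v"
    unfolding seminorm2_def dq using r
    by (intro nn_integral_cong)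
      (auto simp: indicator_def touching_def power_mult_distrib ennreal_mult[symmetric] power2_eq_square[of "r ^ CARD('n)"] power_add)
  finally show ?thesis by simp
qed

lemma mass_rescale:
  fixes u :: "real^'n::finite \<Rightarrow> real"
  assumes [measurable]: "u \<in> borel_measurable borel" "\<Omega> \<in> sets borel" and r: "r > 0"
    and p: "p * (real CARD('n) / 2 - s) = real CARD('n)"
  shows "mass p {x. a + r *\<^sub>R x \<in> \<Omega>} (\<lambda>x. r powr (real CARD('n) / 2 - s) * u (a + r *\<^sub>R x)) = mass p \<Omega> u"
proof -
  let ?n = "real CARD('n)"
  have pw: "\<bar>r powr (?n / 2 - s) * u y\<bar> powr p = r ^ CARD('n) * \<bar>u y\<bar> powr p" for y
    using r p by (simp add: abs_mult powr_mult powr_powr powr_realpow mult.commute[of _ p])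
  have "mass p \<Omega> u = ennreal (r ^ DIM(real^'n)) *
      (\<integral>\<^sup>+x. ennreal (\<bar>u (a + r *\<^sub>R x)\<bar> powr p) * indicator \<Omega> (a + r *\<^sub>R x) \<partial>lborel)"
    unfolding mass_def by (rule nn_integral_lborel_affine[OF _ r]) measurable
  also have "\<dots> = (\<integral>\<^sup>+x. ennreal (r ^ DIM(real^'n)) *
      (ennreal (\<bar>u (a + r *\<^sub>R x)\<bar> powr p) * indicator \<Omega> (a + r *\<^sub>R x)) \<partial>lborel)"
    by (rule nn_integral_cmult[symmetric]) measurable
  also have "\<dots> = mass p {x. a + r *\<^sub>R x \<in> \<Omega>} (\<lambda>x. r powr (?n / 2 - s) * u (a + r *\<^sub>R x))"
    unfolding mass_def pw using r
    by (intro nn_integral_cong) (auto simp: indicator_def ennreal_mult[symmetric])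
  finally show ?thesis by simp
qed

section \<open>Averages over cubes and the non-vanishing of minimizing sequences\<close>

definition local_energy :: "real \<Rightarrow> (real^'n::finite) set \<Rightarrow> (real^'n \<Rightarrow> real) \<Rightarrow> real^'n \<Rightarrow> ennreal" where
  "local_energy s \<Omega> u x = (\<integral>\<^sup>+y\<in>\<Omega>. ennreal ((diffquot s u (x, y))\<^sup>2) \<partial>lborel)"

lemma borel_local_energy:
  assumes [measurable]: "u \<in> borel_measurable borel" "\<Omega> \<in> sets borel"
  shows "local_energy s \<Omega> u \<in> borel_measurable borel"
proof -
  have [measurable]: "diffquot s u \<in> borel_measurable borel" by (rule borel_diffquot) measurable
  have "(\<lambda>z. ennreal ((diffquot s u z)\<^sup>2) * indicator \<Omega> (snd z)) \<in> borel_measurable (lborel \<Otimes>\<^sub>M lborel)"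
    unfolding lborel_prod by measurable
  from lborel.borel_measurable_nn_integral_fst[OF this]
  show ?thesis by (simp add: local_energy_def[abs_def])
qed

lemma nn_integral_local_energy_le:
  assumes [measurable]: "u \<in> borel_measurable borel" "\<Omega> \<in> sets borel"
  shows "(\<integral>\<^sup>+x\<in>\<Omega>. local_energy s \<Omega> u x \<partial>lborel) \<le> seminorm2 s \<Omega> u"
proof -
  have [measurable]: "diffquot s u \<in> borel_measurable borel" by (rule borel_diffquot) measurable
  have [measurable]: "touching \<Omega> \<in> sets borel" by (rule borel_touching) measurable
  have "(\<integral>\<^sup>+x\<in>\<Omega>. local_energy s \<Omega> u x \<partial>lborel)
      = (\<integral>\<^sup>+x. \<integral>\<^sup>+y. ennreal ((diffquot s u (x, y))\<^sup>2) * indicator \<Omega> (snd (x, y)) * indicator \<Omega> (fst (x, y)) \<partial>lborel \<partial>lborel)"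
    unfolding local_energy_def by (intro nn_integral_cong) (auto simp: indicator_def)
  also have "\<dots> = (\<integral>\<^sup>+z. ennreal ((diffquot s u z)\<^sup>2) * indicator \<Omega> (snd z) * indicator \<Omega> (fst z) \<partial>lborel)"
    by (rule nn_integral_lborel_pair[symmetric]) measurable
  also have "\<dots> \<le> seminorm2 s \<Omega> u"
    unfolding seminorm2_def by (intro nn_integral_mono) (auto simp: indicator_def touching_def)
  finally show ?thesis .
qed

text \<open>Integrate \<open>\<bar>a\<bar> \<le> t + a\<^sup>2/t\<close> over \<open>Q\<close> and use
  that the kernel is at least \<open>\<rho> powr (- n - 2 s)\<close> there. This linear form replaces the
  Cauchy-Schwarz inequality; \<open>t\<close> is chosen later.\<close>

lemma nn_integral_abs_diff_le:
  fixes u :: "real^'n::finite \<Rightarrow> real"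
  assumes [measurable]: "u \<in> borel_measurable borel" "Q \<in> sets borel"
    and Q: "AE y in lborel. y \<in> Q \<longrightarrow> y \<in> \<Omega> \<and> norm (x - y) \<le> \<rho>" and t: "t > 0" and s: "s > 0"
    and [measurable]: "\<Omega> \<in> sets borel"
  shows "(\<integral>\<^sup>+y\<in>Q. ennreal \<bar>u x - u y\<bar> \<partial>lborel)
    \<le> ennreal t * emeasure lborel Q + ennreal (\<rho> powr (real CARD('n) + 2 * s) / t) * local_energy s \<Omega> u x"
proof -
  have [measurable]: "diffquot s u \<in> borel_measurable borel" by (rule borel_diffquot) measurable
  let ?K = "\<rho> powr (real CARD('n) + 2 * s)"
  have "(\<integral>\<^sup>+y\<in>Q. ennreal \<bar>u x - u y\<bar> \<partial>lborel)
     \<le> (\<integral>\<^sup>+y. ennreal t * indicator Q y + ennreal (?K / t) * (ennreal ((diffquot s u (x, y))\<^sup>2) * indicator \<Omega> y) \<partial>lborel)"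
  proof (rule nn_integral_mono_AE)
    show "AE y in lborel. ennreal \<bar>u x - u y\<bar> * indicator Q y
      \<le> ennreal t * indicator Q y + ennreal (?K / t) * (ennreal ((diffquot s u (x, y))\<^sup>2) * indicator \<Omega> y)"
      using Q
    proof eventually_elim
      case (elim y)
      show ?case
      proof (cases "y \<in> Q")
        case True
        let ?d = "u x - u y"
        have "0 \<le> t * \<bar>?d\<bar>" using t by simp
        then have "t * \<bar>?d\<bar> \<le> 2 * t * \<bar>?d\<bar>" by linarith
        also have "\<dots> \<le> t\<^sup>2 + \<bar>?d\<bar>\<^sup>2" by (rule sum_squares_bound)
        also have "\<dots> = t\<^sup>2 + ?d\<^sup>2" by simp
        finally have "t * \<bar>?d\<bar> \<le> t\<^sup>2 + ?d\<^sup>2" .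
        then have "\<bar>?d\<bar> \<le> t + ?d\<^sup>2 / t"
          using t by (simp add: field_simps power2_eq_square)
        also have "\<dots> \<le> t + ?K * (diffquot s u (x, y))\<^sup>2 / t"
          using diffquot_square_le[of x y \<rho> s u] elim True s t by (intro add_left_mono divide_right_mono) auto
        finally have "ennreal \<bar>?d\<bar> \<le> ennreal (t + ?K / t * (diffquot s u (x, y))\<^sup>2)" by (simp add: ennreal_leI)
        also have "\<dots> = ennreal t + ennreal (?K / t) * ennreal ((diffquot s u (x, y))\<^sup>2)"
          using t by (subst ennreal_plus) (auto simp: ennreal_mult[symmetric])
        finally show ?thesis using True elim by simp
      qed simp
    qed
  qed
  also have "\<dots> = ennreal t * emeasure lborel Q + ennreal (?K / t) * local_energy s \<Omega> u x"
  proof -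
    have m: "(\<lambda>y. ennreal ((diffquot s u (x, y))\<^sup>2) * indicator \<Omega> y) \<in> borel_measurable lborel"
      by measurable
    have mQ: "(\<lambda>y. ennreal t * indicator Q y) \<in> borel_measurable lborel" by measurable
    show ?thesis
      unfolding local_energy_def nn_integral_add[OF mQ borel_measurable_times_ennreal[OF borel_measurable_const m]]
        nn_integral_cmult[OF m] by (subst nn_integral_cmult_indicator) auto
  qed
  finally show ?thesis .
qed

text \<open>Compare \<open>u x\<close> with the average over the cube of side \<open>r\<close> at the
  corner \<open>x\<close>. These cubes stay in the half-space when \<open>x\<close> does.\<close>

lemma abs_le_of_small_averages:
  fixes u :: "real^'n::finite \<Rightarrow> real" and x :: "real^'n"
  defines "n \<equiv> real CARD('n)"
  assumes s: "s > 0" and c: "c > 0" and r: "r > 0" and g: "g \<ge> 0"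
    and [measurable]: "u \<in> borel_measurable borel" "\<Omega> \<in> sets borel"
    and cube: "box x (\<chi> l. x $ l + r) \<subseteq> \<Omega>"
    and small: "(\<integral>\<^sup>+y\<in>box x (\<chi> l. x $ l + r). ennreal \<bar>u y\<bar> \<partial>lborel) \<le> ennreal (c * r powr (n / 2 + s))"
    and le: "local_energy s \<Omega> u x = ennreal g"
  shows "\<bar>u x\<bar> \<le> 2 * c * r powr - (n / 2 - s) + n powr (n + 2 * s) / c * r powr (n / 2 + s) * g"
proof -
  let ?Q = "box x (\<chi> l. x $ l + r)"
  \<comment> \<open>the size of the average itself, so that two of the three terms coincide\<close>
  define t where "t = c * r powr - (n / 2 - s)"
  have t: "t > 0" using c r by (simp add: t_def)
  let ?E = "(n * r) powr (n + 2 * s) / t"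
  have [measurable]: "?Q \<in> sets borel" by simp
  have mu: "(\<lambda>y. ennreal \<bar>u x - u y\<bar> * indicator ?Q y) \<in> borel_measurable lborel"
      "(\<lambda>y. ennreal \<bar>u y\<bar> * indicator ?Q y) \<in> borel_measurable lborel"
    by measurable
  have rn: "r ^ CARD('n) = r powr n" using r by (simp add: n_def powr_realpow)
  have near: "norm (x - y) \<le> n * r" if "y \<in> ?Q" for y
    unfolding n_def
  proof (rule norm_le_card_times)
    fix l show "\<bar>(x - y) $ l\<bar> \<le> r" using that by (auto simp: mem_box_cart dest: spec[of _ l])
  qed
  have "ennreal (\<bar>u x\<bar> * r ^ CARD('n)) = (\<integral>\<^sup>+y\<in>?Q. ennreal \<bar>u x\<bar> \<partial>lborel)"
    using r by (subst nn_integral_cmult_indicator) (simp_all add: emeasure_lborel_cube ennreal_mult)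
  also have "\<dots> \<le> (\<integral>\<^sup>+y. ennreal \<bar>u x - u y\<bar> * indicator ?Q y + ennreal \<bar>u y\<bar> * indicator ?Q y \<partial>lborel)"
    by (intro nn_integral_mono) (auto simp: indicator_def ennreal_plus[symmetric] simp del: ennreal_plus intro!: ennreal_leI)
  also have "\<dots> = (\<integral>\<^sup>+y\<in>?Q. ennreal \<bar>u x - u y\<bar> \<partial>lborel) + (\<integral>\<^sup>+y\<in>?Q. ennreal \<bar>u y\<bar> \<partial>lborel)"
    by (rule nn_integral_add[OF mu])
  also have "\<dots> \<le> (ennreal t * emeasure lborel ?Q + ennreal ?E * local_energy s \<Omega> u x)
      + ennreal (c * r powr (n / 2 + s))"
    unfolding n_def
    by (intro add_mono nn_integral_abs_diff_le t s small[unfolded n_def])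
      (use near cube in \<open>auto simp: n_def\<close>)
  also have "\<dots> = ennreal (t * r ^ CARD('n) + ?E * g + c * r powr (n / 2 + s))"
    using t c r g by (simp add: le emeasure_lborel_cube ennreal_mult[symmetric] ennreal_plus[symmetric] del: ennreal_plus)
  finally have "\<bar>u x\<bar> * r ^ CARD('n) \<le> t * r ^ CARD('n) + ?E * g + c * r powr (n / 2 + s)"
    using t c r g by (subst (asm) ennreal_le_iff) (auto intro!: add_nonneg_nonneg)
  then have "\<bar>u x\<bar> \<le> t + ?E * g / r powr n + c * r powr (n / 2 + s) / r powr n"
    using r by (simp add: rn field_simps)
  also have "c * r powr (n / 2 + s) / r powr n = t"
  proof -
    have "r powr (n / 2 + s) = r powr - (n / 2 - s) * r powr n" by (simp add: powr_add[symmetric])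
    then show ?thesis using r by (simp add: t_def)
  qed
  also have "?E * g / r powr n = n powr (n + 2 * s) / c * r powr (n / 2 + s) * g"
  proof -
    have "(n * r) powr (n + 2 * s) = n powr (n + 2 * s) * (r powr - (n / 2 - s) * r powr n * r powr (n / 2 + s))"
      using r by (simp add: powr_mult powr_add[symmetric] n_def)
    then show ?thesis using r c by (simp add: t_def)
  qed
  finally show ?thesis by (simp add: t_def)
qed

text \<open>The bound of \<open>abs_le_of_small_averages\<close> is optimal up to a constant when its two
  terms balance, that is for \<open>r\<^sup>n g = c\<^sup>2\<close>, where \<open>g\<close> is the local
  energy. With \<open>p\<close> critical, raising it to the power \<open>p\<close> leaves exactly one
  factor \<open>g\<close>. This is a pointwise form of the improved Sobolev inequality, with the supremum
  of the averages as a Morrey norm.\<close>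

lemma powr_le_local_energy:
  fixes u :: "real^'n::finite \<Rightarrow> real" and x :: "real^'n"
  defines "n \<equiv> real CARD('n)"
  assumes s: "s > 0" and ns: "n > 2 * s" and p: "p * (n / 2 - s) = n" "p > 2" and c: "c > 0"
    and [measurable]: "u \<in> borel_measurable borel" "\<Omega> \<in> sets borel"
    and cube: "\<And>r. r > 0 \<Longrightarrow> box x (\<chi> l. x $ l + r) \<subseteq> \<Omega>"
    and small: "\<And>r. r > 0 \<Longrightarrow>
      (\<integral>\<^sup>+y\<in>box x (\<chi> l. x $ l + r). ennreal \<bar>u y\<bar> \<partial>lborel) \<le> ennreal (c * r powr (n / 2 + s))"
  shows "ennreal (\<bar>u x\<bar> powr p) \<le> ennreal ((2 + n powr (n + 2 * s)) powr p * c powr (p - 2)) * local_energy s \<Omega> u x"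
proof -
  define a where "a = n / 2 - s"
  have a: "a > 0" using ns by (simp add: a_def)
  have n: "n > 0" by (simp add: n_def)
  define C where "C = n powr (n + 2 * s)"
  have C: "C > 0" using n by (simp add: C_def)
  define K where "K = (2 + C) powr p * c powr (p - 2)"
  have K: "K > 0" using C c by (simp add: K_def)
  show ?thesis
  proof (cases "local_energy s \<Omega> u x")
    case top
    then have "ennreal K * local_energy s \<Omega> u x = top" using K by (simp add: ennreal_mult_top)
    then show ?thesis unfolding K_def C_def by (simp only: top_greatest)
  next
    case (real g)
    have main: "\<bar>u x\<bar> \<le> 2 * c * r powr - a + C / c * r powr (n / 2 + s) * g" if "r > 0" for r
      unfolding C_def a_def
      using abs_le_of_small_averages[OF s c that real(1) _ _ cube[OF that] small[OF that, unfolded n_def] real(2)]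
      by (simp add: n_def)
    have "\<bar>u x\<bar> powr p \<le> K * g"
    proof (cases "g = 0")
      case True
      have "\<not> \<bar>u x\<bar> > 0"
      proof
        assume pos: "\<bar>u x\<bar> > 0"
        \<comment> \<open>without local energy the bound tends to zero as \<open>r\<close> grows; this \<open>r\<close> makes it half of \<open>\<bar>u x\<bar>\<close>\<close>
        define r where "r = (4 * c / \<bar>u x\<bar>) powr (1 / a)"
        have r: "r > 0" using pos c by (simp add: r_def)
        have "r powr - a = \<bar>u x\<bar> / (4 * c)"
          using pos c a by (simp add: r_def powr_powr powr_minus)
        then show False using main[OF r] True pos c by (simp add: field_simps)
      qed
      then show ?thesis using True p by simp
    next
      case False
      then have g: "g > 0" using real by simp
      \<comment> \<open>the solution of \<open>r\<^sup>n g = c\<^sup>2\<close>\<close>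
      define r where "r = (c\<^sup>2 / g) powr (1 / n)"
      have r: "r > 0" using g c by (simp add: r_def)
      have rn: "r powr n = c\<^sup>2 / g" using g c n by (simp add: r_def powr_powr)
      have "r powr (n / 2 + s) = r powr - a * r powr n"
        by (simp add: powr_add[symmetric] a_def)
      then have "C / c * r powr (n / 2 + s) * g = C * c * r powr - a"
        using g c by (simp add: rn power2_eq_square)
      then have "\<bar>u x\<bar> \<le> (2 + C) * c * r powr - a" using main[OF r] by (simp add: algebra_simps)
      then have "\<bar>u x\<bar> powr p \<le> ((2 + C) * c * r powr - a) powr p"
        using p by (intro powr_mono2) auto
      also have "\<dots> = (2 + C) powr p * c powr p * r powr - n"
      proof -
        have "p * a = n" using p(1) by (simp only: a_def)
        then have "- a * p = - n" by (simp add: mult.commute)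
        then show ?thesis using C c by (simp add: powr_mult powr_powr)
      qed
      also have "r powr - n = g / c\<^sup>2" using rn by (simp add: powr_minus)
      also have "(2 + C) powr p * c powr p * (g / c\<^sup>2) = K * g"
        using c by (simp add: K_def powr_diff powr_numeral)
      finally show ?thesis .
    qed
    then show ?thesis using real K unfolding K_def C_def by (simp add: ennreal_mult[symmetric])
  qed
qed

text \<open>Otherwise \<open>powr_le_local_energy\<close> integrates to a mass of at most
  \<open>1/2\<close>, by the choice of \<open>c\<close>.\<close>

lemma halfspace_nonvanishing_average:
  fixes k :: "'n::finite"
  defines "n \<equiv> real CARD('n)"
  assumes s: "s > 0" and ns: "n > 2 * s" and p: "p * (n / 2 - s) = n" "p > 2" and M: "M > 0"
  obtains c where "c > 0"
    "\<And>u :: real^'n \<Rightarrow> real. u \<in> borel_measurable borel \<Longrightarrow> mass p (halfspace k 0) u = 1 \<Longrightarrow>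
       seminorm2 s (halfspace k 0) u \<le> ennreal M \<Longrightarrow>
       \<exists>x\<in>halfspace k 0. \<exists>r>0. ennreal (c * r powr (n / 2 + s))
         < (\<integral>\<^sup>+y\<in>box x (\<chi> l. x $ l + r). ennreal \<bar>u y\<bar> \<partial>lborel)"
proof -
  define A where "A = (2 + n powr (n + 2 * s)) powr p"
  have "2 + n powr (n + 2 * s) > 0" by (simp add: add_pos_nonneg)
  then have A: "A > 0" by (simp add: A_def)
  \<comment> \<open>this needs \<open>p > 2\<close>: the power of \<open>c\<close> in the pointwise bound must be positive\<close>
  define c where "c = (1 / (2 * A * M)) powr (1 / (p - 2))"
  have c: "c > 0" "A * c powr (p - 2) * M = 1 / 2"
    using A M p by (simp_all add: c_def powr_powr)
  show thesis
  proof (rule that[OF c(1)], rule ccontr)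
    fix u :: "real^'n \<Rightarrow> real"
    assume [measurable]: "u \<in> borel_measurable borel" and m: "mass p (halfspace k 0) u = 1"
      and e: "seminorm2 s (halfspace k 0) u \<le> ennreal M"
      and neg: "\<not> (\<exists>x\<in>halfspace k 0. \<exists>r>0. ennreal (c * r powr (n / 2 + s))
         < (\<integral>\<^sup>+y\<in>box x (\<chi> l. x $ l + r). ennreal \<bar>u y\<bar> \<partial>lborel))"
    let ?H = "halfspace k 0"
    let ?L = "local_energy s ?H u"
    have [measurable]: "?L \<in> borel_measurable borel" by (rule borel_local_energy) measurable
    have pw: "ennreal (\<bar>u x\<bar> powr p) \<le> ennreal (A * c powr (p - 2)) * ?L x" if "x \<in> ?H" for x
      unfolding A_def n_def
    proof (rule powr_le_local_energy)
      show "box x (\<chi> l. x $ l + r) \<subseteq> ?H" if "r > 0" for r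
        using \<open>x \<in> ?H\<close> by (auto simp: halfspace_def mem_box_cart intro: less_trans)
      show "(\<integral>\<^sup>+y\<in>box x (\<chi> l. x $ l + r). ennreal \<bar>u y\<bar> \<partial>lborel)
          \<le> ennreal (c * r powr (real CARD('n) / 2 + s))" if "r > 0" for r
        using neg that \<open>x \<in> ?H\<close> unfolding n_def by (meson not_less)
    qed (use s ns p c in \<open>auto simp: n_def\<close>)
    have "1 = (\<integral>\<^sup>+x\<in>?H. ennreal (\<bar>u x\<bar> powr p) \<partial>lborel)" using m by (simp add: mass_def)
    also have "\<dots> \<le> (\<integral>\<^sup>+x. ennreal (A * c powr (p - 2)) * (?L x * indicator ?H x) \<partial>lborel)"
      using pw by (intro nn_integral_mono) (auto simp: indicator_def)
    also have "\<dots> = ennreal (A * c powr (p - 2)) * (\<integral>\<^sup>+x\<in>?H. ?L x \<partial>lborel)"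
      by (rule nn_integral_cmult) measurable
    also have "\<dots> \<le> ennreal (A * c powr (p - 2)) * ennreal M"
      by (intro mult_left_mono order_trans[OF nn_integral_local_energy_le e]) auto
    also have "\<dots> = ennreal (A * c powr (p - 2) * M)"
      using c A M by (intro ennreal_mult[symmetric]) auto
    finally have "ennreal 1 \<le> ennreal (1 / 2)" by (simp only: c(2) ennreal_1)
    then have "(1::real) \<le> 1 / 2" by (subst (asm) ennreal_le_iff) auto
    then show False by simp
  qed
qed

text \<open>The cube found by \<open>halfspace_nonvanishing_average\<close> is scaled to unit size and
  moved close to the origin. Translating along \<open>k\<close> by an integer multiple of its side only,
  rather than exactly to the origin, makes \<open>d\<close> a natural number; the price is that the fixed
  cube has side \<open>2\<close>.\<close>

lemma halfspace_nonvanishing_rescaled: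
  fixes k :: "'n::finite"
  defines "n \<equiv> real CARD('n)"
  assumes s: "s > 0" and ns: "n > 2 * s" and p: "p * (n / 2 - s) = n" "p > 2" and M: "M > 0"
  obtains c where "c > 0"
    "\<And>u :: real^'n \<Rightarrow> real. u \<in> borel_measurable borel \<Longrightarrow> mass p (halfspace k 0) u = 1 \<Longrightarrow>
       seminorm2 s (halfspace k 0) u \<le> ennreal M \<Longrightarrow>
       \<exists>(d::nat) v. v \<in> borel_measurable borel \<and> mass p (halfspace k (real d)) v = 1 \<and>
         seminorm2 s (halfspace k (real d)) v = seminorm2 s (halfspace k 0) u \<and>
         ennreal c \<le> (\<integral>\<^sup>+y\<in>box 0 (\<chi> l. 2). ennreal \<bar>v y\<bar> \<partial>lborel)"
proof -
  obtain c where c: "c > 0" and nonv: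
    "\<And>u :: real^'n \<Rightarrow> real. u \<in> borel_measurable borel \<Longrightarrow> mass p (halfspace k 0) u = 1 \<Longrightarrow>
       seminorm2 s (halfspace k 0) u \<le> ennreal M \<Longrightarrow>
       \<exists>x\<in>halfspace k 0. \<exists>r>0. ennreal (c * r powr (n / 2 + s))
         < (\<integral>\<^sup>+y\<in>box x (\<chi> l. x $ l + r). ennreal \<bar>u y\<bar> \<partial>lborel)"
    by (rule halfspace_nonvanishing_average[where k = k, OF s ns[unfolded n_def] p(1)[unfolded n_def] p(2) M, folded n_def]) blast
  show thesis
  proof (rule that[OF c])
    fix u :: "real^'n \<Rightarrow> real"
    assume u [measurable]: "u \<in> borel_measurable borel" and m: "mass p (halfspace k 0) u = 1"
      and e: "seminorm2 s (halfspace k 0) u \<le> ennreal M"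
    obtain x r where x: "x \<in> halfspace k 0" and r: "r > 0" and
      big: "ennreal (c * r powr (n / 2 + s)) < (\<integral>\<^sup>+y\<in>box x (\<chi> l. x $ l + r). ennreal \<bar>u y\<bar> \<partial>lborel)"
      using nonv[OF u m e] by blast
    define d where "d = nat \<lfloor>x $ k / r\<rfloor>"
    \<comment> \<open>the rescaling \<open>y \<mapsto> a + r y\<close> maps \<open>halfspace k d\<close> onto the original half-space\<close>
    define a :: "real^'n" where "a = (\<chi> l. if l = k then r * real d else x $ l)"
    define v where "v y = r powr (n / 2 - s) * u (a + r *\<^sub>R y)" for y
    have [measurable]: "v \<in> borel_measurable borel" unfolding v_def by measurable
    have xk: "x $ k > 0" using x by (simp add: halfspace_def)
    have d: "real d \<le> x $ k / r" "x $ k / r < real d + 1"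
      using xk r by (simp_all add: d_def)
    have pre: "{y. a + r *\<^sub>R y \<in> halfspace k 0} = halfspace k (real d)"
    proof -
      have "(a + r *\<^sub>R y) $ k = r * (real d + y $ k)" for y
        by (simp add: a_def algebra_simps)
      then show ?thesis using r by (auto simp: halfspace_def zero_less_mult_iff)
    qed
    have 1: "mass p (halfspace k (real d)) v = 1"
      using mass_rescale[of u "halfspace k 0" r p s a] p r m
      by (simp add: pre n_def v_def[abs_def])
    have 2: "seminorm2 s (halfspace k (real d)) v = seminorm2 s (halfspace k 0) u"
      using seminorm2_rescale[of u "halfspace k 0" r s a] r
      by (simp add: pre n_def v_def[abs_def])
    have sub: "y \<in> box 0 (\<chi> l. 2)" if y: "a + r *\<^sub>R y \<in> box x (\<chi> l. x $ l + r)" for y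
    proof -
      have "0 < y $ l \<and> y $ l < 2" for l
      proof (cases "l = k")
        case True
        have b: "x $ k < r * real d + r * y $ k" "r * real d + r * y $ k < x $ k + r"
          using y True by (auto simp: mem_box_cart a_def dest: spec[of _ k])
        have "x $ k / r < real d + y $ k" "real d + y $ k < x $ k / r + 1"
          using b r by (simp_all add: field_simps)
        then show ?thesis unfolding True using d by linarith
      next
        case False
        have "x $ l < x $ l + r * y $ l" "x $ l + r * y $ l < x $ l + r"
          using y False by (auto simp: mem_box_cart a_def dest: spec[of _ l])
        then show ?thesis using r by (auto simp: zero_less_mult_iff)
      qed
      then show ?thesis by (simp add: mem_box_cart)
    qed
    let ?I = "\<integral>\<^sup>+y\<in>box 0 (\<chi> l. 2). ennreal \<bar>v y\<bar> \<partial>lborel"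
    have "ennreal (c * r powr (n / 2 + s)) \<le> (\<integral>\<^sup>+y\<in>box x (\<chi> l. x $ l + r). ennreal \<bar>u y\<bar> \<partial>lborel)"
      using big by simp
    also have "\<dots> = ennreal (r ^ DIM(real^'n)) *
       (\<integral>\<^sup>+y. ennreal \<bar>u (a + r *\<^sub>R y)\<bar> * indicator (box x (\<chi> l. x $ l + r)) (a + r *\<^sub>R y) \<partial>lborel)"
      by (rule nn_integral_lborel_affine[OF _ r]) measurable
    also have "\<dots> \<le> ennreal (r ^ DIM(real^'n)) *
       (\<integral>\<^sup>+y. ennreal (r powr - (n / 2 - s)) * (ennreal \<bar>v y\<bar> * indicator (box 0 (\<chi> l. 2)) y) \<partial>lborel)"
    proof (intro mult_left_mono nn_integral_mono)
      fix y
      have "\<bar>u (a + r *\<^sub>R y)\<bar> = r powr - (n / 2 - s) * \<bar>v y\<bar>"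
        using r powr_minus[of r "n / 2 - s"] by (simp add: v_def abs_mult del: minus_diff_eq)
      then show "ennreal \<bar>u (a + r *\<^sub>R y)\<bar> * indicator (box x (\<chi> l. x $ l + r)) (a + r *\<^sub>R y)
        \<le> ennreal (r powr - (n / 2 - s)) * (ennreal \<bar>v y\<bar> * indicator (box 0 (\<chi> l. 2)) y)"
        using sub[of y] by (auto simp: indicator_def ennreal_mult[symmetric])
    qed simp
    also have "\<dots> = ennreal (r ^ DIM(real^'n)) * (ennreal (r powr - (n / 2 - s)) * ?I)"
    proof -
      have m: "(\<lambda>y. ennreal \<bar>v y\<bar> * indicator (box 0 (\<chi> l. 2)) y) \<in> borel_measurable lborel"
        by (intro borel_measurable_times_ennreal borel_measurable_indicator) simp_all
      show ?thesis unfolding nn_integral_cmult[OF m] ..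
    qed
    also have "\<dots> = ennreal (r powr (n / 2 + s)) * ?I"
      unfolding mult.assoc[symmetric]
      using r by (simp add: ennreal_mult[symmetric] powr_realpow[symmetric] powr_add[symmetric] n_def algebra_simps)
    finally have le: "ennreal (c * r powr (n / 2 + s)) \<le> ennreal (r powr (n / 2 + s)) * ?I" .
    have "ennreal c = ennreal (1 / r powr (n / 2 + s)) * ennreal (c * r powr (n / 2 + s))"
      using r c by (simp add: ennreal_mult[symmetric])
    also have "\<dots> \<le> ennreal (1 / r powr (n / 2 + s)) * (ennreal (r powr (n / 2 + s)) * ?I)"
      by (rule mult_left_mono[OF le]) simp
    also have "\<dots> = ?I"
      unfolding mult.assoc[symmetric] using r by (simp add: ennreal_mult[symmetric])
    finally have 3: "ennreal c \<le> ?I" .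
    show "\<exists>(d::nat) v. v \<in> borel_measurable borel \<and> mass p (halfspace k (real d)) v = 1 \<and>
         seminorm2 s (halfspace k (real d)) v = seminorm2 s (halfspace k 0) u \<and>
         ennreal c \<le> (\<integral>\<^sup>+y\<in>box 0 (\<chi> l. 2). ennreal \<bar>v y\<bar> \<partial>lborel)"
      using 1 2 3 by (intro exI[of _ d] exI[of _ v]) simp
  qed
qed

section \<open>Compactness on half-spaces\<close>

lemma AE_lborel_coordinate_neq: "AE x in lborel. (x :: real^'n::finite) $ k \<noteq> c"
proof -
  have "{x :: real^'n. x $ k = c} \<in> null_sets lebesgue"
    using negligible_standard_hyperplane[of "axis k 1 :: real^'n" c]
    by (simp add: negligible_iff_null_sets cart_eq_inner_axis axis_in_Basis_iff)
  moreover have "closed {x :: real^'n. x $ k = c}"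
    by (intro closed_Collect_eq continuous_intros)
  ultimately have "{x :: real^'n. x $ k = c} \<in> null_sets lborel"
    by (simp add: null_sets_completion_iff)
  from AE_not_in[OF this] show ?thesis by simp
qed

lemma mass_Bochner:
  assumes [measurable]: "u \<in> borel_measurable borel" "\<Omega> \<in> sets borel" and fin: "mass p \<Omega> u < \<infinity>"
  shows "integrable lborel (\<lambda>x. \<bar>indicat_real \<Omega> x * u x\<bar> powr p)"
    and "mass p \<Omega> u = ennreal (\<integral>x. \<bar>indicat_real \<Omega> x * u x\<bar> powr p \<partial>lborel)"
proof -
  have eq: "mass p \<Omega> u = (\<integral>\<^sup>+x. ennreal (\<bar>indicat_real \<Omega> x * u x\<bar> powr p) \<partial>lborel)"
    unfolding mass_def by (intro nn_integral_cong) (auto simp: indicator_def)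
  show i: "integrable lborel (\<lambda>x. \<bar>indicat_real \<Omega> x * u x\<bar> powr p)"
    using fin unfolding eq by (intro integrableI_nonneg) auto
  show "mass p \<Omega> u = ennreal (\<integral>x. \<bar>indicat_real \<Omega> x * u x\<bar> powr p \<partial>lborel)"
    unfolding eq by (intro nn_integral_eq_integral i) auto
qed

lemma seminorm2_Bochner:
  assumes u: "u \<in> borel_measurable borel" "\<Omega> \<in> sets borel" and fin: "seminorm2 s \<Omega> u < \<infinity>"
  shows "integrable lborel (\<lambda>z. \<bar>indicat_real (touching \<Omega>) z * diffquot s u z\<bar> powr 2)"
    and "seminorm2 s \<Omega> u = ennreal (\<integral>z. \<bar>indicat_real (touching \<Omega>) z * diffquot s u z\<bar> powr 2 \<partial>lborel)"
proof -
  have [measurable]: "diffquot s u \<in> borel_measurable borel" by (rule borel_diffquot[OF u(1)])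
  have [measurable]: "touching \<Omega> \<in> sets borel" by (rule borel_touching[OF u(2)])
  have eq: "seminorm2 s \<Omega> u = (\<integral>\<^sup>+z. ennreal (\<bar>indicat_real (touching \<Omega>) z * diffquot s u z\<bar> powr 2) \<partial>lborel)"
    unfolding seminorm2_def by (intro nn_integral_cong) (auto simp: indicator_def powr_numeral)
  show i: "integrable lborel (\<lambda>z. \<bar>indicat_real (touching \<Omega>) z * diffquot s u z\<bar> powr 2)"
    using fin unfolding eq by (intro integrableI_nonneg) auto
  show "seminorm2 s \<Omega> u = ennreal (\<integral>z. \<bar>indicat_real (touching \<Omega>) z * diffquot s u z\<bar> powr 2 \<partial>lborel)"
    unfolding eq by (intro nn_integral_eq_integral i) auto
qed

lemma measurable_dyadic_index [measurable]: "dyadic_index m \<in> borel \<rightarrow>\<^sub>M count_space UNIV"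
proof -
  have "dyadic_index m -` {i} \<inter> space borel \<in> sets borel" for i
  proof -
    have "dyadic_index m -` {i} \<inter> space borel = dyadic_cube m i" by (auto simp: mem_dyadic_cube_iff)
    then show ?thesis by simp
  qed
  then show ?thesis by (subst measurable_count_space_eq_countable) auto
qed

definition dyadic_average :: "nat \<Rightarrow> (real^'n::finite \<Rightarrow> real) \<Rightarrow> int^'n \<Rightarrow> real" where
  "dyadic_average m f i = (2 ^ m) ^ CARD('n) * (\<integral>y. indicat_real (dyadic_cube m i) y * f y \<partial>lborel)"

lemma integrable_indicator_dyadic_cube: "integrable lborel (indicat_real (dyadic_cube m i))"
  "(\<integral>y. indicat_real (dyadic_cube m i :: (real^'n::finite) set) y \<partial>lborel) = (1 / 2 ^ m) ^ CARD('n)"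
  by (simp_all add: emeasure_dyadic_cube measure_def)

lemma integrable_on_dyadic_cube:
  fixes f :: "real^'n::finite \<Rightarrow> real"
  assumes "p > 1" "f \<in> borel_measurable borel" "integrable lborel (\<lambda>x. \<bar>f x\<bar> powr p)"
  shows "integrable lborel (\<lambda>y. indicat_real (dyadic_cube m i) y * f y)"
  by (rule integrable_weight_times_abs[OF assms(1), where K = 1])
    (use assms integrable_indicator_dyadic_cube in auto)

lemma abs_dyadic_integral_le:
  fixes f :: "real^'n::finite \<Rightarrow> real"
  assumes p: "p > 1" and [measurable]: "f \<in> borel_measurable borel"
    and i: "integrable lborel (\<lambda>x. \<bar>f x\<bar> powr p)" "(\<integral>x. \<bar>f x\<bar> powr p \<partial>lborel) \<le> 1"
  shows "\<bar>\<integral>y. indicat_real (dyadic_cube m i) y * f y \<partial>lborel\<bar> \<le> 2"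
proof -
  let ?w = "indicat_real (dyadic_cube m i :: (real^'n) set)"
  have "\<bar>\<integral>y. ?w y * f y \<partial>lborel\<bar> \<le> (\<integral>y. \<bar>?w y * f y\<bar> \<partial>lborel)"
    by (rule integral_abs_bound)
  also have "\<dots> \<le> (\<integral>y. \<bar>f y\<bar> powr p + ?w y \<partial>lborel)"
  proof (rule integral_mono)
    show "integrable lborel (\<lambda>y. \<bar>?w y * f y\<bar>)"
      using integrable_on_dyadic_cube[OF p _ i(1)] by auto
    show "integrable lborel (\<lambda>y. \<bar>f y\<bar> powr p + ?w y)"
      using i(1) integrable_indicator_dyadic_cube(1) by (rule Bochner_Integration.integrable_add)
    show "\<bar>?w y * f y\<bar> \<le> \<bar>f y\<bar> powr p + ?w y" for y
      using abs_le_powr_plus[OF p, of 1 "f y"] by (auto simp: indicator_def)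
  qed
  also have "\<dots> = (\<integral>y. \<bar>f y\<bar> powr p \<partial>lborel) + (1 / 2 ^ m) ^ CARD('n)"
    using i(1) integrable_indicator_dyadic_cube[of m i]
    by (subst Bochner_Integration.integral_add) auto
  also have "\<dots> \<le> 1 + 1"
    using i(2) by (intro add_mono power_le_one) auto
  finally show ?thesis by simp
qed

text \<open>The boundary of the half-space lies on faces of dyadic cubes because \<open>d\<close> is a
  natural number. Hence a cube lies, up to a null set, on one side: on the outer side both
  \<open>f\<close> and its average vanish, and on the inner side \<open>nn_integral_abs_diff_le\<close>
  applies.\<close>

lemma dyadic_average_approx:
  fixes u :: "real^'n::finite \<Rightarrow> real" and d :: nat and k :: 'n
  defines "f \<equiv> \<lambda>x. indicat_real (halfspace k (real d)) x * u x"
  assumes p: "p > 1" and s: "s > 0" and t: "t > 0" and [measurable]: "u \<in> borel_measurable borel"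
    and i: "integrable lborel (\<lambda>x. \<bar>f x\<bar> powr p)" and x: "x $ k \<noteq> - real d"
  shows "ennreal \<bar>f x - dyadic_average m f (dyadic_index m x)\<bar> \<le> ennreal t +
      ennreal (real CARD('n) powr (real CARD('n) + 2 * s) * (2 powr - (2 * s)) ^ m / t) *
        (local_energy s (halfspace k (real d)) u x * indicator (halfspace k (real d)) x)"
proof -
  let ?n = "real CARD('n)"
  let ?H = "halfspace k (real d)"
  let ?Q = "dyadic_cube m (dyadic_index m x)"
  let ?w = "indicat_real ?Q"
  have [measurable]: "f \<in> borel_measurable borel" unfolding f_def by measurable
  have xQ: "x \<in> ?Q" by (simp add: mem_dyadic_cube_iff)
  have iQ: "integrable lborel (\<lambda>y. ?w y * f y)" by (rule integrable_on_dyadic_cube[OF p _ i]) measurable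
  have iw: "integrable lborel ?w" by (rule integrable_indicator_dyadic_cube)
  have same_side: "y $ k > - real d \<longleftrightarrow> x $ k > - real d" if y: "y \<in> ?Q" "y $ k \<noteq> - real d" for y
  proof -
    have fl: "\<lfloor>2 ^ m * y $ k\<rfloor> = \<lfloor>2 ^ m * x $ k\<rfloor>"
      using y(1) by (simp add: dyadic_cube_def dyadic_index_def)
    have "z $ k > - real d \<longleftrightarrow> - int (2 ^ m * d) \<le> \<lfloor>2 ^ m * z $ k\<rfloor>" if "z $ k \<noteq> - real d" for z :: "real^'n"
    proof -
      have "- int (2 ^ m * d) \<le> \<lfloor>2 ^ m * z $ k\<rfloor> \<longleftrightarrow> 2 ^ m * (- real d) \<le> 2 ^ m * z $ k"
        by (simp add: le_floor_iff)
      also have "\<dots> \<longleftrightarrow> - real d \<le> z $ k" by (subst mult_le_cancel_left_pos) auto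
      finally show ?thesis using that by auto
    qed
    then show ?thesis using fl y x by simp
  qed
  have ae: "AE y in lborel. y \<in> ?Q \<longrightarrow> (y \<in> ?H \<longleftrightarrow> x \<in> ?H)"
    using AE_lborel_coordinate_neq[of k "- real d"]
    by eventually_elim (use same_side in \<open>auto simp: halfspace_def\<close>)
  have "f x - dyadic_average m f (dyadic_index m x)
      = (2 ^ m) ^ CARD('n) * (\<integral>y. ?w y * (f x - f y) \<partial>lborel)"
  proof -
    have "(\<integral>y. ?w y * (f x - f y) \<partial>lborel) = (\<integral>y. ?w y * f x \<partial>lborel) - (\<integral>y. ?w y * f y \<partial>lborel)"
      unfolding right_diff_distrib using iw iQ by (intro Bochner_Integration.integral_diff) auto
    also have "(\<integral>y. ?w y * f x \<partial>lborel) = (1 / 2 ^ m) ^ CARD('n) * f x"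
      using integrable_indicator_dyadic_cube(2)[of m "dyadic_index m x"] by simp
    finally show ?thesis by (simp add: dyadic_average_def right_diff_distrib power_one_over)
  qed
  then have "ennreal \<bar>f x - dyadic_average m f (dyadic_index m x)\<bar>
      = ennreal ((2 ^ m) ^ CARD('n)) * ennreal (norm (\<integral>y. ?w y * (f x - f y) \<partial>lborel))"
    by (simp add: abs_mult ennreal_mult)
  also have "\<dots> \<le> ennreal ((2 ^ m) ^ CARD('n)) * (\<integral>\<^sup>+y. ennreal (norm (?w y * (f x - f y))) \<partial>lborel)"
  proof (intro mult_left_mono integral_norm_bound_ennreal)
    show "integrable lborel (\<lambda>y. ?w y * (f x - f y))"
      unfolding right_diff_distrib using iw iQ by auto
  qed simp
  also have "\<dots> \<le> ennreal t + ennreal (?n powr (?n + 2 * s) * (2 powr - (2 * s)) ^ m / t) *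
        (local_energy s ?H u x * indicator ?H x)"
  proof (cases "x \<in> ?H")
    case True
    let ?\<rho> = "?n * (1 / 2 ^ m)"
    have "(\<integral>\<^sup>+y. ennreal (norm (?w y * (f x - f y))) \<partial>lborel) = (\<integral>\<^sup>+y\<in>?Q. ennreal \<bar>u x - u y\<bar> \<partial>lborel)"
      using ae by (intro nn_integral_cong_AE, eventually_elim) (use True in \<open>auto simp: f_def indicator_def\<close>)
    also have "\<dots> \<le> ennreal t * emeasure lborel ?Q + ennreal (?\<rho> powr (?n + 2 * s) / t) * local_energy s ?H u x"
    proof (rule nn_integral_abs_diff_le)
      show "AE y in lborel. y \<in> ?Q \<longrightarrow> y \<in> ?H \<and> norm (x - y) \<le> ?\<rho>"
        using ae by eventually_elim (use True dist_in_dyadic_cube[OF xQ] in auto)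
    qed (use t s in auto)
    finally have "ennreal ((2 ^ m) ^ CARD('n)) * (\<integral>\<^sup>+y. ennreal (norm (?w y * (f x - f y))) \<partial>lborel)
      \<le> ennreal ((2 ^ m) ^ CARD('n)) * (ennreal t * emeasure lborel ?Q + ennreal (?\<rho> powr (?n + 2 * s) / t) * local_energy s ?H u x)"
      by (intro mult_left_mono) auto
    also have "\<dots> = ennreal t + ennreal ((2 ^ m) ^ CARD('n) * (?\<rho> powr (?n + 2 * s) / t)) * local_energy s ?H u x"
    proof -
      have "ennreal ((2 ^ m) ^ CARD('n)) * (ennreal t * emeasure lborel ?Q) = ennreal t"
        unfolding emeasure_dyadic_cube using t by (simp add: ennreal_mult[symmetric] power_one_over)
      moreover have "ennreal ((2 ^ m) ^ CARD('n)) * (ennreal (?\<rho> powr (?n + 2 * s) / t) * local_energy s ?H u x)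
        = ennreal ((2 ^ m) ^ CARD('n) * (?\<rho> powr (?n + 2 * s) / t)) * local_energy s ?H u x"
        unfolding mult.assoc[symmetric] using t by (subst ennreal_mult) auto
      ultimately show ?thesis by (simp only: distrib_left)
    qed
    also have "(2 ^ m) ^ CARD('n) * (?\<rho> powr (?n + 2 * s) / t) = ?n powr (?n + 2 * s) * (2 powr - (2 * s)) ^ m / t"
    proof -
      have "?\<rho> powr (?n + 2 * s) = ?n powr (?n + 2 * s) * (2 powr - real m) powr (?n + 2 * s)"
        by (subst powr_mult) (simp_all add: powr_minus powr_realpow divide_inverse)
      moreover have "(2 ^ m) ^ CARD('n) = (2::real) powr (real m * ?n)"
        by (simp add: powr_realpow[symmetric] powr_powr)
      moreover have "((2::real) powr - (2 * s)) ^ m = 2 powr (real m * ?n) * (2 powr - real m) powr (?n + 2 * s)"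
        by (simp add: powr_realpow[symmetric] powr_powr powr_add[symmetric] algebra_simps)
      ultimately show ?thesis by simp
    qed
    finally show ?thesis using True by simp
  next
    case False
    have "(\<integral>\<^sup>+y. ennreal (norm (?w y * (f x - f y))) \<partial>lborel) = (\<integral>\<^sup>+y. 0 \<partial>(lborel :: (real^'n) measure))"
      using ae by (intro nn_integral_cong_AE, eventually_elim) (use False in \<open>auto simp: f_def indicator_def\<close>)
    then show ?thesis by simp
  qed
  finally show ?thesis .
qed


text \<open>Such a weight turns Lebesgue measure into a finite measure with the same null sets, so that
  one \<open>L\<^sup>1\<close> estimate replaces an exhaustion by bounded sets.\<close>

lemma bounded_positive_integrable_weight:
  obtains h :: "'a::euclidean_space \<Rightarrow> ennreal" and W :: real
  where "h \<in> borel_measurable borel" "\<And>x. 0 < h x" "\<And>x. h x \<le> 1" "W > 0" "(\<integral>\<^sup>+x. h x \<partial>lborel) \<le> ennreal W"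
proof -
  obtain g :: "'a \<Rightarrow> ennreal" where g: "g \<in> borel_measurable lborel" "integral\<^sup>N lborel g \<noteq> \<infinity>"
      "\<forall>x\<in>space lborel. 0 < g x \<and> g x < \<infinity>"
    using sigma_finite_measure.Ex_finite_integrable_function[OF lborel.sigma_finite_measure_axioms] by blast
  have [measurable]: "g \<in> borel_measurable borel" using g(1) by simp
  have fin: "(\<integral>\<^sup>+x. min 1 (g x) \<partial>lborel) < \<infinity>"
    using g(2) nn_integral_mono[of lborel "\<lambda>x. min 1 (g x)" g]
    by (simp add: less_top[symmetric] top_unique) (metis min.cobounded2 top_unique)
  show thesis
  proof
    show "(\<lambda>x. min 1 (g x)) \<in> borel_measurable borel" by measurable
    show "(\<integral>\<^sup>+x. min 1 (g x) \<partial>lborel) \<le> ennreal (enn2real (\<integral>\<^sup>+x. min 1 (g x) \<partial>lborel) + 1)"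
      using fin by (simp add: ennreal_plus)
    show "0 < enn2real (\<integral>\<^sup>+x. min 1 (g x) \<partial>lborel) + 1"
      by (simp add: add_nonneg_pos)
  qed (use g in auto)
qed

text \<open>The bound tends to zero when first \<open>t\<close> is small and then \<open>m\<close> is
  large, uniformly over functions of bounded energy.\<close>

lemma weighted_dyadic_average_approx:
  fixes u :: "real^'n::finite \<Rightarrow> real" and d :: nat and k :: 'n
  defines "f \<equiv> \<lambda>x. indicat_real (halfspace k (real d)) x * u x"
  assumes p: "p > 1" and s: "s > 0" and t: "t > 0" and [measurable]: "u \<in> borel_measurable borel"
    and i: "integrable lborel (\<lambda>x. \<bar>f x\<bar> powr p)"
    and e: "seminorm2 s (halfspace k (real d)) u \<le> ennreal M" and M: "M \<ge> 0"
    and h: "h \<in> borel_measurable borel" "\<And>x. h x \<le> 1" "(\<integral>\<^sup>+x. h x \<partial>lborel) \<le> ennreal W" "W \<ge> 0"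
  shows "(\<integral>\<^sup>+x. h x * ennreal \<bar>f x - dyadic_average m f (dyadic_index m x)\<bar> \<partial>lborel)
      \<le> ennreal (t * W + real CARD('n) powr (real CARD('n) + 2 * s) * (2 powr - (2 * s)) ^ m / t * M)"
proof -
  let ?H = "halfspace k (real d)"
  let ?K = "real CARD('n) powr (real CARD('n) + 2 * s) * (2 powr - (2 * s)) ^ m / t"
  have K: "?K \<ge> 0" using t by simp
  have [measurable]: "h \<in> borel_measurable borel" by (rule h(1))
  have [measurable]: "local_energy s ?H u \<in> borel_measurable borel" by (rule borel_local_energy) measurable
  have "(\<integral>\<^sup>+x. h x * ennreal \<bar>f x - dyadic_average m f (dyadic_index m x)\<bar> \<partial>lborel)
     \<le> (\<integral>\<^sup>+x. ennreal t * h x + ennreal ?K * (local_energy s ?H u x * indicator ?H x) \<partial>lborel)"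
  proof (rule nn_integral_mono_AE)
    show "AE x in lborel. h x * ennreal \<bar>f x - dyadic_average m f (dyadic_index m x)\<bar>
      \<le> ennreal t * h x + ennreal ?K * (local_energy s ?H u x * indicator ?H x)"
      using AE_lborel_coordinate_neq[of k "- real d"]
    proof eventually_elim
      case (elim x)
      let ?G = "ennreal ?K * (local_energy s ?H u x * indicator ?H x)"
      have "h x * ennreal \<bar>f x - dyadic_average m f (dyadic_index m x)\<bar> \<le> h x * (ennreal t + ?G)"
        unfolding f_def
        by (intro mult_left_mono dyadic_average_approx[OF p s t _ i[unfolded f_def] elim]) auto
      also have "\<dots> = ennreal t * h x + h x * ?G" by (simp add: distrib_left mult.commute)
      also have "\<dots> \<le> ennreal t * h x + 1 * ?G"
        by (intro add_left_mono mult_right_mono h(2)) simp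
      finally show ?case by simp
    qed
  qed
  also have "\<dots> = ennreal t * (\<integral>\<^sup>+x. h x \<partial>lborel) + ennreal ?K * (\<integral>\<^sup>+x\<in>?H. local_energy s ?H u x \<partial>lborel)"
  proof -
    have 1: "(\<lambda>x. local_energy s ?H u x * indicator ?H x) \<in> borel_measurable lborel"
      "h \<in> borel_measurable lborel" by measurable
    have 2: "(\<lambda>x. ennreal t * h x) \<in> borel_measurable lborel"
      "(\<lambda>x. ennreal ?K * (local_energy s ?H u x * indicator ?H x)) \<in> borel_measurable lborel" by measurable
    show ?thesis unfolding nn_integral_add[OF 2] nn_integral_cmult[OF 1(1)] nn_integral_cmult[OF 1(2)] ..
  qed
  also have "\<dots> \<le> ennreal t * ennreal W + ennreal ?K * ennreal M"
    by (intro add_mono mult_left_mono h order_trans[OF nn_integral_local_energy_le e]) auto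
  also have "\<dots> = ennreal (t * W + ?K * M)"
    using t K M h(4) by (simp add: ennreal_mult[symmetric] ennreal_plus[symmetric] del: ennreal_plus)
  finally show ?thesis .
qed

lemma nn_integral_abs_triangle:
  fixes a b :: "'a \<Rightarrow> real" and h :: "'a \<Rightarrow> ennreal"
  assumes [measurable]: "a \<in> borel_measurable M" "b \<in> borel_measurable M" "c \<in> borel_measurable M" "h \<in> borel_measurable M"
  shows "(\<integral>\<^sup>+x. h x * ennreal \<bar>a x - c x\<bar> \<partial>M) \<le> (\<integral>\<^sup>+x. h x * ennreal \<bar>a x - b x\<bar> \<partial>M) + (\<integral>\<^sup>+x. h x * ennreal \<bar>b x - c x\<bar> \<partial>M)"
proof -
  have "(\<integral>\<^sup>+x. h x * ennreal \<bar>a x - c x\<bar> \<partial>M) \<le> (\<integral>\<^sup>+x. h x * ennreal \<bar>a x - b x\<bar> + h x * ennreal \<bar>b x - c x\<bar> \<partial>M)"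
    unfolding distrib_left[symmetric]
    by (intro nn_integral_mono mult_left_mono) (auto simp: ennreal_plus[symmetric] simp del: ennreal_plus intro!: ennreal_leI)
  also have "\<dots> = (\<integral>\<^sup>+x. h x * ennreal \<bar>a x - b x\<bar> \<partial>M) + (\<integral>\<^sup>+x. h x * ennreal \<bar>b x - c x\<bar> \<partial>M)"
    by (intro nn_integral_add) measurable
  finally show ?thesis .
qed

text \<open>A substitute for Rellich's theorem. The averages over the countably many dyadic cubes
  converge along a diagonal subsequence; as they approximate the functions uniformly, the latter form a
  Cauchy sequence in weighted \<open>L\<^sup>1\<close>. The half-spaces may vary with
  \<open>j\<close>.\<close>

lemma bounded_energy_AE_convergent_subseq:
  fixes v :: "nat \<Rightarrow> real^'n::finite \<Rightarrow> real" and d :: "nat \<Rightarrow> nat" and k :: 'n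
  assumes p: "p > 1" and s: "s > 0" and M: "M \<ge> 0"
    and v: "\<And>j. v j \<in> borel_measurable borel"
    and m: "\<And>j. mass p (halfspace k (real (d j))) (v j) \<le> 1"
    and e: "\<And>j. seminorm2 s (halfspace k (real (d j))) (v j) \<le> ennreal M"
  obtains r where "strict_mono (r :: nat \<Rightarrow> nat)"
    "AE x in lborel. convergent (\<lambda>j. indicat_real (halfspace k (real (d (r j)))) x * v (r j) x)"
proof -
  define f where "f j x = indicat_real (halfspace k (real (d j))) x * v j x" for j x
  note v[measurable]
  have f[measurable]: "f j \<in> borel_measurable borel" for j unfolding f_def[abs_def] by measurable
  have fin: "mass p (halfspace k (real (d j))) (v j) < \<infinity>" for j
    using m[of j] by (simp add: order_le_less_trans)
  have i: "integrable lborel (\<lambda>x. \<bar>f j x\<bar> powr p)" for j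
    unfolding f_def by (rule mass_Bochner[OF v _ fin]) measurable
  have i1: "(\<integral>x. \<bar>f j x\<bar> powr p \<partial>lborel) \<le> 1" for j
    using m[of j] mass_Bochner(2)[OF v _ fin, of j] unfolding f_def by simp
  let ?A = "\<lambda>j (m, i). \<integral>y. indicat_real (dyadic_cube m i) y * f j y \<partial>lborel"
  obtain r :: "nat \<Rightarrow> nat" where r: "strict_mono r" and
    conv: "\<And>z. \<exists>l. (\<lambda>j. ?A (r j) z) \<longlonglongrightarrow> l"
  proof (rule function_convergent_subsequence[of "UNIV :: (nat \<times> (int^'n)) set" ?A 2])
    show "norm (?A j z) \<le> 2" for j z
      using abs_dyadic_integral_le[OF p f i i1] by (auto split: prod.split)
  qed (auto intro: that)
  define F where "F j = f (r j)" for j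
  define P where "P m j x = dyadic_average m (F j) (dyadic_index m x)" for m j x
  have [measurable]: "F j \<in> borel_measurable borel" for j by (simp add: F_def)
  have [measurable]: "P m j \<in> borel_measurable borel" for m j unfolding P_def by measurable
  have "\<exists>l. (\<lambda>j. P m j x) \<longlonglongrightarrow> l" for m x
  proof -
    obtain l where "(\<lambda>j. ?A (r j) (m, dyadic_index m x)) \<longlonglongrightarrow> l" using conv by blast
    then have "(\<lambda>j. P m j x) \<longlonglongrightarrow> (2 ^ m) ^ CARD('n) * l"
      unfolding P_def dyadic_average_def F_def by (intro tendsto_mult tendsto_const) simp
    then show ?thesis by blast
  qed
  then obtain L where L: "\<And>m x. (\<lambda>j. P m j x) \<longlonglongrightarrow> L m x" by metis
  have [measurable]: "L m \<in> borel_measurable borel" for m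
    by (rule borel_measurable_LIMSEQ_real[where u = "P m"]) (auto intro: L)
  have Pb: "\<bar>P m j x\<bar> \<le> 2 * (2 ^ m) ^ CARD('n)" for m j x
    unfolding P_def dyadic_average_def F_def abs_mult
    using abs_dyadic_integral_le[OF p f i i1, of m "dyadic_index m x" "r j"] by (simp add: mult.commute mult_left_mono)
  obtain h :: "real^'n \<Rightarrow> ennreal" and W where h[measurable]: "h \<in> borel_measurable borel"
    and hp: "\<And>x. 0 < h x" and h1: "\<And>x. h x \<le> 1" and W: "W > 0" and hW: "(\<integral>\<^sup>+x. h x \<partial>lborel) \<le> ennreal W"
    by (rule bounded_positive_integrable_weight) blast
  define C where "C = real CARD('n) powr (real CARD('n) + 2 * s)"
  have C: "C > 0" by (simp add: C_def)
  have near: "(\<integral>\<^sup>+x. h x * ennreal \<bar>F j x - P m j x\<bar> \<partial>lborel) \<le> ennreal (t * W + C * (2 powr - (2 * s)) ^ m / t * M)"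
    if t: "t > 0" for t m j
    unfolding F_def P_def f_def[abs_def] C_def
    by (rule weighted_dyadic_average_approx[OF p s t v i[unfolded f_def] e M h h1 hW]) (use W in simp)
  have avg: "(\<lambda>j. \<integral>\<^sup>+x. h x * ennreal \<bar>P m j x - L m x\<bar> \<partial>lborel) \<longlonglongrightarrow> 0" for m
  proof -
    let ?B = "4 * (2 ^ m) ^ CARD('n) :: real"
    have "(\<lambda>j. \<integral>\<^sup>+x. h x * ennreal \<bar>P m j x - L m x\<bar> \<partial>lborel) \<longlonglongrightarrow> (\<integral>\<^sup>+x. 0 \<partial>(lborel :: (real^'n) measure))"
    proof (rule nn_integral_dominated_convergence[where w = "\<lambda>x. ennreal ?B * h x"])
      show "(\<integral>\<^sup>+x. ennreal ?B * h x \<partial>lborel) < \<infinity>"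
        using hW by (subst nn_integral_cmult) (auto simp: ennreal_mult_less_top order_le_less_trans)
      show "AE x in lborel. h x * ennreal \<bar>P m j x - L m x\<bar> \<le> ennreal ?B * h x" for j
      proof (rule AE_I2)
        fix x
        have "\<bar>L m x\<bar> \<le> 2 * (2 ^ m) ^ CARD('n)"
          by (rule LIMSEQ_le_const2[OF tendsto_rabs[OF L]]) (use Pb in auto)
        then have "\<bar>P m j x - L m x\<bar> \<le> ?B" using Pb[of m j x] by linarith
        then show "h x * ennreal \<bar>P m j x - L m x\<bar> \<le> ennreal ?B * h x"
          by (subst mult.commute) (intro mult_right_mono ennreal_leI, auto)
      qed
      show "AE x in lborel. (\<lambda>j. h x * ennreal \<bar>P m j x - L m x\<bar>) \<longlonglongrightarrow> 0"
      proof (rule AE_I2)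
        fix x
        have "(\<lambda>j. \<bar>P m j x - L m x\<bar>) \<longlonglongrightarrow> 0" using L[of m x] by (simp add: LIM_zero tendsto_rabs_zero)
        then have 0: "(\<lambda>j. ennreal \<bar>P m j x - L m x\<bar>) \<longlonglongrightarrow> 0" using tendsto_ennrealI by fastforce
        show "(\<lambda>j. h x * ennreal \<bar>P m j x - L m x\<bar>) \<longlonglongrightarrow> 0"
        proof (rule tendsto_sandwich[OF _ _ tendsto_const 0])
          show "\<forall>\<^sub>F j in sequentially. h x * ennreal \<bar>P m j x - L m x\<bar> \<le> ennreal \<bar>P m j x - L m x\<bar>"
            using mult_right_mono[OF h1[of x]] by (intro always_eventually allI) fastforce
        qed simp
      qed
    qed measurable
    then show ?thesis by simp
  qed
  obtain r' where r': "strict_mono (r' :: nat \<Rightarrow> nat)" and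
    c: "AE x in density lborel h. convergent (\<lambda>j. F (r' j) x)"
  proof (rule L1_Cauchy_imp_AE_convergent_subseq[of F "density lborel h"])
    fix e :: real assume e: "e > 0"
    \<comment> \<open>the term \<open>t W\<close> is fixed first; then \<open>m\<close> makes the energy term small\<close>
    define t where "t = e / (8 * W)"
    have t: "t > 0" "t * W = e / 8" using e W by (simp_all add: t_def)
    have "(\<lambda>m. C * (2 powr - (2 * s)) ^ m / t * M) \<longlonglongrightarrow> C * 0 / t * M"
      using s t by (intro tendsto_intros LIMSEQ_realpow_zero) (auto simp: powr_less_one)
    then have "\<forall>\<^sub>F m in sequentially. C * (2 powr - (2 * s)) ^ m / t * M < e / 8"
      by (rule order_tendstoD) (use e in simp)
    then obtain m where m: "C * (2 powr - (2 * s)) ^ m / t * M < e / 8"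
      by (meson eventually_sequentially order_refl)
    have 1: "(\<integral>\<^sup>+x. h x * ennreal \<bar>F j x - P m j x\<bar> \<partial>lborel) \<le> ennreal (e / 4)" for j
      using m t(2) by (intro order_trans[OF near[OF t(1)]] ennreal_leI) linarith
    have "\<forall>\<^sub>F j in sequentially. (\<integral>\<^sup>+x. h x * ennreal \<bar>P m j x - L m x\<bar> \<partial>lborel) < ennreal (e / 4)"
      by (rule order_tendstoD(2)[OF avg]) (use e in simp)
    then obtain N where N: "\<And>j. j \<ge> N \<Longrightarrow> (\<integral>\<^sup>+x. h x * ennreal \<bar>P m j x - L m x\<bar> \<partial>lborel) < ennreal (e / 4)"
      by (auto simp: eventually_sequentially)
    have half: "(\<integral>\<^sup>+x. h x * ennreal \<bar>F j x - L m x\<bar> \<partial>lborel) \<le> ennreal (e / 2)" if "j \<ge> N" for j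
    proof -
      have "(\<integral>\<^sup>+x. h x * ennreal \<bar>F j x - L m x\<bar> \<partial>lborel)
        \<le> (\<integral>\<^sup>+x. h x * ennreal \<bar>F j x - P m j x\<bar> \<partial>lborel) + (\<integral>\<^sup>+x. h x * ennreal \<bar>P m j x - L m x\<bar> \<partial>lborel)"
        by (rule nn_integral_abs_triangle) measurable
      also have "\<dots> \<le> ennreal (e / 4) + ennreal (e / 4)"
        using N[OF that] by (intro add_mono 1) simp
      also have "\<dots> = ennreal (e / 2)" using e by (simp add: ennreal_plus[symmetric] del: ennreal_plus)
      finally show ?thesis .
    qed
    have "(\<integral>\<^sup>+x. ennreal \<bar>F i x - F j x\<bar> \<partial>density lborel h) \<le> ennreal e" if "i \<ge> N" "j \<ge> N" for i j
    proof -
      have "(\<integral>\<^sup>+x. ennreal \<bar>F i x - F j x\<bar> \<partial>density lborel h) = (\<integral>\<^sup>+x. h x * ennreal \<bar>F i x - F j x\<bar> \<partial>lborel)"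
        by (rule nn_integral_density) measurable
      also have "\<dots> \<le> (\<integral>\<^sup>+x. h x * ennreal \<bar>F i x - L m x\<bar> \<partial>lborel) + (\<integral>\<^sup>+x. h x * ennreal \<bar>L m x - F j x\<bar> \<partial>lborel)"
        by (rule nn_integral_abs_triangle) measurable
      also have "\<dots> \<le> ennreal (e / 2) + ennreal (e / 2)"
        using half[OF that(1)] half[OF that(2)] by (intro add_mono) (simp_all add: abs_minus_commute)
      also have "\<dots> = ennreal e" using e by (simp add: ennreal_plus[symmetric] del: ennreal_plus)
      finally show ?thesis .
    qed
    then show "\<exists>N. \<forall>i\<ge>N. \<forall>j\<ge>N. (\<integral>\<^sup>+x. ennreal \<bar>F i x - F j x\<bar> \<partial>density lborel h) \<le> ennreal e" by blast
  qed (auto intro: that)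
  have "AE x in lborel. convergent (\<lambda>j. F (r' j) x)"
    using c hp by (subst (asm) AE_density) auto
  then show thesis
    by (intro that[of "r \<circ> r'"] strict_mono_o r r') (simp add: F_def f_def)
qed

section \<open>Optimal extension from a half-space\<close>

text \<open>The quadratic \<open>a \<mapsto> \<integral> w (u - a)\<^sup>2\<close> has its vertex at the
  weighted mean.\<close>

lemma weighted_mean_minimizes:
  fixes w u :: "'a \<Rightarrow> real"
  assumes w: "integrable M w" "\<And>x. w x \<ge> 0" "(\<integral>x. w x \<partial>M) > 0"
    and u: "integrable M (\<lambda>x. w x * u x)" and [measurable]: "u \<in> borel_measurable M"
    and mdef: "m = (\<integral>x. w x * u x \<partial>M) / (\<integral>x. w x \<partial>M)"
  shows "(\<integral>\<^sup>+x. ennreal (w x * (u x - m)\<^sup>2) \<partial>M) \<le> (\<integral>\<^sup>+x. ennreal (w x * (u x - a)\<^sup>2) \<partial>M)"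
proof (cases "(\<integral>\<^sup>+x. ennreal (w x * (u x - a)\<^sup>2) \<partial>M) = \<infinity>")
  case False
  have [measurable]: "w \<in> borel_measurable M" using w(1) by auto
  have ia: "integrable M (\<lambda>x. w x * (u x - a)\<^sup>2)"
    using False w(2) by (intro integrableI_nonneg) (auto simp: less_top)
  let ?W = "\<integral>x. w x \<partial>M"
  have eq: "w x * (u x - m)\<^sup>2 = w x * (u x - a)\<^sup>2 + (2 * (a - m)) * (w x * u x - a * w x) + (a - m)\<^sup>2 * w x" for x
    by (simp add: power2_eq_square algebra_simps)
  have i2: "integrable M (\<lambda>x. (2 * (a - m)) * (w x * u x - a * w x))"
    "integrable M (\<lambda>x. (a - m)\<^sup>2 * w x)" using u w by auto
  have im: "integrable M (\<lambda>x. w x * (u x - m)\<^sup>2)"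
    unfolding eq using ia i2 by (intro Bochner_Integration.integrable_add)
  have "(\<integral>x. w x * (u x - m)\<^sup>2 \<partial>M) = (\<integral>x. w x * (u x - a)\<^sup>2 \<partial>M)
      + (2 * (a - m)) * ((\<integral>x. w x * u x \<partial>M) - a * ?W) + (a - m)\<^sup>2 * ?W"
    unfolding eq using ia i2 u w by simp
  also have "(\<integral>x. w x * u x \<partial>M) = m * ?W" using w(3) by (simp add: mdef)
  also have "(\<integral>x. w x * (u x - a)\<^sup>2 \<partial>M) + 2 * (a - m) * (m * ?W - a * ?W) + (a - m)\<^sup>2 * ?W
      = (\<integral>x. w x * (u x - a)\<^sup>2 \<partial>M) - (a - m)\<^sup>2 * ?W"
    by (simp add: power2_eq_square algebra_simps)
  also have "\<dots> \<le> (\<integral>x. w x * (u x - a)\<^sup>2 \<partial>M)" using w(3) by simp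
  finally have "(\<integral>x. w x * (u x - m)\<^sup>2 \<partial>M) \<le> (\<integral>x. w x * (u x - a)\<^sup>2 \<partial>M)" .
  then show ?thesis
    using ia im w(2) by (simp add: nn_integral_eq_integral ennreal_leI)
qed simp

lemma diffquot_square:
  "(diffquot s u (x, y))\<^sup>2 = norm (x - y) powr - (real CARD('n) + 2 * s) * (u x - u y)\<^sup>2"
  for x y :: "real^'n::finite"
proof -
  have "(norm (x - y) powr ((real CARD('n) + 2 * s) / 2))\<^sup>2 = norm (x - y) powr (real CARD('n) + 2 * s)"
    by (simp add: power2_eq_square powr_add[symmetric])
  then show ?thesis by (simp only: diffquot_def power_divide powr_minus_divide fst_conv snd_conv) simp
qed

definition kernel_weight :: "real \<Rightarrow> (real^'n::finite) set \<Rightarrow> real^'n \<Rightarrow> real^'n \<Rightarrow> real" where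
  "kernel_weight s \<Omega> y x = indicat_real \<Omega> x * norm (y - x) powr - (real CARD('n) + 2 * s)"

text \<open>The extension of \<open>u\<close> from \<open>\<Omega>\<close> with the least energy over
  pairs touching \<open>\<Omega>\<close>, see \<open>seminorm2_optimal_extension_le\<close>.\<close>

definition optimal_extension :: "real \<Rightarrow> (real^'n::finite) set \<Rightarrow> (real^'n \<Rightarrow> real) \<Rightarrow> real^'n \<Rightarrow> real" where
  "optimal_extension s \<Omega> u y = (if y \<in> \<Omega> then u y else
     (\<integral>x. kernel_weight s \<Omega> y x * u x \<partial>lborel) / (\<integral>x. kernel_weight s \<Omega> y x \<partial>lborel))"

lemma borel_optimal_extension:
  assumes [measurable]: "u \<in> borel_measurable borel" "\<Omega> \<in> sets borel"
  shows "optimal_extension s \<Omega> u \<in> borel_measurable borel"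
proof -
  have 1: "(\<lambda>(y, x). kernel_weight s \<Omega> y x * u x) \<in> borel_measurable (borel \<Otimes>\<^sub>M lborel)"
    and 2: "(\<lambda>(y, x). kernel_weight s \<Omega> y x) \<in> borel_measurable (borel \<Otimes>\<^sub>M lborel)"
    unfolding kernel_weight_def by measurable
  note [measurable] = lborel.borel_measurable_lebesgue_integral[OF 1] lborel.borel_measurable_lebesgue_integral[OF 2]
  show ?thesis unfolding optimal_extension_def[abs_def] by measurable
qed

text \<open>A point strictly outside the half-space has positive distance to it, so the kernel is bounded
  there and decays integrably.\<close>

lemma kernel_weight_halfspace:
  fixes y :: "real^'n::finite"
  assumes s: "s > 0" and y: "y $ k < - d"
  defines "w \<equiv> kernel_weight s (halfspace k d) y"
  shows "integrable lborel w" "\<And>x. 0 \<le> w x"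
    "\<And>x. w x \<le> (- d - y $ k) powr - (real CARD('n) + 2 * s)" "(\<integral>x. w x \<partial>lborel) > 0"
proof -
  let ?e = "real CARD('n) + 2 * s"
  let ?\<delta> = "- d - y $ k"
  have \<delta>: "?\<delta> > 0" using y by simp
  have far: "norm (y - x) \<ge> ?\<delta>" if "x \<in> halfspace k d" for x
    using that component_le_norm_cart[of "y - x" k] y by (simp add: halfspace_def)
  have wm[measurable]: "w \<in> borel_measurable borel" unfolding w_def kernel_weight_def[abs_def] by measurable
  show nn: "0 \<le> w x" for x by (simp add: w_def kernel_weight_def)
  show "w x \<le> ?\<delta> powr - ?e" for x
    using far[of x] \<delta> s by (cases "x \<in> halfspace k d") (auto simp: w_def kernel_weight_def intro!: powr_mono2')
  show i: "integrable lborel w"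
  proof (rule integrableI_nonneg)
    have "(\<integral>\<^sup>+x. ennreal (w x) \<partial>lborel)
        \<le> (\<integral>\<^sup>+x. ennreal (norm (y - x) powr - ?e) * indicator {x. norm x \<ge> ?\<delta>} (y - x) \<partial>lborel)"
      using far by (intro nn_integral_mono) (auto simp: w_def kernel_weight_def indicator_def)
    also have "\<dots> = (\<integral>\<^sup>+x. ennreal (norm (y - x) powr - ?e) * indicator {x. norm x \<ge> ?\<delta>} (y - x)
        \<partial>density (distr lborel borel (\<lambda>x. y + (-1) *\<^sub>R x)) (\<lambda>_. ennreal (\<bar>-1\<bar> ^ DIM(real^'n))))"
      using lborel_affine[of "-1" y] by (simp add: ennreal_power)
    also have "\<dots> = (\<integral>\<^sup>+x\<in>{x. norm x \<ge> ?\<delta>}. ennreal (norm (x::real^'n) powr - ?e) \<partial>lborel)"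
      by (subst nn_integral_density) (simp_all add: nn_integral_distr)
    also have "\<dots> < \<infinity>" using nn_integral_powr_at_infinity[OF \<delta>, of "2 * s", where 'a = "real^'n"] s by simp
    finally show "(\<integral>\<^sup>+x. ennreal (w x) \<partial>lborel) < \<infinity>" .
  qed (use nn in auto)
  have "(\<integral>x. w x \<partial>lborel) \<noteq> 0"
  proof
    assume "(\<integral>x. w x \<partial>lborel) = 0"
    then have "AE x in lborel. w x = 0" using nn by (subst (asm) integral_nonneg_eq_0_iff_AE[OF i]) auto
    let ?c = "\<chi> l. - d :: real^'n"
    let ?B = "box ?c (\<chi> l. ?c $ l + 1)"
    have "AE x in lborel. x \<notin> ?B"
      using \<open>AE x in lborel. w x = 0\<close>
    proof eventually_elim
      case (elim x)
      show ?case
      proof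
        assume "x \<in> ?B"
        then have x: "x \<in> halfspace k d" by (auto simp: halfspace_def mem_box_cart)
        then have "norm (y - x) > 0" using far[OF x] \<delta> by linarith
        then show False using elim x by (simp add: w_def kernel_weight_def)
      qed
    qed
    then have "emeasure lborel ?B = 0"
      by (subst (asm) AE_iff_measurable[of ?B]) auto
    then show False using emeasure_lborel_cube(1)[of 1 ?c] by simp
  qed
  moreover have "0 \<le> (\<integral>x. w x \<partial>lborel)" using nn by (intro Bochner_Integration.integral_nonneg)
  ultimately show "(\<integral>x. w x \<partial>lborel) > 0" by linarith
qed

lemma integrable_kernel_weight_times:
  fixes y :: "real^'n::finite"
  assumes s: "s > 0" and y: "y $ k < - d" and p: "p > 1" and [measurable]: "u \<in> borel_measurable borel"
    and fin: "mass p (halfspace k d) u < \<infinity>"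
  shows "integrable lborel (\<lambda>x. kernel_weight s (halfspace k d) y x * u x)"
proof -
  have "integrable lborel (\<lambda>x. kernel_weight s (halfspace k d) y x * (indicat_real (halfspace k d) x * u x))"
    using mass_Bochner(1)[OF _ _ fin]
    by (intro integrable_weight_times_abs[OF p kernel_weight_halfspace(1-3)[OF s y]]) auto
  moreover have "kernel_weight s (halfspace k d) y x * (indicat_real (halfspace k d) x * u x)
      = kernel_weight s (halfspace k d) y x * u x" for x
    by (simp add: kernel_weight_def indicator_def)
  ultimately show ?thesis by (simp only:)
qed

text \<open>Pairs with exactly one point in \<open>\<Omega>\<close> are counted twice, once for each
  order.\<close>

lemma seminorm2_split:
  fixes u :: "real^'n::finite \<Rightarrow> real"
  assumes u: "u \<in> borel_measurable borel" and \<Omega>[measurable]: "\<Omega> \<in> sets borel"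
  shows "seminorm2 s \<Omega> u = (\<integral>\<^sup>+y\<in>\<Omega>. local_energy s \<Omega> u y \<partial>lborel)
      + ((\<integral>\<^sup>+y\<in>-\<Omega>. local_energy s \<Omega> u y \<partial>lborel) + (\<integral>\<^sup>+y\<in>-\<Omega>. local_energy s \<Omega> u y \<partial>lborel))"
proof -
  have [measurable]: "diffquot s u \<in> borel_measurable borel" by (rule borel_diffquot[OF u])
  let ?D = "\<lambda>z. ennreal ((diffquot s u z)\<^sup>2)"
  have sym: "(diffquot s u (x, y))\<^sup>2 = (diffquot s u (y, x))\<^sup>2" for x y
    by (simp add: diffquot_square norm_minus_commute power2_commute)
  have m: "(\<lambda>z. ?D z * indicator A (fst z) * indicator B (snd z)) \<in> borel_measurable borel"
    if [measurable]: "A \<in> sets borel" "B \<in> sets borel" for A B by measurable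
  have iter: "(\<integral>\<^sup>+z. ?D z * indicator A (fst z) * indicator \<Omega> (snd z) \<partial>lborel)
      = (\<integral>\<^sup>+y\<in>A. local_energy s \<Omega> u y \<partial>lborel)" if [measurable]: "A \<in> sets borel" for A
    by (subst nn_integral_lborel_pair) (measurable, auto simp: local_energy_def indicator_def intro!: nn_integral_cong)
  have iter': "(\<integral>\<^sup>+z. ?D z * indicator \<Omega> (fst z) * indicator A (snd z) \<partial>lborel)
      = (\<integral>\<^sup>+y\<in>A. local_energy s \<Omega> u y \<partial>lborel)" if [measurable]: "A \<in> sets borel" for A
    by (subst nn_integral_lborel_pair_swap) (measurable, auto simp: local_energy_def indicator_def sym intro!: nn_integral_cong)
  have "seminorm2 s \<Omega> u = (\<integral>\<^sup>+z. ?D z * indicator \<Omega> (fst z) * indicator \<Omega> (snd z)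
     + (?D z * indicator (-\<Omega>) (fst z) * indicator \<Omega> (snd z) + ?D z * indicator \<Omega> (fst z) * indicator (-\<Omega>) (snd z)) \<partial>lborel)"
    unfolding seminorm2_def by (intro nn_integral_cong) (auto simp: indicator_def touching_def)
  also have "\<dots> = (\<integral>\<^sup>+z. ?D z * indicator \<Omega> (fst z) * indicator \<Omega> (snd z) \<partial>lborel)
     + ((\<integral>\<^sup>+z. ?D z * indicator (-\<Omega>) (fst z) * indicator \<Omega> (snd z) \<partial>lborel) + (\<integral>\<^sup>+z. ?D z * indicator \<Omega> (fst z) * indicator (-\<Omega>) (snd z) \<partial>lborel))"
    using m[of \<Omega> \<Omega>] m[of "-\<Omega>" \<Omega>] m[of \<Omega> "-\<Omega>"] by (simp add: nn_integral_add)
  finally show ?thesis by (simp only: iter[OF \<Omega>] iter[of "-\<Omega>"] iter'[of "-\<Omega>"] \<Omega> borel_comp)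
qed

text \<open>Off \<open>\<Omega>\<close> the energy is a sum of independent quadratic problems, one for
  each outer point, each solved by the weighted mean.\<close>

lemma seminorm2_optimal_extension_le:
  fixes u :: "real^'n::finite \<Rightarrow> real"
  assumes s: "s > 0" and p: "p > 1" and u[measurable]: "u \<in> borel_measurable borel"
    and fin: "mass p (halfspace k d) u < \<infinity>"
  shows "seminorm2 s (halfspace k d) (optimal_extension s (halfspace k d) u) \<le> seminorm2 s (halfspace k d) u"
proof -
  let ?H = "halfspace k d"
  let ?U = "optimal_extension s ?H u"
  have U[measurable]: "?U \<in> borel_measurable borel" by (rule borel_optimal_extension) measurable
  have loc: "local_energy s ?H v y = (\<integral>\<^sup>+x. ennreal (kernel_weight s ?H y x * (v x - v y)\<^sup>2) \<partial>lborel)" for v and y :: "real^'n"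
    unfolding local_energy_def
    by (intro nn_integral_cong) (auto simp: diffquot_square kernel_weight_def indicator_def power2_commute)
  have UL: "local_energy s ?H ?U y = (\<integral>\<^sup>+x. ennreal (kernel_weight s ?H y x * (u x - ?U y)\<^sup>2) \<partial>lborel)" for y
    unfolding loc by (intro nn_integral_cong) (auto simp: kernel_weight_def indicator_def optimal_extension_def)
  have inside: "local_energy s ?H ?U y = local_energy s ?H u y" if "y \<in> ?H" for y
  proof -
    have "?U y = u y" using that by (simp add: optimal_extension_def)
    then show ?thesis by (simp only: UL loc[of u])
  qed
  have outside: "local_energy s ?H ?U y \<le> local_energy s ?H u y" if "y $ k < - d" for y
    unfolding UL loc[of u]
  proof (rule weighted_mean_minimizes)
    show "?U y = (\<integral>x. kernel_weight s ?H y x * u x \<partial>lborel) / (\<integral>x. kernel_weight s ?H y x \<partial>lborel)"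
      using that by (simp add: optimal_extension_def halfspace_def)
  qed (use kernel_weight_halfspace[OF s that] integrable_kernel_weight_times[OF s that p u fin] in auto)
  have "(\<integral>\<^sup>+y\<in>-?H. local_energy s ?H ?U y \<partial>lborel) \<le> (\<integral>\<^sup>+y\<in>-?H. local_energy s ?H u y \<partial>lborel)"
  proof (rule nn_integral_mono_AE)
    show "AE y in lborel. local_energy s ?H ?U y * indicator (-?H) y \<le> local_energy s ?H u y * indicator (-?H) y"
      using AE_lborel_coordinate_neq[of k "- d"]
      by eventually_elim (use outside in \<open>auto simp: indicator_def halfspace_def\<close>)
  qed
  moreover have "(\<integral>\<^sup>+y\<in>?H. local_energy s ?H ?U y \<partial>lborel) = (\<integral>\<^sup>+y\<in>?H. local_energy s ?H u y \<partial>lborel)"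
    using inside by (intro nn_integral_cong) (auto simp: indicator_def)
  ultimately show ?thesis
    by (simp only: seminorm2_split[OF U borel_halfspace] seminorm2_split[OF u borel_halfspace] add_mono order_refl)
qed

lemma mass_optimal_extension: "mass p \<Omega> (optimal_extension s \<Omega> u) = mass p \<Omega> u"
  unfolding mass_def by (intro nn_integral_cong) (auto simp: optimal_extension_def indicator_def)

text \<open>At an outer point the extension is the integral of \<open>u\<close> against a bounded
  integrable weight, so that convergence almost everywhere and boundedness in \<open>L\<^sup>p\<close>
  suffice.\<close>

lemma optimal_extension_tendsto:
  fixes u :: "nat \<Rightarrow> real^'n::finite \<Rightarrow> real"
  assumes s: "s > 0" and p: "p > 1" and y: "y $ k < - d"
    and u[measurable]: "\<And>j. u j \<in> borel_measurable borel" and v[measurable]: "v \<in> borel_measurable borel"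
    and m: "\<And>j. mass p (halfspace k d) (u j) \<le> 1" "mass p (halfspace k d) v \<le> 1"
    and lim: "AE x in lborel. x \<in> halfspace k d \<longrightarrow> (\<lambda>j. u j x) \<longlonglongrightarrow> v x"
  shows "(\<lambda>j. optimal_extension s (halfspace k d) (u j) y) \<longlonglongrightarrow> optimal_extension s (halfspace k d) v y"
proof -
  let ?H = "halfspace k d"
  let ?w = "kernel_weight s ?H y"
  let ?h = "\<lambda>j x. indicat_real ?H x * u j x - indicat_real ?H x * v x"
  have fin: "mass p ?H (u j) < \<infinity>" "mass p ?H v < \<infinity>" for j
    using m by (simp_all add: order_le_less_trans[OF _ ennreal_one_less_top])
  note bu = mass_Bochner[OF u borel_halfspace fin(1)] and bv = mass_Bochner[OF v borel_halfspace fin(2)]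
  have le1: "(\<integral>x. \<bar>indicat_real ?H x * u j x\<bar> powr p \<partial>lborel) \<le> 1" "(\<integral>x. \<bar>indicat_real ?H x * v x\<bar> powr p \<partial>lborel) \<le> 1" for j
    using m bu(2) bv(2) by auto
  have hi: "integrable lborel (\<lambda>x. \<bar>?h j x\<bar> powr p)" for j
    by (rule integrable_abs_powr_diff) (use p bu bv in auto)
  have hb: "(\<integral>x. \<bar>?h j x\<bar> powr p \<partial>lborel) \<le> 2 powr p * 2" for j
  proof -
    have "(\<integral>x. \<bar>?h j x\<bar> powr p \<partial>lborel)
        \<le> (\<integral>x. 2 powr p * (\<bar>indicat_real ?H x * u j x\<bar> powr p + \<bar>indicat_real ?H x * v x\<bar> powr p) \<partial>lborel)"
      using bu(1) bv(1) p by (intro integral_mono hi abs_diff_powr_le) auto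
    also have "\<dots> = 2 powr p * ((\<integral>x. \<bar>indicat_real ?H x * u j x\<bar> powr p \<partial>lborel) + (\<integral>x. \<bar>indicat_real ?H x * v x\<bar> powr p \<partial>lborel))"
      using bu(1) bv(1) by simp
    also have "\<dots> \<le> 2 powr p * 2" using add_mono[OF le1(1)[of j] le1(2)] by (intro mult_left_mono) auto
    finally show ?thesis .
  qed
  have null: "(\<lambda>j. \<integral>x. ?w x * \<bar>?h j x\<bar> \<partial>lborel) \<longlonglongrightarrow> 0"
  proof (rule weighted_L1_tendsto_zero[OF p kernel_weight_halfspace(1-3)[OF s y] _ hi hb])
    show "AE x in lborel. (\<lambda>j. ?h j x) \<longlonglongrightarrow> 0"
      using lim by eventually_elim (auto simp: indicator_def LIM_zero)
  qed measurable
  have bound: "\<bar>(\<integral>x. ?w x * u j x \<partial>lborel) - (\<integral>x. ?w x * v x \<partial>lborel)\<bar> \<le> (\<integral>x. ?w x * \<bar>?h j x\<bar> \<partial>lborel)" for j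
  proof -
    have "(\<integral>x. ?w x * u j x \<partial>lborel) - (\<integral>x. ?w x * v x \<partial>lborel) = (\<integral>x. ?w x * u j x - ?w x * v x \<partial>lborel)"
      using integrable_kernel_weight_times[OF s y p u fin(1)] integrable_kernel_weight_times[OF s y p v fin(2)] by simp
    moreover have "\<bar>?w x * u j x - ?w x * v x\<bar> = ?w x * \<bar>?h j x\<bar>" for x
      by (auto simp: kernel_weight_def indicator_def abs_mult right_diff_distrib[symmetric])
    ultimately show ?thesis using integral_abs_bound[of lborel "\<lambda>x. ?w x * u j x - ?w x * v x"] by simp
  qed
  have "(\<lambda>j. (\<integral>x. ?w x * u j x \<partial>lborel) - (\<integral>x. ?w x * v x \<partial>lborel)) \<longlonglongrightarrow> 0"
    by (rule Lim_null_comparison[OF _ null]) (use bound in \<open>simp add: eventually_sequentially\<close>)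
  then have "(\<lambda>j. \<integral>x. ?w x * u j x \<partial>lborel) \<longlonglongrightarrow> (\<integral>x. ?w x * v x \<partial>lborel)" by (simp add: LIM_zero_iff)
  then have "(\<lambda>j. (\<integral>x. ?w x * u j x \<partial>lborel) / (\<integral>x. ?w x \<partial>lborel)) \<longlonglongrightarrow> (\<integral>x. ?w x * v x \<partial>lborel) / (\<integral>x. ?w x \<partial>lborel)"
    using kernel_weight_halfspace(4)[OF s y] by (intro tendsto_divide tendsto_const) auto
  then show ?thesis using y by (simp add: optimal_extension_def halfspace_def)
qed

section \<open>Limits of minimizing sequences\<close>

lemma AE_lborel_fst_snd:
  fixes P :: "'a::euclidean_space \<Rightarrow> bool"
  assumes "AE x in lborel. P x"
  shows "AE z in lborel. P (fst z) \<and> P (snd z :: 'a)"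
proof -
  obtain N where N: "{x \<in> space lborel. \<not> P x} \<subseteq> N" "N \<in> null_sets (lborel :: 'a measure)"
    using assms by (auto simp: eventually_ae_filter)
  then have [measurable]: "N \<in> sets borel" by auto
  have N0: "emeasure lborel N = 0" using N by auto
  let ?M = "{z. fst z \<in> N \<or> snd z \<in> N} :: ('a \<times> 'a) set"
  have [measurable]: "?M \<in> sets borel" by measurable
  have "emeasure lborel ?M = (\<integral>\<^sup>+z. indicator ?M z \<partial>lborel)" by simp
  also have "\<dots> \<le> (\<integral>\<^sup>+z. indicator N (fst z) + indicator N (snd z) \<partial>lborel)"
    by (intro nn_integral_mono) (auto simp: indicator_def)
  also have "\<dots> = (\<integral>\<^sup>+z. indicator N (fst z :: 'a) \<partial>(lborel :: ('a \<times> 'a) measure))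
      + (\<integral>\<^sup>+z. indicator N (snd z :: 'a) \<partial>(lborel :: ('a \<times> 'a) measure))"
    by (rule nn_integral_add) measurable
  also have "(\<integral>\<^sup>+z. indicator N (fst z :: 'a) \<partial>(lborel :: ('a \<times> 'a) measure)) = 0"
    by (subst nn_integral_lborel_pair_swap) (measurable, simp add: N0)
  also have "(\<integral>\<^sup>+z. indicator N (snd z :: 'a) \<partial>(lborel :: ('a \<times> 'a) measure)) = 0"
    by (subst nn_integral_lborel_pair) (measurable, simp add: N0)
  finally have "?M \<in> null_sets lborel" by (simp add: null_setsI)
  from AE_not_in[OF this] show ?thesis
    by eventually_elim (use N(1) in auto)
qed

lemma mass_eq_nn_integral:
  "mass p \<Omega> u = (\<integral>\<^sup>+x. ennreal (\<bar>indicat_real \<Omega> x * u x\<bar> powr p) \<partial>lborel)"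
  unfolding mass_def by (intro nn_integral_cong) (auto simp: indicator_def)

lemma seminorm2_eq_nn_integral:
  "seminorm2 s \<Omega> u = (\<integral>\<^sup>+z. ennreal (\<bar>indicat_real (touching \<Omega>) z * diffquot s u z\<bar> powr 2) \<partial>lborel)"
  unfolding seminorm2_def by (intro nn_integral_cong) (auto simp: indicator_def powr_numeral)

lemma Fatou_powr:
  fixes f :: "nat \<Rightarrow> 'a \<Rightarrow> real"
  assumes q: "q > 0" and [measurable]: "\<And>j. f j \<in> borel_measurable M" "g \<in> borel_measurable M"
    and lim: "AE x in M. (\<lambda>j. f j x) \<longlonglongrightarrow> g x"
    and b: "\<And>j. (\<integral>\<^sup>+x. ennreal (\<bar>f j x\<bar> powr q) \<partial>M) \<le> B"
  shows "(\<integral>\<^sup>+x. ennreal (\<bar>g x\<bar> powr q) \<partial>M) \<le> B"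
proof -
  have "(\<integral>\<^sup>+x. ennreal (\<bar>g x\<bar> powr q) \<partial>M) = (\<integral>\<^sup>+x. liminf (\<lambda>j. ennreal (\<bar>f j x\<bar> powr q)) \<partial>M)"
  proof (rule nn_integral_cong_AE)
    show "AE x in M. ennreal (\<bar>g x\<bar> powr q) = liminf (\<lambda>j. ennreal (\<bar>f j x\<bar> powr q))"
      using lim
    proof eventually_elim
      case (elim x)
      have "(\<lambda>j. ennreal (\<bar>f j x\<bar> powr q)) \<longlonglongrightarrow> ennreal (\<bar>g x\<bar> powr q)"
        by (intro tendsto_ennrealI tendsto_powr' tendsto_rabs elim tendsto_const) (use q in auto)
      from lim_imp_Liminf[OF trivial_limit_sequentially this] show ?case by (rule sym)
    qed
  qed
  also have "\<dots> \<le> liminf (\<lambda>j. \<integral>\<^sup>+x. ennreal (\<bar>f j x\<bar> powr q) \<partial>M)"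
    by (rule nn_integral_liminf) measurable
  also have "\<dots> \<le> B"
    using b by (intro Liminf_le) auto
  finally show ?thesis .
qed

text \<open>Both powers dominate their bases on the unit interval.\<close>

lemma one_minus_powr_le:
  fixes t \<theta> :: real
  assumes "0 \<le> t" "t \<le> 1" "0 < \<theta>" "\<theta> \<le> 1"
  shows "1 - (1 - t) powr \<theta> \<le> t powr \<theta>"
proof -
  show ?thesis using powr_mono'[of \<theta> 1 t] powr_mono'[of \<theta> 1 "1 - t"] assms by simp
qed

lemma indicator_times_tendsto:
  fixes a :: "nat \<Rightarrow> real"
  assumes "\<And>j. A j \<subseteq> A'" "x \<in> A' \<Longrightarrow> \<forall>\<^sub>F j in sequentially. x \<in> A j" "a \<longlonglongrightarrow> l"
  shows "(\<lambda>j. indicat_real (A j) x * a j) \<longlonglongrightarrow> indicat_real A' x * l"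
proof (cases "x \<in> A'")
  case True
  have "\<forall>\<^sub>F j in sequentially. a j = indicat_real (A j) x * a j"
    using assms(2)[OF True] by eventually_elim auto
  then have "(\<lambda>j. indicat_real (A j) x * a j) \<longlonglongrightarrow> l"
    using assms(3) by (rule Lim_transform_eventually[rotated])
  then show ?thesis using True by simp
next
  case False
  then have "x \<notin> A j" for j using assms(1)[of j] by blast
  then show ?thesis using False by simp
qed

text \<open>The domains \<open>\<Omega> j\<close> increase to \<open>\<Omega>'\<close> in the weak sense
  that every point of \<open>\<Omega>'\<close> is eventually in them; this covers a fixed half-space as
  well as half-spaces exhausting the whole space. Writing \<open>t\<close> for the mass of
  \<open>w\<close>, the Brezis-Lieb lemma shows that the remainders \<open>v j - w\<close> have
  asymptotic mass \<open>1 - t\<close> and energy \<open>E(v j) - E(w)\<close>. The inequality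
  \<open>lower\<close> for the remainders then bounds the energy of \<open>w\<close>. The amount of
  \<open>v j\<close> on \<open>B\<close> keeps \<open>t\<close> positive.\<close>

lemma minimizing_sequence_limit:
  fixes v :: "nat \<Rightarrow> real^'n::finite \<Rightarrow> real" and \<Omega> :: "nat \<Rightarrow> (real^'n) set"
  assumes p: "p > 1" and \<theta>: "0 < \<theta>" "\<theta> \<le> 1" and \<kappa>: "\<kappa> > 0" and \<sigma>: "\<sigma> \<ge> 0"
    and \<Omega>: "\<And>j. \<Omega> j \<in> sets borel" "\<Omega>' \<in> sets borel" "\<And>j. \<Omega> j \<subseteq> \<Omega>'"
      "\<And>x. x \<in> \<Omega>' \<Longrightarrow> \<forall>\<^sub>F j in sequentially. x \<in> \<Omega> j"
    and v: "\<And>j. v j \<in> borel_measurable borel" and w: "w \<in> borel_measurable borel"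
    and lim: "AE x in lborel. (\<lambda>j. v j x) \<longlonglongrightarrow> w x"
    and mass1: "\<And>j. mass p (\<Omega> j) (v j) = 1"
    and upper: "\<And>j. ennreal \<kappa> * seminorm2 s (\<Omega> j) (v j) \<le> ennreal (\<tau> j)" "\<And>j. \<tau> j \<ge> 0" "\<tau> \<longlonglongrightarrow> \<sigma>"
    and lower: "\<And>j u. u \<in> borel_measurable borel \<Longrightarrow> mass p (\<Omega> j) u < \<infinity> \<Longrightarrow>
      ennreal (\<sigma> * enn2real (mass p (\<Omega> j) u) powr \<theta>) \<le> ennreal \<kappa> * seminorm2 s (\<Omega> j) u"
    and B: "B \<in> sets borel" "emeasure lborel B < \<infinity>" "\<And>j. B \<subseteq> \<Omega> j"
    and c: "c > 0" "\<And>j. ennreal c \<le> (\<integral>\<^sup>+x\<in>B. ennreal \<bar>v j x\<bar> \<partial>lborel)"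
  shows "0 < mass p \<Omega>' w" "mass p \<Omega>' w \<le> 1"
    "ennreal \<kappa> * seminorm2 s \<Omega>' w \<le> ennreal (\<sigma> * enn2real (mass p \<Omega>' w) powr \<theta>)"
proof -
  note [measurable] = \<Omega>(1,2) v w B(1)
  have [measurable]: "diffquot s (v j) \<in> borel_measurable borel" "diffquot s w \<in> borel_measurable borel"
      "touching (\<Omega> j) \<in> sets borel" "touching \<Omega>' \<in> sets borel" for j
    by (intro borel_diffquot borel_touching v w \<Omega>)+
  \<comment> \<open>the cut-offs entering the two applications of \<open>brezis_lieb\<close>: small letters for the mass, capitals for the energy\<close>
  define f where "f j x = indicat_real (\<Omega> j) x * v j x" for j x
  define h where "h j x = indicat_real (\<Omega> j) x * w x" for j x
  define f' where "f' x = indicat_real \<Omega>' x * w x" for x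
  define F where "F j z = indicat_real (touching (\<Omega> j)) z * diffquot s (v j) z" for j z
  define H where "H j z = indicat_real (touching (\<Omega> j)) z * diffquot s w z" for j z
  define F' where "F' z = indicat_real (touching \<Omega>') z * diffquot s w z" for z
  have meas[measurable]: "f j \<in> borel_measurable lborel" "h j \<in> borel_measurable lborel" "f' \<in> borel_measurable lborel"
      "F j \<in> borel_measurable lborel" "H j \<in> borel_measurable lborel" "F' \<in> borel_measurable lborel" for j
    unfolding f_def[abs_def] h_def[abs_def] f'_def[abs_def] F_def[abs_def] H_def[abs_def] F'_def[abs_def] by measurable
  have tsub: "touching (\<Omega> j) \<subseteq> touching \<Omega>'" for j using \<Omega>(3)[of j] by (auto simp: touching_def)
  have tev: "\<forall>\<^sub>F j in sequentially. z \<in> touching (\<Omega> j)" if "z \<in> touching \<Omega>'" for z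
  proof (cases "fst z \<in> \<Omega>'")
    case True
    from \<Omega>(4)[OF True] show ?thesis by eventually_elim (auto simp: touching_def mem_Times_iff)
  next
    case False
    then have "snd z \<in> \<Omega>'" using that by (auto simp: touching_def mem_Times_iff)
    from \<Omega>(4)[OF this] show ?thesis by eventually_elim (auto simp: touching_def mem_Times_iff)
  qed
  have lim_f: "AE x in lborel. (\<lambda>j. f j x) \<longlonglongrightarrow> f' x"
    using lim unfolding f_def f'_def by eventually_elim (intro indicator_times_tendsto \<Omega>)
  have lim_h: "AE x in lborel. (\<lambda>j. h j x) \<longlonglongrightarrow> f' x"
    unfolding h_def f'_def by (intro AE_I2 indicator_times_tendsto \<Omega> tendsto_const)
  have lim_F: "AE z in lborel. (\<lambda>j. F j z) \<longlonglongrightarrow> F' z"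
    using AE_lborel_fst_snd[OF lim]
  proof eventually_elim
    case (elim z)
    have "(\<lambda>j. (v j (fst z) - v j (snd z)) * inverse (norm (fst z - snd z) powr ((real CARD('n) + 2 * s) / 2)))
        \<longlonglongrightarrow> (w (fst z) - w (snd z)) * inverse (norm (fst z - snd z) powr ((real CARD('n) + 2 * s) / 2))"
      using elim by (intro tendsto_mult tendsto_diff tendsto_const) auto
    then show ?case unfolding F_def F'_def diffquot_def divide_inverse
      by (intro indicator_times_tendsto tsub tev)
  qed
  have lim_H: "AE z in lborel. (\<lambda>j. H j z) \<longlonglongrightarrow> F' z"
    unfolding H_def F'_def by (intro AE_I2 indicator_times_tendsto tsub tev tendsto_const)

  have fin_v: "mass p (\<Omega> j) (v j) < \<infinity>" for j using mass1[of j] by simp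
  have int_f: "integrable lborel (\<lambda>x. \<bar>f j x\<bar> powr p)" for j
    unfolding f_def by (rule mass_Bochner(1)[OF v \<Omega>(1) fin_v])
  have f1: "(\<integral>x. \<bar>f j x\<bar> powr p \<partial>lborel) = 1" for j
    using mass1[of j] mass_Bochner(2)[OF v \<Omega>(1) fin_v, of j] by (simp add: f_def)
  have m1: "mass p \<Omega>' w \<le> 1"
    using mass1 unfolding mass_eq_nn_integral f'_def[symmetric] f_def[symmetric]
    by (intro Fatou_powr[OF _ meas(1,3) lim_f]) (use p in auto)
  then have fin_w: "mass p \<Omega>' w < \<infinity>" by (simp add: order_le_less_trans[OF _ ennreal_one_less_top])
  have int_f': "integrable lborel (\<lambda>x. \<bar>f' x\<bar> powr p)"
    unfolding f'_def by (rule mass_Bochner(1)[OF w \<Omega>(2) fin_w])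
  define t where "t = (\<integral>x. \<bar>f' x\<bar> powr p \<partial>lborel)"
  have mt: "mass p \<Omega>' w = ennreal t" unfolding t_def f'_def by (rule mass_Bochner(2)[OF w \<Omega>(2) fin_w])
  have t0: "t \<ge> 0" by (simp add: t_def)
  have t1: "t \<le> 1" using m1 t0 by (simp add: mt)
  define a where "a j = (\<integral>x. \<bar>f j x - h j x\<bar> powr p \<partial>lborel)" for j
  have "(\<lambda>j. (\<integral>x. \<bar>f j x\<bar> powr p \<partial>lborel) - a j) \<longlonglongrightarrow> t"
    unfolding a_def t_def
    by (rule brezis_lieb[OF _ meas(1,2,3) int_f _ int_f' _ lim_f lim_h, where B = 1])
      (use p f1 \<Omega>(3) in \<open>auto simp: h_def f'_def indicator_def\<close>)
  then have a: "a \<longlonglongrightarrow> 1 - t"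
    using tendsto_diff[OF tendsto_const[of 1], of "\<lambda>j. 1 - a j" t] by (simp add: f1)
  have a0: "a j \<ge> 0" for j by (simp add: a_def)
  have ma: "mass p (\<Omega> j) (\<lambda>x. v j x - w x) = ennreal (a j)" for j
  proof -
    have i: "integrable lborel (\<lambda>x. \<bar>f j x - h j x\<bar> powr p)"
    proof (rule integrable_abs_powr_diff)
      show "integrable lborel (\<lambda>x. \<bar>h j x\<bar> powr p)"
        by (rule Bochner_Integration.integrable_bound[OF int_f'])
          (use \<Omega>(3)[of j] in \<open>auto simp: h_def f'_def indicator_def\<close>)
    qed (use p int_f in auto)
    have "mass p (\<Omega> j) (\<lambda>x. v j x - w x) = (\<integral>\<^sup>+x. ennreal (\<bar>f j x - h j x\<bar> powr p) \<partial>lborel)"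
      unfolding mass_eq_nn_integral f_def h_def right_diff_distrib ..
    also have "\<dots> = ennreal (a j)" unfolding a_def by (intro nn_integral_eq_integral i) auto
    finally show ?thesis .
  qed

  define e where "e j = (\<integral>z. \<bar>F j z\<bar> powr 2 \<partial>lborel)" for j
  have fin_F: "seminorm2 s (\<Omega> j) (v j) < \<infinity>" for j
  proof (rule ccontr)
    assume "\<not> seminorm2 s (\<Omega> j) (v j) < \<infinity>"
    then have "seminorm2 s (\<Omega> j) (v j) = top" by (simp add: less_top[symmetric])
    then have "ennreal \<kappa> * seminorm2 s (\<Omega> j) (v j) = top"
      using \<kappa> by (simp add: ennreal_mult_top)
    then show False using upper(1)[of j] by (simp add: top_unique)
  qed
  have int_F: "integrable lborel (\<lambda>z. \<bar>F j z\<bar> powr 2)" for j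
    unfolding F_def by (rule seminorm2_Bochner(1)[OF v \<Omega>(1) fin_F])
  have sv: "seminorm2 s (\<Omega> j) (v j) = ennreal (e j)" for j
    unfolding e_def F_def by (rule seminorm2_Bochner(2)[OF v \<Omega>(1) fin_F])
  have e0: "e j \<ge> 0" for j by (simp add: e_def)
  have \<tau>0: "\<tau> j \<ge> \<kappa> * e j" for j
    using upper(1)[of j] upper(2)[of j] \<kappa> e0[of j] by (simp add: sv ennreal_mult[symmetric])
  have "Bseq \<tau>" using upper(3) by (intro convergent_imp_Bseq) (auto simp: convergent_def)
  then obtain T where T: "\<And>j. \<bar>\<tau> j\<bar> \<le> T" by (auto simp: Bseq_def)
  have eT: "e j \<le> T / \<kappa>" for j
    using \<tau>0[of j] T[of j] \<kappa> by (simp add: field_simps)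
  have "seminorm2 s \<Omega>' w \<le> ennreal (T / \<kappa>)"
    unfolding seminorm2_eq_nn_integral F'_def[symmetric]
  proof (rule Fatou_powr[OF _ meas(4,6) lim_F])
    show "(\<integral>\<^sup>+z. ennreal (\<bar>F j z\<bar> powr 2) \<partial>lborel) \<le> ennreal (T / \<kappa>)" for j
      using sv[of j] eT[of j] unfolding seminorm2_eq_nn_integral F_def[symmetric] by (simp add: ennreal_leI)
  qed simp
  then have fin_F': "seminorm2 s \<Omega>' w < \<infinity>" by (simp add: order_le_less_trans)
  have int_F': "integrable lborel (\<lambda>z. \<bar>F' z\<bar> powr 2)"
    unfolding F'_def by (rule seminorm2_Bochner(1)[OF w \<Omega>(2) fin_F'])
  define E where "E = (\<integral>z. \<bar>F' z\<bar> powr 2 \<partial>lborel)"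
  have sw: "seminorm2 s \<Omega>' w = ennreal E"
    unfolding E_def F'_def by (rule seminorm2_Bochner(2)[OF w \<Omega>(2) fin_F'])
  define b where "b j = (\<integral>z. \<bar>F j z - H j z\<bar> powr 2 \<partial>lborel)" for j
  have HF': "\<bar>H j z\<bar> \<le> \<bar>F' z\<bar>" for j z
    using tsub[of j] by (auto simp: H_def F'_def indicator_def)
  have eb: "(\<lambda>j. e j - b j) \<longlonglongrightarrow> E"
    unfolding e_def b_def E_def
    by (rule brezis_lieb[OF _ meas(4,5,6) int_F _ int_F' HF' lim_F lim_H, where B = "T / \<kappa>"])
      (use eT in \<open>auto simp: e_def\<close>)
  have sb: "seminorm2 s (\<Omega> j) (\<lambda>x. v j x - w x) = ennreal (b j)" for j
  proof -
    have i: "integrable lborel (\<lambda>z. \<bar>F j z - H j z\<bar> powr 2)"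
    proof (rule integrable_abs_powr_diff)
      show "integrable lborel (\<lambda>z. \<bar>H j z\<bar> powr 2)"
        by (rule Bochner_Integration.integrable_bound[OF int_F'])
          (use HF' in \<open>auto simp: abs_le_square_iff[symmetric] simp del: split_paired_All\<close>)
    qed (use int_F in auto)
    have "seminorm2 s (\<Omega> j) (\<lambda>x. v j x - w x) = (\<integral>\<^sup>+z. ennreal (\<bar>F j z - H j z\<bar> powr 2) \<partial>lborel)"
      unfolding seminorm2_eq_nn_integral diffquot_diff F_def H_def right_diff_distrib ..
    also have "\<dots> = ennreal (b j)" unfolding b_def by (intro nn_integral_eq_integral i) auto
    finally show ?thesis .
  qed
  have b0: "b j \<ge> 0" for j by (simp add: b_def)
  have low: "\<sigma> * a j powr \<theta> \<le> \<kappa> * b j" for j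
  proof -
    have "ennreal (\<sigma> * a j powr \<theta>) \<le> ennreal \<kappa> * ennreal (b j)"
      using lower[of "\<lambda>x. v j x - w x" j] a0[of j] by (simp add: ma sb)
    then show ?thesis using \<kappa> b0[of j] by (simp add: ennreal_mult[symmetric])
  qed
  \<comment> \<open>the inequality for the remainders, in the limit\<close>
  have "\<kappa> * E \<le> \<sigma> - \<sigma> * (1 - t) powr \<theta>"
  proof (rule LIMSEQ_le)
    show "(\<lambda>j. \<kappa> * (e j - b j)) \<longlonglongrightarrow> \<kappa> * E" by (intro tendsto_intros eb)
    show "(\<lambda>j. \<tau> j - \<sigma> * a j powr \<theta>) \<longlonglongrightarrow> \<sigma> - \<sigma> * (1 - t) powr \<theta>"
      using \<theta> a0 by (intro tendsto_intros upper(3) tendsto_powr' a) auto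
    show "\<exists>N. \<forall>j\<ge>N. \<kappa> * (e j - b j) \<le> \<tau> j - \<sigma> * a j powr \<theta>"
    proof (intro exI allI impI)
      show "\<kappa> * (e j - b j) \<le> \<tau> j - \<sigma> * a j powr \<theta>" for j
        using low[of j] \<tau>0[of j] unfolding right_diff_distrib by linarith
    qed
  qed
  also have "\<dots> = \<sigma> * (1 - (1 - t) powr \<theta>)" by (simp add: right_diff_distrib)
  also have "\<dots> \<le> \<sigma> * t powr \<theta>"
    using \<sigma> t0 t1 \<theta> by (intro mult_left_mono one_minus_powr_le) auto
  finally have fine: "\<kappa> * E \<le> \<sigma> * t powr \<theta>" .
  then show "ennreal \<kappa> * seminorm2 s \<Omega>' w \<le> ennreal (\<sigma> * enn2real (mass p \<Omega>' w) powr \<theta>)"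
    using \<kappa> t0 by (simp add: sw mt ennreal_mult'[symmetric] ennreal_leI)
  show "mass p \<Omega>' w \<le> 1" by (rule m1)
  show "0 < mass p \<Omega>' w"
  proof (rule ccontr)
    assume "\<not> 0 < mass p \<Omega>' w"
    \<comment> \<open>then \<open>f j\<close> would tend to zero in \<open>L\<^sup>1\<close> on \<open>B\<close>\<close>
    then have "t = 0" using t0 by (simp add: mt)
    then have "AE x in lborel. \<bar>f' x\<bar> powr p = 0"
      unfolding t_def by (subst (asm) integral_nonneg_eq_0_iff_AE[OF int_f']) auto
    with lim_f have null: "AE x in lborel. (\<lambda>j. f j x) \<longlonglongrightarrow> 0" by eventually_elim auto
    have iB: "integrable lborel (indicat_real B)" using B by (simp add: integrable_indicator_iff)
    have to0: "(\<lambda>j. \<integral>x. indicat_real B x * \<bar>f j x\<bar> \<partial>lborel) \<longlonglongrightarrow> 0"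
      by (rule weighted_L1_tendsto_zero[OF p iB _ _ meas(1) int_f _ null, where K = 1 and B = 1])
        (use f1 in \<open>auto simp: indicator_def\<close>)
    have "c \<le> (\<integral>x. indicat_real B x * \<bar>f j x\<bar> \<partial>lborel)" for j
    proof -
      have i: "integrable lborel (\<lambda>x. indicat_real B x * \<bar>f j x\<bar>)"
        by (rule integrable_weight_times_abs[OF p iB, where K = 1]) (use int_f in \<open>auto simp: indicator_def\<close>)
      have "ennreal c \<le> (\<integral>\<^sup>+x\<in>B. ennreal \<bar>v j x\<bar> \<partial>lborel)" by (rule c)
      also have "\<dots> = (\<integral>\<^sup>+x. ennreal (indicat_real B x * \<bar>f j x\<bar>) \<partial>lborel)"
        using B(3)[of j] by (intro nn_integral_cong) (auto simp: f_def indicator_def)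
      also have "\<dots> = ennreal (\<integral>x. indicat_real B x * \<bar>f j x\<bar> \<partial>lborel)"
        by (intro nn_integral_eq_integral i) auto
      finally show ?thesis by (subst (asm) ennreal_le_iff) auto
    qed
    then have "c \<le> 0" by (intro LIMSEQ_le_const[OF to0]) auto
    then show False using c(1) by simp
  qed
qed

section \<open>The variational constants in terms of Borel functions\<close>

lemma mass_cong_AE: "AE x in lborel. u x = v x \<Longrightarrow> mass p \<Omega> u = mass p \<Omega> v"
  unfolding mass_def by (intro nn_integral_cong_AE) auto

lemma pos_halfspace_eq: "pos_halfspace k = halfspace k 0"
  by (simp add: pos_halfspace_def halfspace_def)

lemma energy_eq_seminorm2:
  fixes u v :: "real^'n::finite \<Rightarrow> real"
  assumes uv: "AE x in lborel. u x = v x" and Z: "AE z in lborel. z \<in> Z \<longleftrightarrow> z \<in> touching \<Omega>"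
  shows "energy s u Z = ennreal (frac_const CARD('n) s / 2) * seminorm2 s \<Omega> v"
proof -
  have "(\<integral>\<^sup>+z\<in>Z. ennreal ((u (fst z) - u (snd z))\<^sup>2 / norm (fst z - snd z) powr (real CARD('n) + 2 * s)) \<partial>lborel)
      = seminorm2 s \<Omega> v"
    unfolding seminorm2_def
  proof (rule nn_integral_cong_AE)
    show "AE z in lborel. ennreal ((u (fst z) - u (snd z))\<^sup>2 / norm (fst z - snd z) powr (real CARD('n) + 2 * s)) * indicator Z z
        = ennreal ((diffquot s v z)\<^sup>2) * indicator (touching \<Omega>) z"
      using Z AE_lborel_fst_snd[OF uv]
    proof eventually_elim
      case (elim z)
      have "(diffquot s v z)\<^sup>2 = norm (fst z - snd z) powr - (real CARD('n) + 2 * s) * (v (fst z) - v (snd z))\<^sup>2"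
        using diffquot_square[of s v "fst z" "snd z"] by simp
      also have "\<dots> = (v (fst z) - v (snd z))\<^sup>2 / norm (fst z - snd z) powr (real CARD('n) + 2 * s)"
        unfolding powr_minus_divide by simp
      finally show ?case using elim by (simp add: indicator_def)
    qed
  qed
  then show ?thesis unfolding energy_def by (simp add: nn_integral_completion)
qed

lemma energy_UNIV_eq:
  fixes u v :: "real^'n::finite \<Rightarrow> real"
  assumes "AE x in lborel. u x = v x"
  shows "energy s u UNIV = ennreal (frac_const CARD('n) s / 2) * seminorm2 s UNIV v"
  using assms by (rule energy_eq_seminorm2) (simp add: touching_def)

text \<open>The two domains differ only in pairs with a point on the boundary hyperplane.\<close>

lemma energy_Sr_eq:
  fixes u v :: "real^'n::finite \<Rightarrow> real"
  assumes "AE x in lborel. u x = v x"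
  shows "energy s u (Sr_domain k) = ennreal (frac_const CARD('n) s / 2) * seminorm2 s (halfspace k 0) v"
proof (rule energy_eq_seminorm2[OF assms])
  show "AE z in lborel. z \<in> Sr_domain k \<longleftrightarrow> z \<in> touching (halfspace k 0)"
    using AE_lborel_fst_snd[OF AE_lborel_coordinate_neq[of k 0]]
    by eventually_elim (auto simp: Sr_domain_def touching_def halfspace_def neg_halfspace_def)
qed

lemma nn_integral_lebesgue_on_powr:
  fixes A :: "(real^'n::finite) set"
  assumes "A \<in> sets borel"
  shows "(\<integral>\<^sup>+x. ennreal (\<bar>u x\<bar> powr p) \<partial>lebesgue_on A) = mass p A u"
  using assms unfolding mass_def by (subst nn_integral_restrict_space) (auto simp: nn_integral_completion)

lemma Lp_on_iff:
  fixes A :: "(real^'n::finite) set"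
  assumes A: "A \<in> sets borel" and [measurable]: "u \<in> borel_measurable (lebesgue_on A)"
  shows "u \<in> Lp_on p A \<longleftrightarrow> mass p A u < \<infinity>"
  unfolding Lp_on_def nn_integral_lebesgue_on_powr[OF A, symmetric]
  by (simp add: integrable_iff_bounded)

lemma Lp_norm_on_eq:
  fixes A :: "(real^'n::finite) set"
  assumes A: "A \<in> sets borel" and [measurable]: "u \<in> borel_measurable (lebesgue_on A)"
  shows "(Lp_norm_on p A u)\<^sup>2 = enn2real (mass p A u) powr (2 / p)"
  unfolding Lp_norm_on_def nn_integral_lebesgue_on_powr[OF A, symmetric]
  by (subst integral_eq_nn_integral) (auto simp: power2_eq_square powr_add[symmetric])

lemma nonzero_on_iff:
  fixes A :: "(real^'n::finite) set"
  assumes A: "A \<in> sets borel" and [measurable]: "u \<in> borel_measurable (lebesgue_on A)"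
  shows "nonzero_on A u \<longleftrightarrow> mass p A u \<noteq> 0"
  unfolding nonzero_on_def nn_integral_lebesgue_on_powr[OF A, symmetric]
  by (subst nn_integral_0_iff_AE) auto

lemma borel_imp_lebesgue_on:
  fixes u :: "real^'n::finite \<Rightarrow> real"
  assumes "u \<in> borel_measurable borel"
  shows "u \<in> borel_measurable lebesgue" "u \<in> borel_measurable (lebesgue_on A)"
proof -
  show 1: "u \<in> borel_measurable lebesgue" using assms by (intro measurable_completion) simp
  show "u \<in> borel_measurable (lebesgue_on A)" by (rule measurable_restrict_space1[OF 1])
qed

lemma mult_le_of_le_divide_ennreal:
  fixes a b :: ennreal
  assumes "a \<le> b / ennreal c" "c > 0"
  shows "a * ennreal c \<le> b"
proof -
  have "a * ennreal c \<le> b / ennreal c * ennreal c" by (rule mult_right_mono[OF assms(1)]) simp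
  also have "\<dots> = b" using assms(2) by (simp add: ennreal_divide_times ennreal_divide_self)
  finally show ?thesis .
qed

lemma frac_const_pos:
  assumes "0 < s" "s < 1"
  shows "frac_const n s > 0"
  unfolding frac_const_def using assms
  by (intro divide_pos_pos mult_pos_pos Gamma_real_pos) (auto intro: add_nonneg_pos)

text \<open>The infimum as an inequality for all functions of finite mass: for vanishing mass or infinite
  energy it is trivial.\<close>

lemma S_const_Sr_le:
  fixes u :: "real^'n::finite \<Rightarrow> real"
  assumes s: "0 < s" "s < 1" and u: "u \<in> borel_measurable borel"
    and p: "p = critical_exponent CARD('n) s"
    and fin: "mass p (halfspace k 0) u < \<infinity>"
  shows "S_const_Sr k s * ennreal (enn2real (mass p (halfspace k 0) u) powr (2 / p))
    \<le> ennreal (frac_const CARD('n) s / 2) * seminorm2 s (halfspace k 0) u"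
proof (cases "mass p (halfspace k 0) u = 0 \<or> energy s u (Sr_domain k) = \<infinity>")
  case True
  then show ?thesis using energy_Sr_eq[of u u s k] by auto
next
  case False
  let ?H = "pos_halfspace k"
  note H = borel_halfspace[of k 0, folded pos_halfspace_eq]
  have "u \<in> D_space_Sr k s" "nonzero_on ?H u"
    using False fin borel_imp_lebesgue_on[OF u]
    by (auto simp: D_space_Sr_def Lp_on_iff[OF H] nonzero_on_iff[OF H, where p = p] p[symmetric] pos_halfspace_eq[symmetric] less_top)
  then have "S_const_Sr k s \<le> energy s u (Sr_domain k) / ennreal ((Lp_norm_on p ?H u)\<^sup>2)"
    unfolding S_const_Sr_def p by (intro INF_lower) auto
  then have "S_const_Sr k s \<le> energy s u (Sr_domain k) / ennreal (enn2real (mass p ?H u) powr (2 / p))"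
    by (simp add: Lp_norm_on_eq[OF H] borel_imp_lebesgue_on[OF u])
  moreover have "enn2real (mass p ?H u) powr (2 / p) > 0"
    using False fin by (auto simp: pos_halfspace_eq enn2real_eq_0_iff)
  ultimately have "S_const_Sr k s * ennreal (enn2real (mass p ?H u) powr (2 / p)) \<le> energy s u (Sr_domain k)"
    by (rule mult_le_of_le_divide_ennreal)
  then show ?thesis using energy_Sr_eq[of u u s k] by (simp add: pos_halfspace_eq)
qed

lemma S_const_le:
  fixes u :: "real^'n::finite \<Rightarrow> real"
  assumes s: "0 < s" "s < 1" and u: "u \<in> borel_measurable borel"
    and p: "p = critical_exponent CARD('n) s"
    and fin: "mass p UNIV u < \<infinity>"
  shows "S_const TYPE('n) s * ennreal (enn2real (mass p UNIV u) powr (2 / p))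
    \<le> ennreal (frac_const CARD('n) s / 2) * seminorm2 s UNIV u"
proof (cases "mass p UNIV u = 0 \<or> energy s u UNIV = \<infinity>")
  case True
  then show ?thesis using energy_UNIV_eq[of u u s] by auto
next
  case False
  have H: "UNIV \<in> sets (borel :: (real^'n) measure)" by simp
  have "u \<in> D_space s" "nonzero_on UNIV u"
    using False fin borel_imp_lebesgue_on[OF u]
    by (auto simp: D_space_def Lp_on_iff[OF H] nonzero_on_iff[OF H, where p = p] p[symmetric] less_top)
  then have "S_const TYPE('n) s \<le> energy s u UNIV / ennreal ((Lp_norm_on p UNIV u)\<^sup>2)"
    unfolding S_const_def p by (intro INF_lower) auto
  then have "S_const TYPE('n) s \<le> energy s u UNIV / ennreal (enn2real (mass p UNIV u) powr (2 / p))"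
    by (simp add: Lp_norm_on_eq[OF H] borel_imp_lebesgue_on[OF u])
  moreover have "enn2real (mass p UNIV u) powr (2 / p) > 0"
    using False fin by (auto simp: enn2real_eq_0_iff)
  ultimately have "S_const TYPE('n) s * ennreal (enn2real (mass p UNIV u) powr (2 / p)) \<le> energy s u UNIV"
    by (rule mult_le_of_le_divide_ennreal)
  then show ?thesis using energy_UNIV_eq[of u u s] by simp
qed

lemma translate_to_halfspace_0:
  fixes v :: "real^'n::finite \<Rightarrow> real"
  assumes [measurable]: "v \<in> borel_measurable borel" and p: "p * (real CARD('n) / 2 - s) = real CARD('n)"
  obtains u where "u \<in> borel_measurable borel" "mass p (halfspace k 0) u = mass p (halfspace k d) v"
    "seminorm2 s (halfspace k 0) u = seminorm2 s (halfspace k d) v"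
proof
  define a :: "real^'n" where "a = axis k d"
  let ?u = "\<lambda>x. v (x - a)"
  show m[measurable]: "?u \<in> borel_measurable borel" by measurable
  have H: "{x. a + 1 *\<^sub>R x \<in> halfspace k 0} = halfspace k d"
    by (auto simp: halfspace_def a_def)
  show "mass p (halfspace k 0) ?u = mass p (halfspace k d) v"
    using mass_rescale[of ?u "halfspace k 0" 1 p s a] p m unfolding H by simp
  show "seminorm2 s (halfspace k 0) ?u = seminorm2 s (halfspace k d) v"
    using seminorm2_rescale[of ?u "halfspace k 0" 1 s a] m unfolding H by simp
qed

lemma S_const_Sr_le_translated:
  fixes u :: "real^'n::finite \<Rightarrow> real"
  assumes s: "0 < s" "s < 1" and u: "u \<in> borel_measurable borel"
    and p: "p = critical_exponent CARD('n) s" "p * (real CARD('n) / 2 - s) = real CARD('n)"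
    and fin: "mass p (halfspace k d) u < \<infinity>"
  shows "S_const_Sr k s * ennreal (enn2real (mass p (halfspace k d) u) powr (2 / p))
    \<le> ennreal (frac_const CARD('n) s / 2) * seminorm2 s (halfspace k d) u"
proof -
  obtain v where v: "v \<in> borel_measurable borel" "mass p (halfspace k 0) v = mass p (halfspace k d) u"
    "seminorm2 s (halfspace k 0) v = seminorm2 s (halfspace k d) u"
    by (rule translate_to_halfspace_0[OF u p(2)])
  show ?thesis using S_const_Sr_le[OF s v(1) p(1), of k] fin by (simp add: v)
qed

lemma seminorm2_mono: "\<Omega> \<subseteq> \<Omega>' \<Longrightarrow> seminorm2 s \<Omega> u \<le> seminorm2 s \<Omega>' u"
  unfolding seminorm2_def by (intro nn_integral_mono) (auto simp: touching_def indicator_def)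

lemma mass_halfspace_tendsto:
  fixes u :: "real^'n::finite \<Rightarrow> real"
  assumes [measurable]: "u \<in> borel_measurable borel"
  shows "(\<lambda>d::nat. mass p (halfspace k (real d)) u) \<longlonglongrightarrow> mass p UNIV u"
  unfolding mass_def
proof (rule nn_integral_LIMSEQ)
  show "incseq (\<lambda>d x. ennreal (\<bar>u x\<bar> powr p) * indicator (halfspace k (real d)) x)"
    by (auto simp: incseq_def le_fun_def indicator_def halfspace_def)
  fix x :: "real^'n"
  obtain N :: nat where N: "- x $ k < real N" using reals_Archimedean2 by blast
  show "(\<lambda>d. ennreal (\<bar>u x\<bar> powr p) * indicator (halfspace k (real d)) x) \<longlonglongrightarrow> ennreal (\<bar>u x\<bar> powr p) * indicator UNIV x"
  proof (rule tendsto_eventually)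
    show "\<forall>\<^sub>F d in sequentially. ennreal (\<bar>u x\<bar> powr p) * indicator (halfspace k (real d)) x = ennreal (\<bar>u x\<bar> powr p) * indicator UNIV x"
      using eventually_ge_at_top[of N] by eventually_elim (use N in \<open>auto simp: halfspace_def\<close>)
  qed
qed measurable

lemma lebesgue_borel_version:
  fixes u :: "real^'n::finite \<Rightarrow> real"
  assumes "u \<in> borel_measurable lebesgue"
  obtains v where "v \<in> borel_measurable borel" "AE x in lborel. u x = v x"
  using completion_ex_borel_measurable_real[OF assms] by auto

text \<open>Instead of translating the function into the half-space, the half-space is translated until
  it exhausts the whole space.\<close>

lemma S_const_Sr_le_S_const:
  fixes k :: "'n::finite"
  assumes s: "0 < s" "s < 1"
    and p: "p = critical_exponent CARD('n) s" "p * (real CARD('n) / 2 - s) = real CARD('n)" "p > 2"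
  shows "S_const_Sr k s \<le> S_const TYPE('n) s"
  unfolding S_const_def
proof (rule INF_greatest)
  fix u :: "real^'n \<Rightarrow> real" assume "u \<in> {u. u \<in> D_space s \<and> nonzero_on UNIV u}"
  then have uD: "u \<in> Lp_on p UNIV" "energy s u UNIV < \<infinity>" and nz: "nonzero_on UNIV u"
    by (auto simp: D_space_def p(1))
  have um: "u \<in> borel_measurable (lebesgue_on UNIV)" using uD(1) by (simp add: Lp_on_def)
  then have "u \<in> borel_measurable lebesgue" by simp
  then obtain v where v: "v \<in> borel_measurable borel" and uv: "AE x in lborel. u x = v x"
    by (rule lebesgue_borel_version)
  have U: "UNIV \<in> sets (borel :: (real^'n) measure)" by simp
  define m where "m = mass p UNIV v"
  have m: "mass p UNIV u = m" unfolding m_def by (rule mass_cong_AE[OF uv])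
  have mfin: "m < \<infinity>" "m \<noteq> 0"
    using uD(1) nz by (auto simp: Lp_on_iff[OF U um] nonzero_on_iff[OF U um, of p] m)
  define N where "N = enn2real m powr (2 / p)"
  have N: "N > 0" using mfin by (auto simp: N_def enn2real_eq_0_iff)
  define e where "e = energy s u UNIV"
  have le: "S_const_Sr k s * ennreal (enn2real (mass p (halfspace k (real d)) v) powr (2 / p)) \<le> e" for d :: nat
  proof -
    have "mass p (halfspace k (real d)) v \<le> m"
      unfolding m_def mass_def by (intro nn_integral_mono) (auto simp: indicator_def)
    then have "S_const_Sr k s * ennreal (enn2real (mass p (halfspace k (real d)) v) powr (2 / p))
      \<le> ennreal (frac_const CARD('n) s / 2) * seminorm2 s (halfspace k (real d)) v"
      using mfin(1) by (intro S_const_Sr_le_translated s v p) auto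
    also have "\<dots> \<le> e" unfolding e_def energy_UNIV_eq[OF uv]
      by (intro mult_left_mono seminorm2_mono) auto
    finally show ?thesis .
  qed
  have "(\<lambda>d::nat. enn2real (mass p (halfspace k (real d)) v)) \<longlonglongrightarrow> enn2real m"
    using mass_halfspace_tendsto[OF v, of p k] mfin unfolding m_def[symmetric]
    by (intro tendsto_enn2real) auto
  then have "(\<lambda>d::nat. ennreal (enn2real (mass p (halfspace k (real d)) v) powr (2 / p))) \<longlonglongrightarrow> ennreal N"
    unfolding N_def using p(3) by (intro tendsto_ennrealI tendsto_powr' tendsto_const) auto
  then have "(\<lambda>d::nat. S_const_Sr k s * ennreal (enn2real (mass p (halfspace k (real d)) v) powr (2 / p))) \<longlonglongrightarrow> S_const_Sr k s * ennreal N"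
    using N by (intro tendsto_mult_ennreal tendsto_const) auto
  then have fin: "S_const_Sr k s * ennreal N \<le> e"
    by (rule LIMSEQ_le_const2) (use le in auto)
  have "S_const_Sr k s = S_const_Sr k s * ennreal N / ennreal N"
    using N by (simp add: ennreal_mult_divide_eq)
  also have "\<dots> \<le> e / ennreal N" by (rule divide_right_mono_ennreal[OF fin])
  also have "\<dots> = energy s u UNIV / ennreal ((Lp_norm_on (critical_exponent CARD('n) s) UNIV u)\<^sup>2)"
    by (simp add: e_def N_def Lp_norm_on_eq[OF U um] m p(1)[symmetric])
  finally show "S_const_Sr k s \<le> energy s u UNIV / ennreal ((Lp_norm_on (critical_exponent CARD('n) s) UNIV u)\<^sup>2)" .
qed

section \<open>Existence of a minimizer\<close>

lemma seminorm2_cmult: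
  assumes u: "u \<in> borel_measurable borel" "\<Omega> \<in> sets borel"
  shows "seminorm2 s \<Omega> (\<lambda>x. c * u x) = ennreal (c\<^sup>2) * seminorm2 s \<Omega> u"
proof -
  have [measurable]: "diffquot s u \<in> borel_measurable borel" "touching \<Omega> \<in> sets borel"
    by (intro borel_diffquot borel_touching u)+
  have m: "(\<lambda>z. ennreal ((diffquot s u z)\<^sup>2) * indicator (touching \<Omega>) z) \<in> borel_measurable lborel"
    by measurable
  have "diffquot s (\<lambda>x. c * u x) z = c * diffquot s u z" for z
    by (simp add: diffquot_def right_diff_distrib)
  then show ?thesis unfolding seminorm2_def nn_integral_cmult[OF m, symmetric]
    by (intro nn_integral_cong) (simp add: power_mult_distrib ennreal_mult mult.assoc)
qed

lemma mass_cmult: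
  assumes [measurable]: "u \<in> borel_measurable borel" "\<Omega> \<in> sets borel"
  shows "mass p \<Omega> (\<lambda>x. c * u x) = ennreal (\<bar>c\<bar> powr p) * mass p \<Omega> u"
proof -
  have m: "(\<lambda>x. ennreal (\<bar>u x\<bar> powr p) * indicator \<Omega> x) \<in> borel_measurable lborel" by measurable
  show ?thesis unfolding mass_def nn_integral_cmult[OF m, symmetric]
    by (intro nn_integral_cong) (simp add: abs_mult powr_mult ennreal_mult mult.assoc)
qed

text \<open>Both sides of the quotient are homogeneous of degree two, so an almost minimizer can be
  scaled to mass \<open>1\<close>.\<close>

lemma normalized_almost_minimizer:
  fixes k :: "'n::finite"
  assumes p: "p = critical_exponent CARD('n) s" "p > 2" and e: "S_const_Sr k s < ennreal e"
    and \<kappa>: "\<kappa> = frac_const CARD('n) s / 2"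
  obtains u :: "real^'n \<Rightarrow> real" where "u \<in> borel_measurable borel" "mass p (halfspace k 0) u = 1"
    "ennreal \<kappa> * seminorm2 s (halfspace k 0) u \<le> ennreal e"
proof -
  let ?H = "halfspace k 0"
  note H = borel_halfspace[of k 0]
  obtain u where uD: "u \<in> D_space_Sr k s" and nz: "nonzero_on ?H u" and
    q: "energy s u (Sr_domain k) / ennreal ((Lp_norm_on p ?H u)\<^sup>2) < ennreal e"
    using e unfolding S_const_Sr_def INF_less_iff by (auto simp: p(1) pos_halfspace_eq)
  have um: "u \<in> borel_measurable lebesgue" and uL: "u \<in> Lp_on p ?H"
    and fin: "energy s u (Sr_domain k) < \<infinity>"
    using uD by (auto simp: D_space_Sr_def p(1) pos_halfspace_eq)
  have um': "u \<in> borel_measurable (lebesgue_on ?H)" by (rule measurable_restrict_space1[OF um])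
  obtain v where v: "v \<in> borel_measurable borel" and uv: "AE x in lborel. u x = v x"
    by (rule lebesgue_borel_version[OF um])
  define m where "m = enn2real (mass p ?H v)"
  have mass_u: "mass p ?H u = mass p ?H v" by (rule mass_cong_AE[OF uv])
  have mv: "mass p ?H v = ennreal m" and m: "m > 0"
    using uL nz by (auto simp: Lp_on_iff[OF H um'] nonzero_on_iff[OF H um', of p] mass_u m_def enn2real_positive_iff zero_less_iff_neq_zero)
  define c where "c = m powr - (1 / p)"
  have c2: "c\<^sup>2 = 1 / m powr (2 / p)"
    using m by (simp add: c_def power2_eq_square powr_add[symmetric] powr_minus_divide)
  have cp: "\<bar>c\<bar> powr p = 1 / m"
  proof -
    have "c powr p = m powr - 1" using p(2) by (simp add: c_def powr_powr)
    then show ?thesis using m by (simp add: c_def powr_minus_divide)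
  qed
  show thesis
  proof (rule that[of "\<lambda>x. c * v x"])
    show "(\<lambda>x. c * v x) \<in> borel_measurable borel" using v by measurable
    show "mass p ?H (\<lambda>x. c * v x) = 1"
      using m by (simp add: mass_cmult[OF v H] mv cp ennreal_mult[symmetric])
    have "ennreal \<kappa> * seminorm2 s ?H (\<lambda>x. c * v x) = ennreal (1 / m powr (2 / p)) * energy s u (Sr_domain k)"
      by (simp add: seminorm2_cmult[OF v H] energy_Sr_eq[OF uv] \<kappa> c2 mult.left_commute)
    also have "\<dots> = energy s u (Sr_domain k) / ennreal (m powr (2 / p))"
      using m by (simp add: divide_ennreal_def inverse_ennreal mult.commute inverse_eq_divide)
    also have "\<dots> \<le> ennreal e"
      using q by (simp add: Lp_norm_on_eq[OF H um'] mass_u m_def)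
    finally show "ennreal \<kappa> * seminorm2 s ?H (\<lambda>x. c * v x) \<le> ennreal e" .
  qed
qed

lemma constant_or_diverging:
  fixes d :: "nat \<Rightarrow> nat"
  obtains r D where "strict_mono (r :: nat \<Rightarrow> nat)" "\<And>j. d (r j) = D" | "filterlim d at_top sequentially"
proof (cases "\<exists>D. infinite {j. d j = D}")
  case True
  then obtain D where D: "infinite {j. d j = D}" by blast
  show thesis
  proof (rule that(1))
    show "strict_mono (enumerate {j. d j = D})" using D by (rule strict_mono_enumerate)
    show "d (enumerate {j. d j = D} j) = D" for j using enumerate_in_set[OF D, of j] by simp
  qed
next
  case False
  have "filterlim d at_top sequentially"
    unfolding filterlim_at_top
  proof
    fix N
    have "finite (\<Union>D\<in>{..<N}. {j. d j = D})" using False by auto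
    also have "(\<Union>D\<in>{..<N}. {j. d j = D}) = {j. \<not> N \<le> d j}" by auto
    finally show "\<forall>\<^sub>F j in sequentially. N \<le> d j" by (simp add: eventually_cofinite[symmetric] cofinite_eq_sequentially)
  qed
  then show thesis by (rule that(2))
qed

lemma measurable_AE_limit:
  fixes f :: "nat \<Rightarrow> real^'n::finite \<Rightarrow> real"
  assumes [measurable]: "\<And>j. f j \<in> borel_measurable borel" and c: "AE x in lborel. convergent (\<lambda>j. f j x)"
  obtains w where "w \<in> borel_measurable borel" "AE x in lborel. (\<lambda>j. f j x) \<longlonglongrightarrow> w x"
proof
  show "(\<lambda>x. lim (\<lambda>j. f j x)) \<in> borel_measurable borel" by measurable
  show "AE x in lborel. (\<lambda>j. f j x) \<longlonglongrightarrow> lim (\<lambda>j. f j x)"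
    using c by eventually_elim (simp add: convergent_LIMSEQ_iff)
qed

lemma eventually_eq_indicator_tendsto:
  fixes a :: "nat \<Rightarrow> real"
  assumes "(\<lambda>j. indicat_real (A j) x * a j) \<longlonglongrightarrow> l" "\<forall>\<^sub>F j in sequentially. x \<in> A j"
  shows "a \<longlonglongrightarrow> l"
proof (rule Lim_transform_eventually[OF assms(1)])
  show "\<forall>\<^sub>F j in sequentially. indicat_real (A j) x * a j = a j"
    using assms(2) by eventually_elim simp
qed

theorem theorem1p3:
  fixes s :: real and k :: "'n::finite"
  assumes "0 < s" and "s < 1" and "real CARD('n) > 2 * s"
  shows "S_const_Sr k s \<le> S_const TYPE('n) s \<and>
    (S_const_Sr k s < S_const TYPE('n) s \<longrightarrow>
      (\<exists>u \<in> D_space_Sr k s. nonzero_on (pos_halfspace k) u \<and>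
         energy s u (Sr_domain k) =
           S_const_Sr k s *
             ennreal ((Lp_norm_on (critical_exponent CARD('n) s) (pos_halfspace k) u)\<^sup>2)))"
proof (intro conjI impI)
  define p where pdef: "p = critical_exponent CARD('n) s"
  have p: "p * (real CARD('n) / 2 - s) = real CARD('n)" "p > 2"
    using assms by (simp_all add: pdef critical_exponent_def field_simps)
  have p1: "p > 1" using p by simp
  define \<theta> where "\<theta> = 2 / p"
  have \<theta>: "0 < \<theta>" "\<theta> \<le> 1" using p by (simp_all add: \<theta>_def)
  define \<kappa> where "\<kappa> = frac_const CARD('n) s / 2"
  have \<kappa>: "\<kappa> > 0" using frac_const_pos[OF assms(1,2)] by (simp add: \<kappa>_def)
  show "S_const_Sr k s \<le> S_const TYPE('n) s"
    by (rule S_const_Sr_le_S_const[OF assms(1,2) pdef p])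
  assume less: "S_const_Sr k s < S_const TYPE('n) s"
  define \<sigma> where "\<sigma> = enn2real (S_const_Sr k s)"
  have S: "S_const_Sr k s = ennreal \<sigma>" and \<sigma>: "\<sigma> \<ge> 0"
    using less by (auto simp: \<sigma>_def less_top_ennreal dest: order_less_le_trans[OF _ top_greatest])
  have lower: "ennreal (\<sigma> * enn2real (mass p (halfspace k d) u) powr \<theta>) \<le> ennreal \<kappa> * seminorm2 s (halfspace k d) u"
    if "u \<in> borel_measurable borel" "mass p (halfspace k d) u < \<infinity>" for u d
    using S_const_Sr_le_translated[OF assms(1,2) that(1) pdef p(1) that(2)] \<sigma>
    by (simp add: S \<theta>_def \<kappa>_def ennreal_mult)
  define \<tau> where "\<tau> j = \<sigma> + inverse (real (Suc j))" for j
  have \<tau>: "\<tau> j \<ge> 0" "\<tau> j \<le> \<sigma> + 1" "S_const_Sr k s < ennreal (\<tau> j)" for j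
    using \<sigma> by (simp_all add: \<tau>_def S ennreal_lessI inverse_le_1_iff add_nonneg_pos)
  have \<tau>lim: "\<tau> \<longlonglongrightarrow> \<sigma>"
    unfolding \<tau>_def using tendsto_add[OF tendsto_const LIMSEQ_inverse_real_of_nat, of \<sigma>] by simp
  define M where "M = (\<sigma> + 1) / \<kappa>"
  have M: "M > 0" using \<sigma> \<kappa> by (simp add: M_def)
  have semi_le: "seminorm2 s \<Omega> u \<le> ennreal M" if "ennreal \<kappa> * seminorm2 s \<Omega> u \<le> ennreal (\<tau> j)" for \<Omega> u j
  proof -
    have "seminorm2 s \<Omega> u = ennreal (1 / \<kappa>) * (ennreal \<kappa> * seminorm2 s \<Omega> u)"
      using \<kappa> by (simp add: mult.assoc[symmetric] ennreal_mult[symmetric])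
    also have "\<dots> \<le> ennreal (1 / \<kappa>) * ennreal (\<sigma> + 1)"
      using \<tau>(2)[of j] by (intro mult_left_mono order_trans[OF that] ennreal_leI) auto
    also have "\<dots> = ennreal M" using \<kappa> \<sigma> by (subst ennreal_mult[symmetric]) (simp_all add: M_def)
    finally show ?thesis .
  qed
  let ?B = "box 0 (\<chi> l. 2) :: (real^'n) set"
  obtain c where c: "c > 0" and resc:
    "\<And>u :: real^'n \<Rightarrow> real. u \<in> borel_measurable borel \<Longrightarrow> mass p (halfspace k 0) u = 1 \<Longrightarrow>
       seminorm2 s (halfspace k 0) u \<le> ennreal M \<Longrightarrow>
       \<exists>(d::nat) v. v \<in> borel_measurable borel \<and> mass p (halfspace k (real d)) v = 1 \<and>
         seminorm2 s (halfspace k (real d)) v = seminorm2 s (halfspace k 0) u \<and>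
         ennreal c \<le> (\<integral>\<^sup>+y\<in>?B. ennreal \<bar>v y\<bar> \<partial>lborel)"
    by (rule halfspace_nonvanishing_rescaled[where k = k, OF assms(1,3) p M]) blast
  define Q where "Q j d v \<longleftrightarrow> v \<in> borel_measurable borel \<and> mass p (halfspace k (real d)) v = 1 \<and>
      ennreal \<kappa> * seminorm2 s (halfspace k (real d)) v \<le> ennreal (\<tau> j) \<and>
      ennreal c \<le> (\<integral>\<^sup>+y\<in>?B. ennreal \<bar>v y\<bar> \<partial>lborel)" for j and d :: nat and v :: "real^'n \<Rightarrow> real"
  have "\<exists>d v. Q j d v" for j
  proof -
    obtain u :: "real^'n \<Rightarrow> real" where u: "u \<in> borel_measurable borel" "mass p (halfspace k 0) u = 1"
        "ennreal \<kappa> * seminorm2 s (halfspace k 0) u \<le> ennreal (\<tau> j)"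
      by (rule normalized_almost_minimizer[OF pdef p(2) \<tau>(3) \<kappa>_def])
    obtain d :: nat and v where "v \<in> borel_measurable borel" "mass p (halfspace k (real d)) v = 1"
         "seminorm2 s (halfspace k (real d)) v = seminorm2 s (halfspace k 0) u"
         "ennreal c \<le> (\<integral>\<^sup>+y\<in>?B. ennreal \<bar>v y\<bar> \<partial>lborel)"
      using resc[OF u(1,2) semi_le[OF u(3)]] by blast
    then show ?thesis using u(3) unfolding Q_def by (intro exI[of _ d] exI[of _ v]) simp
  qed
  then obtain d :: "nat \<Rightarrow> nat" and v :: "nat \<Rightarrow> real^'n \<Rightarrow> real" where "\<And>j. Q j (d j) (v j)"
    by metis
  then have v: "\<And>j. v j \<in> borel_measurable borel" and v1: "\<And>j. mass p (halfspace k (real (d j))) (v j) = 1"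
    and vup: "\<And>j. ennreal \<kappa> * seminorm2 s (halfspace k (real (d j))) (v j) \<le> ennreal (\<tau> j)"
    and vc: "\<And>j. ennreal c \<le> (\<integral>\<^sup>+y\<in>?B. ennreal \<bar>v j y\<bar> \<partial>lborel)"
    unfolding Q_def by blast+
  have BH: "?B \<subseteq> halfspace k (real D)" for D
  proof
    fix x assume "x \<in> ?B"
    then have "0 < x $ k" by (simp add: mem_box_cart)
    then have "- real D < x $ k" by linarith
    then show "x \<in> halfspace k (real D)" by (simp add: halfspace_def)
  qed
  have Bfin: "?B \<in> sets borel" "emeasure lborel ?B < \<infinity>"
    using emeasure_lborel_box_finite by simp_all
  consider r D where "strict_mono (r :: nat \<Rightarrow> nat)" "\<And>j. d (r j) = D" | "filterlim d at_top sequentially"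
    by (rule constant_or_diverging[of d]) blast+
  then show "\<exists>u \<in> D_space_Sr k s. nonzero_on (pos_halfspace k) u \<and> energy s u (Sr_domain k) =
           S_const_Sr k s * ennreal ((Lp_norm_on (critical_exponent CARD('n) s) (pos_halfspace k) u)\<^sup>2)"
  proof cases
    case (2)
    \<comment> \<open>the half-spaces exhaust the space, and the limit would contradict \<open>less\<close>\<close>
    obtain r where r: "strict_mono (r :: nat \<Rightarrow> nat)" and
      cv: "AE x in lborel. convergent (\<lambda>j. indicat_real (halfspace k (real (d (r j)))) x * v (r j) x)"
      by (rule bounded_energy_AE_convergent_subseq[where k = k and d = d, OF p1 assms(1) _ v _ semi_le[OF vup]])
        (use M v1 in auto)
    have mm: "(\<lambda>x. indicat_real (halfspace k (real (d (r j)))) x * v (r j) x) \<in> borel_measurable borel" for j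
      using v[of "r j"] by measurable
    obtain w where w: "w \<in> borel_measurable borel" and
      wl: "AE x in lborel. (\<lambda>j. indicat_real (halfspace k (real (d (r j)))) x * v (r j) x) \<longlonglongrightarrow> w x"
      by (rule measurable_AE_limit[OF mm cv])
    have ev: "\<forall>\<^sub>F j in sequentially. x \<in> halfspace k (real (d (r j)))" for x
    proof -
      obtain N :: nat where N: "- x $ k < real N" using reals_Archimedean2 by blast
      have "\<forall>\<^sub>F j in sequentially. N \<le> d (r j)"
        using filterlim_compose[OF 2 filterlim_subseq[OF r]] by (simp add: filterlim_at_top)
      then show ?thesis by eventually_elim (use N in \<open>auto simp: halfspace_def\<close>)
    qed
    have lim: "AE x in lborel. (\<lambda>j. v (r j) x) \<longlonglongrightarrow> w x"
      using wl by eventually_elim (rule eventually_eq_indicator_tendsto[OF _ ev])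
    note res = minimizing_sequence_limit[where \<Omega> = "\<lambda>j. halfspace k (real (d (r j)))" and \<Omega>' = UNIV
        and \<tau> = "\<lambda>j. \<tau> (r j)" and B = ?B, OF p1 \<theta> \<kappa> \<sigma> borel_halfspace _ _ ev v w lim v1 vup \<tau>(1)
        LIMSEQ_subseq_LIMSEQ[OF \<tau>lim r, unfolded comp_def] lower Bfin BH c vc]
    have w1: "0 < mass p UNIV w" "mass p UNIV w \<le> 1"
      "ennreal \<kappa> * seminorm2 s UNIV w \<le> ennreal (\<sigma> * enn2real (mass p UNIV w) powr \<theta>)"
      using res by auto
    define N where "N = enn2real (mass p UNIV w) powr \<theta>"
    have wfin: "mass p UNIV w < \<infinity>" using w1(2) by (simp add: order_le_less_trans[OF _ ennreal_one_less_top])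
    have N: "N > 0" using w1(1) wfin by (auto simp: N_def enn2real_eq_0_iff)
    have "S_const TYPE('n) s * ennreal N \<le> ennreal \<kappa> * seminorm2 s UNIV w"
      using S_const_le[OF assms(1,2) w pdef wfin] by (simp add: N_def \<theta>_def \<kappa>_def)
    also have "\<dots> \<le> S_const_Sr k s * ennreal N"
      using w1(3) \<sigma> N by (simp add: S N_def ennreal_mult)
    finally have "S_const TYPE('n) s * ennreal N / ennreal N \<le> S_const_Sr k s * ennreal N / ennreal N"
      by (rule divide_right_mono_ennreal)
    then have "S_const TYPE('n) s \<le> S_const_Sr k s" using N by (simp add: ennreal_mult_divide_eq)
    with less show ?thesis by simp
  next
    case (1 r0 D)
    \<comment> \<open>the half-space is fixed; off it the values are replaced by the optimal ones\<close>
    let ?H = "halfspace k (real D)"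
    note H = borel_halfspace[of k "real D"]
    define V where "V j = v (r0 j)" for j
    have V: "V j \<in> borel_measurable borel" "mass p ?H (V j) = 1" for j
      using v v1[of "r0 j"] by (simp_all add: V_def 1)
    have Vup: "ennreal \<kappa> * seminorm2 s ?H (V j) \<le> ennreal (\<tau> (r0 j))" for j
      using vup[of "r0 j"] by (simp add: V_def 1)
    obtain r where r: "strict_mono (r :: nat \<Rightarrow> nat)" and
      cv: "AE x in lborel. convergent (\<lambda>j. indicat_real ?H x * V (r j) x)"
      by (rule bounded_energy_AE_convergent_subseq[where k = k and d = "\<lambda>_. D", OF p1 assms(1) _ V(1) _ semi_le[OF Vup]])
        (use M V in auto)
    have mm: "(\<lambda>x. indicat_real ?H x * V (r j) x) \<in> borel_measurable borel" for j
      using V(1)[of "r j"] by measurable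
    obtain w0 where w0: "w0 \<in> borel_measurable borel" and
      wl: "AE x in lborel. (\<lambda>j. indicat_real ?H x * V (r j) x) \<longlonglongrightarrow> w0 x"
      by (rule measurable_AE_limit[OF mm cv])
    have lim0: "AE x in lborel. x \<in> ?H \<longrightarrow> (\<lambda>j. V (r j) x) \<longlonglongrightarrow> w0 x"
      using wl by eventually_elim (auto intro: eventually_eq_indicator_tendsto[where A = "\<lambda>_. ?H"])
    have "mass p ?H w0 \<le> (\<integral>\<^sup>+x. ennreal (\<bar>w0 x\<bar> powr p) \<partial>lborel)"
      unfolding mass_def by (intro nn_integral_mono) (auto simp: indicator_def)
    also have "\<dots> \<le> 1"
      by (rule Fatou_powr[OF _ _ _ wl]) (use p V mm w0 in \<open>auto simp: mass_eq_nn_integral\<close>)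
    finally have w0m: "mass p ?H w0 \<le> 1" .
    define U where "U j = optimal_extension s ?H (V (r j))" for j
    define w where "w = optimal_extension s ?H w0"
    have U: "U j \<in> borel_measurable borel" "mass p ?H (U j) = 1" for j
      unfolding U_def by (intro borel_optimal_extension V H) (simp add: mass_optimal_extension V)
    have Uup: "ennreal \<kappa> * seminorm2 s ?H (U j) \<le> ennreal (\<tau> (r0 (r j)))" for j
      unfolding U_def
      by (intro order_trans[OF mult_left_mono[OF seminorm2_optimal_extension_le[OF assms(1) p1 V(1)]] Vup]) (simp_all add: V)
    have w: "w \<in> borel_measurable borel" unfolding w_def by (intro borel_optimal_extension w0 H)
    have lim: "AE x in lborel. (\<lambda>j. U j x) \<longlonglongrightarrow> w x"
      using lim0 AE_lborel_coordinate_neq[of k "- real D"]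
    proof eventually_elim
      case (elim x)
      show ?case
      proof (cases "x \<in> ?H")
        case True
        then show ?thesis using elim by (simp add: U_def w_def optimal_extension_def)
      next
        case False
        then have "x $ k < - real D" using elim by (auto simp: halfspace_def)
        then show ?thesis unfolding U_def w_def
          by (intro optimal_extension_tendsto[OF assms(1) p1 _ V(1) w0 _ w0m lim0]) (simp_all add: V)
      qed
    qed
    have Uc: "ennreal c \<le> (\<integral>\<^sup>+y\<in>?B. ennreal \<bar>U j y\<bar> \<partial>lborel)" for j
    proof -
      have "(\<integral>\<^sup>+y\<in>?B. ennreal \<bar>U j y\<bar> \<partial>lborel) = (\<integral>\<^sup>+y\<in>?B. ennreal \<bar>v (r0 (r j)) y\<bar> \<partial>lborel)"
        using BH[of D] by (intro nn_integral_cong) (auto simp: U_def V_def optimal_extension_def indicator_def)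
      then show ?thesis using vc[of "r0 (r j)"] by simp
    qed
    have \<tau>r: "(\<lambda>j. \<tau> (r0 (r j))) \<longlonglongrightarrow> \<sigma>"
      using LIMSEQ_subseq_LIMSEQ[OF LIMSEQ_subseq_LIMSEQ[OF \<tau>lim 1(1)] r] by (simp add: comp_def)
    note res = minimizing_sequence_limit[where \<Omega> = "\<lambda>j. ?H" and \<Omega>' = ?H
        and \<tau> = "\<lambda>j. \<tau> (r0 (r j))" and B = ?B, OF p1 \<theta> \<kappa> \<sigma> H H _ _ U(1) w lim U(2) Uup \<tau>(1) \<tau>r lower Bfin BH c Uc]
    have w1: "0 < mass p ?H w" "mass p ?H w \<le> 1"
      "ennreal \<kappa> * seminorm2 s ?H w \<le> ennreal (\<sigma> * enn2real (mass p ?H w) powr \<theta>)"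
      using res by auto
    obtain u where u: "u \<in> borel_measurable borel" "mass p (halfspace k 0) u = mass p ?H w"
      "seminorm2 s (halfspace k 0) u = seminorm2 s ?H w"
      by (rule translate_to_halfspace_0[OF w p(1)])
    note H0 = borel_halfspace[of k 0]
    note u' = borel_imp_lebesgue_on[OF u(1)]
    have ufin: "mass p (halfspace k 0) u < \<infinity>"
      using w1(2) by (simp add: u order_le_less_trans[OF _ ennreal_one_less_top])
    have en: "energy s u (Sr_domain k) = ennreal \<kappa> * seminorm2 s (halfspace k 0) u"
      unfolding \<kappa>_def by (rule energy_Sr_eq) simp
    have norm: "(Lp_norm_on p (halfspace k 0) u)\<^sup>2 = enn2real (mass p (halfspace k 0) u) powr \<theta>"
      by (simp add: Lp_norm_on_eq[OF H0 u'(2)] \<theta>_def)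
    have eq: "energy s u (Sr_domain k) = ennreal (\<sigma> * enn2real (mass p (halfspace k 0) u) powr \<theta>)"
      using w1(3) lower[OF u(1) ufin] unfolding en by (intro antisym) (simp_all add: u)
    show ?thesis
    proof (intro bexI conjI)
      show "nonzero_on (pos_halfspace k) u"
        using w1(1) by (simp add: pos_halfspace_eq nonzero_on_iff[OF H0 u'(2), of p] u)
      show "energy s u (Sr_domain k) =
           S_const_Sr k s * ennreal ((Lp_norm_on (critical_exponent CARD('n) s) (pos_halfspace k) u)\<^sup>2)"
        unfolding eq S pdef[symmetric] pos_halfspace_eq norm using \<sigma> by (simp add: ennreal_mult)
      show "u \<in> D_space_Sr k s"
        using u'(1) Lp_on_iff[OF H0 u'(2), of p] ufin eq
        by (simp add: D_space_Sr_def pdef[symmetric] pos_halfspace_eq)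
    qed
  qed
qed

end
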